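(* Let $n,m\ge1$ be integers, let $k$ be an integer, let $M$ be a positive definite symmetric half-integral $m\times m$ matrix, and let $\kappa=\frac{n+1}{2}$. Define the differential operator $$H_{k,M}f=\det(Y)^{\kappa-k-1}\exp\{4\pi\,\mathrm{Tr}(MVY^{-1}V^t)\}\,\det(X_+)\left(\det(Y)^{k+1-\kappa}\exp\{-4\pi\,\mathrm{Tr}(MVY^{-1}V^t)\}f\right),$$ where $X_+=2\sqrt{-1}\frac{\partial}{\partial Z}+\sqrt{-1}Y^{-1}V^t\left(\frac{\partial}{\partial W}\right)^t+\left(\sqrt{-1}Y^{-1}V^t\left(\frac{\partial}{\partial W}\right)^t\right)^t$, $Y=\mathrm{Im}(Z)$ and $V=\mathrm{Im}(W)$. Then $H_{k,M}$ maps $J_{k,M}$ to $J_{k+2,M}$.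
   Context: $\mathbb{H}_n=\{Z\in M_{n,n}(\mathbb{C}): Z=Z^t,\ \mathrm{Im}(Z)>0\}$ and $\mathbb{H}_{n,m}=\mathbb{H}_n\times\mathbb{C}^{(m,n)}$, where $\mathbb{C}^{(m,n)}$ is the space of complex $m\times n$ matrices; points are written $(Z,W)$. Derivatives: $\frac{\partial}{\partial W}$ is the $n\times m$ matrix with $(j,i)$ entry $\frac{\partial}{\partial w_{ij}}$; $\frac{\partial}{\partial Z}$ is the symmetric $n\times n$ matrix with diagonal entries $\frac{\partial}{\partial z_{ii}}$ and off-diagonal entries $\frac12\frac{\partial}{\partial z_{ij}}$ (Wirtinger derivatives). In $X_+$ the functions are coefficients multiplying the derivatives on the left, and transposition only permutes entries; $\det(X_+)$ is the differential operator obtained from the determinant of the matrix of operators $X_+$, products being compositions. $\Gamma^J$ is the set of elements $g=\left(\begin{pmatrix}A&B\\C&D\end{pmatrix},(\lambda,\mu,\kappa_0)\right)$ with $\begin{pmatrix}A&B\\C&D\end{pmatrix}\in \mathrm{Sp}(n,\mathbb{Z})$, $\lambda,\mu\in\mathbb{Z}^{(m,n)}$, $\kappa_0\in\mathbb{Z}^{(m,m)}$ and $\kappa_0+\mu\lambda^t$ symmetric, acting by $$g(Z,W)=\left((AZ+B)(CZ+D)^{-1},\ (W+\lambda Z+\mu)(CZ+D)^{-1}\right).$$ A symmetric matrix $M$ is half-integral if $M_{ii}\in\mathbb{Z}$ and $2M_{ij}\in\mathbb{Z}$. $J_{k,M}$ is the set of (not necessarily holomorphic) smooth functions $f:\mathbb{H}_{n,m}\to\mathbb{C}$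 such that for all $g=\left(\begin{pmatrix}A&B\\C&D\end{pmatrix},(\lambda,\mu,\kappa_0)\right)\in\Gamma^J$ $$f(g(Z,W))=\det(CZ+D)^k\exp\Big(2\pi\sqrt{-1}\,\mathrm{Tr}\big\{M(W+\lambda Z+\mu)(CZ+D)^{-1}C(W+\lambda Z+\mu)^t-M(\lambda Z\lambda^t+2\lambda W^t+\kappa_0+\mu\lambda^t)\big\}\Big)f(Z,W).$$ No growth conditions are imposed. *)

theory Defs
  imports "HOL-Analysis.Analysis"
begin

text \<open>
  An \<open>m \<times> n\<close> matrix over \<open>'a\<close> has type \<open>'a^'n^'m\<close>, with \<open>m = CARD('m)\<close> and
  \<open>n = CARD('n)\<close>. Functions on the Siegel--Jacobi space are total HOL functions on
  all pairs of matrices; everything below depends only on their values on that space.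
\<close>

abbreviation cmat_of_int :: "int^'a^'b \<Rightarrow> complex^'a^'b" where
  "cmat_of_int \<equiv> map_matrix of_int"

abbreviation cmat_of_real :: "real^'a^'b \<Rightarrow> complex^'a^'b" where
  "cmat_of_real \<equiv> map_matrix of_real"

abbreviation Im_mat :: "complex^'a^'b \<Rightarrow> real^'a^'b" where
  "Im_mat \<equiv> map_matrix Im"

definition symmetric_mat :: "'a^'n^'n \<Rightarrow> bool" where
  "symmetric_mat A \<longleftrightarrow> transpose A = A"

definition positive_definite :: "real^'n^'n \<Rightarrow> bool" where
  "positive_definite A \<longleftrightarrow> symmetric_mat A \<and> (\<forall>x. x \<noteq> 0 \<longrightarrow> 0 < x \<bullet> (A *v x))"

definition half_integral :: "real^'n^'n \<Rightarrow> bool" where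
  "half_integral A \<longleftrightarrow> symmetric_mat A \<and> (\<forall>i. A $ i $ i \<in> \<int>) \<and> (\<forall>i j. 2 * A $ i $ j \<in> \<int>)"

definition block_mat ::
  "'a^'n^'n \<Rightarrow> 'a^'n^'n \<Rightarrow> 'a^'n^'n \<Rightarrow> 'a^'n^'n \<Rightarrow> 'a^('n + 'n)^('n + 'n)" where
  "block_mat A B C D = (\<chi> i j. case i of
      Inl a \<Rightarrow> (case j of Inl b \<Rightarrow> A $ a $ b | Inr b \<Rightarrow> B $ a $ b)
    | Inr a \<Rightarrow> (case j of Inl b \<Rightarrow> C $ a $ b | Inr b \<Rightarrow> D $ a $ b))"

definition Sp_int :: "(int^('n::finite + 'n)^('n + 'n)) set" where
  "Sp_int = (let J = block_mat 0 (mat 1) (- mat 1) 0 in {G. transpose G ** J ** G = J})"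

type_synonym ('n, 'm) sj_point = "(complex^'n^'n) \<times> (complex^'n^'m)"

definition siegel_jacobi_space :: "('n::finite, 'm::finite) sj_point set" where
  "siegel_jacobi_space = {(Z, W). symmetric_mat Z \<and> positive_definite (Im_mat Z)}"

type_synonym ('n, 'm) jacobi_elt =
  "((int^'n^'n) \<times> (int^'n^'n) \<times> (int^'n^'n) \<times> (int^'n^'n)) \<times>
   ((int^'n^'m) \<times> (int^'n^'m) \<times> (int^'m^'m))"

definition jacobi_group :: "('n::finite, 'm::finite) jacobi_elt set" where
  "jacobi_group = {((A, B, C, D), (l, mu, kap)).
     block_mat A B C D \<in> Sp_int \<and> symmetric_mat (kap + mu ** transpose l)}"

definition aut_denom :: "('n::finite, 'm::finite) jacobi_elt \<Rightarrow> complex^'n^'n \<Rightarrow> complex^'n^'n" where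
  "aut_denom = (\<lambda>((A, B, C, D), (l, mu, kap)) Z. cmat_of_int C ** Z + cmat_of_int D)"

definition heis_shift :: "('n::finite, 'm::finite) jacobi_elt \<Rightarrow> ('n, 'm) sj_point \<Rightarrow> complex^'n^'m" where
  "heis_shift = (\<lambda>((A, B, C, D), (l, mu, kap)) (Z, W). W + cmat_of_int l ** Z + cmat_of_int mu)"

definition jacobi_act :: "('n::finite, 'm::finite) jacobi_elt \<Rightarrow> ('n, 'm) sj_point \<Rightarrow> ('n, 'm) sj_point" where
  "jacobi_act g = (\<lambda>(Z, W).
     case g of ((A, B, C, D), (l, mu, kap)) \<Rightarrow>
       ((cmat_of_int A ** Z + cmat_of_int B) ** matrix_inv (aut_denom g Z),
        heis_shift g (Z, W) ** matrix_inv (aut_denom g Z)))"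

text \<open>
  \<open>Ck_rel r T S f\<close>: \<open>f\<close> is of class \<open>C\<^sup>r\<close> on \<open>S\<close>, where \<open>S\<close> is relatively open in the
  real linear subspace \<open>T\<close>. Only the restriction of the Frechet derivative to \<open>T\<close> is
  determined by \<open>f\<close>, hence only tangent directions \<open>v \<in> T\<close> occur in the recursion.
\<close>

primrec Ck_rel :: "nat \<Rightarrow> 'a::real_normed_vector set \<Rightarrow> 'a set \<Rightarrow>
    ('a \<Rightarrow> 'b::real_normed_vector) \<Rightarrow> bool" where
  "Ck_rel 0 T S f \<longleftrightarrow> continuous_on S f"
| "Ck_rel (Suc r) T S f \<longleftrightarrow>
     (\<exists>f'. (\<forall>p\<in>S. (f has_derivative f' p) (at p within S)) \<and>
           (\<forall>v\<in>T. Ck_rel r T S (\<lambda>p. f' p v)))"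

definition sj_tangent :: "('n::finite, 'm::finite) sj_point set" where
  "sj_tangent = {(U, X). symmetric_mat U}"

definition smooth_sj :: "(('n::finite, 'm::finite) sj_point \<Rightarrow> complex) \<Rightarrow> bool" where
  "smooth_sj f \<longleftrightarrow> (\<forall>r. Ck_rel r sj_tangent siegel_jacobi_space f)"

definition jacobi_factor :: "int \<Rightarrow> real^'m^'m \<Rightarrow>
    ('n::finite, 'm) jacobi_elt \<Rightarrow> ('n, 'm) sj_point \<Rightarrow> complex" where
  "jacobi_factor k M g = (\<lambda>(Z, W).
     case g of ((A, B, C, D), (l, mu, kap)) \<Rightarrow>
       let M' = cmat_of_real M; C' = cmat_of_int C; l' = cmat_of_int l;
           mu' = cmat_of_int mu; kap' = cmat_of_int kap;
           N = aut_denom g Z; W' = heis_shift g (Z, W)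
       in det N powi k *
          exp (2 * of_real pi * \<i> * trace (
            M' ** W' ** matrix_inv N ** C' ** transpose W'
            - M' ** (l' ** Z ** transpose l' + 2 *\<^sub>R (l' ** transpose W)
                     + kap' + mu' ** transpose l'))))"

definition jacobi_forms :: "int \<Rightarrow> real^'m^'m \<Rightarrow> (('n::finite, 'm::finite) sj_point \<Rightarrow> complex) set" where
  "jacobi_forms k M = {f. smooth_sj f \<and>
     (\<forall>g\<in>jacobi_group. \<forall>p\<in>siegel_jacobi_space.
        f (jacobi_act g p) = jacobi_factor k M g p * f p)}"

definition dir_deriv :: "'a::real_normed_vector \<Rightarrow> ('a \<Rightarrow> complex) \<Rightarrow> 'a \<Rightarrow> complex" where
  "dir_deriv v f p = vector_derivative (\<lambda>t. f (p + t *\<^sub>R v)) (at 0)"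

text \<open>
  The independent coordinates of a symmetric matrix \<open>Z\<close> are \<open>z\<^sub>i\<^sub>j = z\<^sub>j\<^sub>i\<close>, so varying
  \<open>z\<^sub>i\<^sub>j\<close> moves both entries \<open>(i, j)\<close> and \<open>(j, i)\<close>. The real and the imaginary part of a
  coordinate vary in the directions given by \<open>c = 1\<close> and \<open>c = \<i>\<close>.
\<close>

definition z_dir :: "'n \<Rightarrow> 'n \<Rightarrow> complex \<Rightarrow> ('n::finite, 'm::finite) sj_point" where
  "z_dir i j c = ((\<chi> a b. if {a, b} = {i, j} then c else 0), 0)"

definition w_dir :: "'m \<Rightarrow> 'n \<Rightarrow> complex \<Rightarrow> ('n::finite, 'm::finite) sj_point" where
  "w_dir i j c = (0, (\<chi> a b. if a = i \<and> b = j then c else 0))"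

type_synonym ('n, 'm) sj_op =
  "(('n, 'm) sj_point \<Rightarrow> complex) \<Rightarrow> ('n, 'm) sj_point \<Rightarrow> complex"

definition partial_z :: "'n \<Rightarrow> 'n \<Rightarrow> ('n::finite, 'm::finite) sj_op" where
  "partial_z i j f p = (dir_deriv (z_dir i j 1) f p - \<i> * dir_deriv (z_dir i j \<i>) f p) / 2"

definition partial_w :: "'m \<Rightarrow> 'n \<Rightarrow> ('n::finite, 'm::finite) sj_op" where
  "partial_w i j f p = (dir_deriv (w_dir i j 1) f p - \<i> * dir_deriv (w_dir i j \<i>) f p) / 2"

definition D_Z :: "'n \<Rightarrow> 'n \<Rightarrow> ('n::finite, 'm::finite) sj_op" where
  "D_Z i j f p = (if i = j then partial_z i j f p else partial_z i j f p / 2)"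

definition D_W :: "'n \<Rightarrow> 'm \<Rightarrow> ('n::finite, 'm::finite) sj_op" where
  "D_W j i = partial_w i j"

text \<open>The \<open>(a, b)\<close> entry of \<open>\<i> Y\<^sup>-\<^sup>1 V\<^sup>t (\<partial>/\<partial>W)\<^sup>t\<close>:\<close>

definition YV_D_W :: "'n \<Rightarrow> 'n \<Rightarrow> ('n::finite, 'm::finite) sj_op" where
  "YV_D_W a b f = (\<lambda>(Z, W).
     \<i> * (\<Sum>c\<in>UNIV. of_real ((matrix_inv (Im_mat Z) ** transpose (Im_mat W)) $ a $ c)
                      * D_W b c f (Z, W)))"

definition X_plus :: "'n \<Rightarrow> 'n \<Rightarrow> ('n::finite, 'm::finite) sj_op" where
  "X_plus a b f p = 2 * \<i> * D_Z a b f p + YV_D_W a b f p + YV_D_W b a f p"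

text \<open>
  Leibniz formula for the determinant of a matrix of operators; the product
  \<open>X\<^sub>1\<^sub>,\<^sub>\<sigma>\<^sub>(\<^sub>1\<^sub>) \<dots> X\<^sub>n\<^sub>,\<^sub>\<sigma>\<^sub>(\<^sub>n\<^sub>)\<close> is a composition, with the rows in increasing order.
  A linear order on the index type is needed only to fix the order of the factors;
  the entries of \<open>X_plus\<close> commute on smooth functions on the Siegel--Jacobi space.
\<close>

definition op_det :: "('n::{finite,linorder} \<Rightarrow> 'n \<Rightarrow> ('n, 'm::finite) sj_op) \<Rightarrow> ('n, 'm) sj_op" where
  "op_det X f p = (\<Sum>\<sigma> | \<sigma> permutes UNIV. of_int (sign \<sigma>) *
     foldr (\<circ>) (map (\<lambda>i. X i (\<sigma> i)) (sorted_list_of_set UNIV)) id f p)"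

definition trace_MVYV :: "real^'m^'m \<Rightarrow> ('n::finite, 'm::finite) sj_point \<Rightarrow> real" where
  "trace_MVYV M = (\<lambda>(Z, W).
     trace (M ** Im_mat W ** matrix_inv (Im_mat Z) ** transpose (Im_mat W)))"

definition H_op :: "int \<Rightarrow> real^'m^'m \<Rightarrow> ('n::{finite,linorder}, 'm) sj_op" where
  "H_op k M f p =
     (let kappa = (real CARD('n) + 1) / 2;
          detY = (\<lambda>q. det (Im_mat (fst q)))
      in of_real (detY p powr (kappa - of_int k - 1) * exp (4 * pi * trace_MVYV M p)) *
         op_det X_plus
           (\<lambda>q. of_real (detY q powr (of_int k + 1 - kappa) * exp (- 4 * pi * trace_MVYV M q)) * f q)
           p)"

end

theory Submission
  imports Defs
begin

text \<open>
  Write \<open>W = P Z + Q\<close> with \<open>P, Q\<close> real. For fixed \<open>P, Q\<close>, \<open>X\<^sub>+\<close> is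
  \<open>2 \<i> \<partial>/\<partial>Z\<close>, and \<open>exp (- 4 \<pi> Tr (M V Y\<^sup>-\<^sup>1 V\<^sup>t))\<close> is \<open>\<bar>\<theta>\<bar>\<^sup>2\<close> for the
  holomorphic function \<open>\<theta>(Z) = exp (2 \<pi> \<i> Tr (M P Z P\<^sup>t))\<close>. The antiholomorphic factor of
  \<open>\<bar>\<theta>\<bar>\<^sup>2\<close> commutes with \<open>\<partial>/\<partial>Z\<close>, so up to a constant \<open>H\<^sub>k\<^sub>,\<^sub>M f = \<theta>\<^sup>-\<^sup>1 \<delta>\<^sub>k (\<theta> f)\<close> with Maass's
  operator \<open>\<delta>\<^sub>k G = det(Y)\<^bsup>\<kappa>-k-1\<^esup> det(\<partial>/\<partial>Z) (det(Y)\<^bsup>k+1-\<kappa>\<^esup> G)\<close>. The Jacobi transformation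
  law says that \<open>\<theta> f\<close> transforms with weight \<open>k\<close> under \<open>Sp(n, \<int>)\<close>, which also moves \<open>(P, Q)\<close>, so it
  remains to see that \<open>\<delta>\<^sub>k\<close> carries weight \<open>k\<close> to weight \<open>k + 2\<close> under real symplectic maps.

  A symplectic map is a composition of maps \<open>Z \<mapsto> g Z g\<^sup>t + S\<close>, for which this is the
  multilinearity of \<open>det(\<partial>/\<partial>Z)\<close>, and of maps \<open>Z \<mapsto> Z (1 + S Z)\<^sup>-\<^sup>1\<close>. The latter are additive in
  \<open>S\<close>, so \<open>S = t e e\<^sup>t\<close> suffices. Then only one row and one column of the matrix \<open>\<partial>/\<partial>Z\<close> are
  affected, each monomial of the determinant acquires at most one term of lower order, and these
  terms cancel because \<open>\<kappa> - 1 = (n - 1) / 2\<close>.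
\<close>

subsection \<open>Smoothness on relatively open subsets of a subspace\<close>

text \<open>For S = t e e^t all rows of (1 + S Z)^-1 except row e are constant, and row e depends on
  Z only through column e. A monomial of the determinant contains either the (e, e) entry of
  \<partial>/\<partial>Z or exactly one entry in each of row e and column e; all its other entries
  pass through the substitution unchanged. Let K_r be the monomial of the complementary minor for a
  permutation r fixing e. Up to a common factor, r contributes c K_r, where c is the exponent of the
  automorphy factor, and each of the n - 1 permutations r \<circ> (e a), of opposite sign,
  contributes - K_r / 2. The total coefficient c + (n - 1) / 2 vanishes for c = 1 - \<kappa>, which
  is where \<kappa> comes from. The factorisation needs an invertible lower right block, which a
  symplectic matrix need not have; a real translation repairs this. Symmetric matrices are not open
  among all matrices, so differential calculus is set up relative to a tangent subspace T, along
  which alone derivatives are determined.\<close>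

locale rel_open_set =
  fixes T S :: "'a::euclidean_space set"
  assumes subspace_T: "subspace T"
    and S_sub_T: "S \<subseteq> T"
    and rel_open: "p \<in> S \<Longrightarrow> \<exists>e>0. \<forall>q\<in>T. dist q p < e \<longrightarrow> q \<in> S"
begin

definition smooth :: "('a \<Rightarrow> complex) \<Rightarrow> bool" where
  "smooth f \<longleftrightarrow> (\<forall>r. Ck_rel r T S f)"

lemma eventually_line_in:
  assumes "p \<in> S" "v \<in> T"
  shows "eventually (\<lambda>t::real. p + t *\<^sub>R v \<in> S) (nhds 0)"
proof -
  obtain e where e: "e > 0" "\<And>q. q \<in> T \<Longrightarrow> dist q p < e \<Longrightarrow> q \<in> S"
    using rel_open[OF assms(1)] by blast
  have "((\<lambda>t::real. p + t *\<^sub>R v) \<longlongrightarrow> p + 0 *\<^sub>R v) (nhds 0)"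
    by (intro tendsto_intros filterlim_ident)
  then have "eventually (\<lambda>t::real. dist (p + t *\<^sub>R v) p < e) (nhds 0)"
    using e(1) by (simp add: tendsto_iff)
  then show ?thesis
  proof eventually_elim
    case (elim t)
    have "p + t *\<^sub>R v \<in> T"
      using assms S_sub_T subspace_T by (meson subsetD subspace_add subspace_scale)
    then show ?case using e(2) elim by blast
  qed
qed

text \<open>Links the two kinds of derivative in play: \<open>dir_deriv\<close> is two-sided along a
  line, and the line stays in \<open>S\<close> for small parameters because \<open>S\<close> is
  relatively open, so a Frechet derivative within \<open>S\<close> determines it in tangent
  directions.\<close>

lemma has_vector_derivative_line:
  assumes f: "(f has_derivative f') (at p within S)" and p: "p \<in> S" and v: "v \<in> T"
  shows "((\<lambda>t::real. f (p + t *\<^sub>R v)) has_vector_derivative f' v) (at 0)"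
proof -
  obtain A where A: "open A" "(0::real) \<in> A" "\<And>t. t \<in> A \<Longrightarrow> p + t *\<^sub>R v \<in> S"
    using eventually_line_in[OF p v] unfolding eventually_nhds by blast
  have "((\<lambda>t::real. p + t *\<^sub>R v) has_derivative (\<lambda>t. t *\<^sub>R v)) (at 0 within A)"
    by (auto intro!: derivative_eq_intros)
  moreover have "(f has_derivative f') (at (p + (0::real) *\<^sub>R v) within ((\<lambda>t::real. p + t *\<^sub>R v) ` A))"
    using has_derivative_subset[OF f, of "(\<lambda>t::real. p + t *\<^sub>R v) ` A"] A(3)
    by (simp add: image_subset_iff)
  ultimately have "((\<lambda>t::real. f (p + t *\<^sub>R v)) has_derivative (\<lambda>t. f' (t *\<^sub>R v))) (at 0 within A)"
    using has_derivative_in_compose by fastforce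
  then have "((\<lambda>t::real. f (p + t *\<^sub>R v)) has_derivative (\<lambda>t. f' (t *\<^sub>R v))) (at 0)"
    using A at_within_open by metis
  then show ?thesis
    using f by (simp add: has_vector_derivative_def linear_cmul[OF has_derivative_linear[OF f]])
qed

lemma dir_deriv_eq:
  assumes "(f has_derivative f') (at p within S)" "p \<in> S" "v \<in> T"
  shows "dir_deriv v f p = f' v"
  unfolding dir_deriv_def
  by (rule vector_derivative_at[OF has_vector_derivative_line[OF assms]])

lemma Ck_rel_cong:
  assumes "\<And>p. p \<in> S \<Longrightarrow> f p = g p"
  shows "Ck_rel r T S f \<longleftrightarrow> Ck_rel r T S g"
proof (cases r)
  case 0
  then show ?thesis using assms by (simp cong: continuous_on_cong)
next
  case (Suc r')
  have "(f has_derivative f') (at p within S) \<longleftrightarrow> (g has_derivative f') (at p within S)"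
    if "p \<in> S" for p f'
    using assms that by (intro iffI; metis has_derivative_transform)
  then show ?thesis using Suc by simp
qed

lemma smooth_cong:
  assumes "\<And>p. p \<in> S \<Longrightarrow> f p = g p"
  shows "smooth f \<longleftrightarrow> smooth g"
  unfolding smooth_def by (simp add: Ck_rel_cong[of f g, OF assms])

lemma smooth_transform: "smooth f \<Longrightarrow> (\<And>p. p \<in> S \<Longrightarrow> f p = g p) \<Longrightarrow> smooth g"
  by (simp add: smooth_cong[of f g])

lemma Ck_rel_SucE:
  assumes "Ck_rel (Suc r) T S f"
  obtains f' where "\<And>p. p \<in> S \<Longrightarrow> (f has_derivative f' p) (at p within S)"
    "\<And>v. v \<in> T \<Longrightarrow> Ck_rel r T S (\<lambda>p. f' p v)"
  using assms by auto

lemma Ck_rel_SucI: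
  assumes "\<And>p. p \<in> S \<Longrightarrow> (f has_derivative f' p) (at p within S)"
    and "\<And>v. v \<in> T \<Longrightarrow> Ck_rel r T S (\<lambda>p. f' p v)"
  shows "Ck_rel (Suc r) T S f"
  using assms by auto

text \<open>The derivative in \<open>Ck_rel\<close> is an existential witness that may differ for
  every order; in tangent directions it must equal \<open>dir_deriv v f\<close>. This makes the
  witness canonical and lets directional derivatives inherit smoothness.\<close>

lemma Ck_rel_Suc_dir_deriv:
  assumes "Ck_rel (Suc r) T S f"
  shows "p \<in> S \<Longrightarrow> \<exists>f'. (f has_derivative f') (at p within S)"
    and "v \<in> T \<Longrightarrow> Ck_rel r T S (dir_deriv v f)"
proof -
  obtain f' where f': "\<And>p. p \<in> S \<Longrightarrow> (f has_derivative f' p) (at p within S)"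
    "\<And>v. v \<in> T \<Longrightarrow> Ck_rel r T S (\<lambda>p. f' p v)"
    using assms by auto
  show "p \<in> S \<Longrightarrow> \<exists>f'. (f has_derivative f') (at p within S)" using f' by blast
  show "Ck_rel r T S (dir_deriv v f)" if "v \<in> T"
    using f'(2)[OF that] Ck_rel_cong[of "dir_deriv v f" "\<lambda>p. f' p v" r] dir_deriv_eq f'(1) that
    by blast
qed

lemma Ck_rel_SucD: "Ck_rel (Suc r) T S f \<Longrightarrow> Ck_rel r T S f"
proof (induction r arbitrary: f)
  case 0
  then show ?case
    by (auto simp: continuous_on_eq_continuous_within intro: has_derivative_continuous)
next
  case (Suc r)
  then obtain f' where f': "\<And>p. p \<in> S \<Longrightarrow> (f has_derivative f' p) (at p within S)"
    "\<And>v. v \<in> T \<Longrightarrow> Ck_rel (Suc r) T S (\<lambda>p. f' p v)"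
    by (metis Ck_rel.simps(2))
  show ?case using Ck_rel_SucI[OF f'(1) Suc.IH[OF f'(2)]] .
qed

lemma
  assumes "smooth f"
  shows smooth_has_derivative: "p \<in> S \<Longrightarrow> \<exists>f'. (f has_derivative f') (at p within S)"
    and smooth_dir_deriv: "v \<in> T \<Longrightarrow> smooth (dir_deriv v f)"
  using assms Ck_rel_Suc_dir_deriv unfolding smooth_def by metis+

lemma smooth_continuous_on: "smooth f \<Longrightarrow> continuous_on S f"
  unfolding smooth_def using Ck_rel.simps(1) by metis

section \<open>Closure properties of smooth functions\<close>

lemma Ck_rel_const: "Ck_rel r T S (\<lambda>p. c :: complex)"
  by (induction r arbitrary: c) (auto intro!: exI[of _ "\<lambda>p v. 0"])

lemma smooth_const [simp]: "smooth (\<lambda>p. c)"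
  unfolding smooth_def using Ck_rel_const by blast

lemma smooth_linear:
  assumes "bounded_linear L"
  shows "smooth L"
  unfolding smooth_def
proof
  fix r show "Ck_rel r T S L"
  proof (cases r)
    case 0
    then show ?thesis using assms by (simp add: linear_continuous_on)
  next
    case (Suc r')
    then show ?thesis
      using bounded_linear_imp_has_derivative[OF assms] Ck_rel_SucI[of L "\<lambda>p. L" r'] Ck_rel_const
      by blast
  qed
qed

lemma Ck_rel_add:
  fixes f g :: "'a \<Rightarrow> complex"
  shows "Ck_rel r T S f \<Longrightarrow> Ck_rel r T S g \<Longrightarrow> Ck_rel r T S (\<lambda>p. f p + g p)"
proof (induction r arbitrary: f g)
  case 0
  then show ?case by (auto intro: continuous_intros)
next
  case (Suc r)
  obtain f' where f': "\<And>p. p \<in> S \<Longrightarrow> (f has_derivative f' p) (at p within S)"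
    "\<And>v. v \<in> T \<Longrightarrow> Ck_rel r T S (\<lambda>p. f' p v)" by (rule Ck_rel_SucE[OF Suc.prems(1)]) blast
  obtain g' where g': "\<And>p. p \<in> S \<Longrightarrow> (g has_derivative g' p) (at p within S)"
    "\<And>v. v \<in> T \<Longrightarrow> Ck_rel r T S (\<lambda>p. g' p v)" by (rule Ck_rel_SucE[OF Suc.prems(2)]) blast
  show ?case
    by (rule Ck_rel_SucI[where f' = "\<lambda>p v. f' p v + g' p v"])
       (use f' g' Suc.IH in \<open>auto intro: has_derivative_add\<close>)
qed

lemma Ck_rel_mult:
  fixes f g :: "'a \<Rightarrow> complex"
  shows "Ck_rel r T S f \<Longrightarrow> Ck_rel r T S g \<Longrightarrow> Ck_rel r T S (\<lambda>p. f p * g p)"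
proof (induction r arbitrary: f g)
  case 0
  then show ?case by (auto intro: continuous_intros)
next
  case (Suc r)
  obtain f' where f': "\<And>p. p \<in> S \<Longrightarrow> (f has_derivative f' p) (at p within S)"
    "\<And>v. v \<in> T \<Longrightarrow> Ck_rel r T S (\<lambda>p. f' p v)" by (rule Ck_rel_SucE[OF Suc.prems(1)]) blast
  obtain g' where g': "\<And>p. p \<in> S \<Longrightarrow> (g has_derivative g' p) (at p within S)"
    "\<And>v. v \<in> T \<Longrightarrow> Ck_rel r T S (\<lambda>p. g' p v)" by (rule Ck_rel_SucE[OF Suc.prems(2)]) blast
  have fg: "Ck_rel r T S f" "Ck_rel r T S g" using Suc.prems Ck_rel_SucD by blast+
  show ?case
    by (rule Ck_rel_SucI[where f' = "\<lambda>p v. f p * g' p v + f' p v * g p"])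
       (use f' g' Suc.IH fg Ck_rel_add in \<open>auto intro: has_derivative_mult\<close>)
qed

lemma smooth_add: "smooth f \<Longrightarrow> smooth g \<Longrightarrow> smooth (\<lambda>p. f p + g p)"
  and smooth_mult: "smooth f \<Longrightarrow> smooth g \<Longrightarrow> smooth (\<lambda>p. f p * g p)"
  unfolding smooth_def using Ck_rel_add Ck_rel_mult by blast+

lemma smooth_minus: "smooth f \<Longrightarrow> smooth (\<lambda>p. - f p)"
  using smooth_mult[of "\<lambda>_. -1" f] by simp

lemma smooth_diff: "smooth f \<Longrightarrow> smooth g \<Longrightarrow> smooth (\<lambda>p. f p - g p)"
  using smooth_add[of f "\<lambda>p. - g p"] smooth_minus by simp

lemma smooth_divide_const: "smooth f \<Longrightarrow> smooth (\<lambda>p. f p / c)"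
  using smooth_mult[of f "\<lambda>_. 1 / c"] by simp

lemma smooth_sum: "(\<And>i. i \<in> I \<Longrightarrow> smooth (f i)) \<Longrightarrow> smooth (\<lambda>p. \<Sum>i\<in>I. f i p)"
  by (induction I rule: infinite_finite_induct) (auto intro: smooth_add)

lemma smooth_prod: "(\<And>i. i \<in> I \<Longrightarrow> smooth (f i)) \<Longrightarrow> smooth (\<lambda>p. \<Prod>i\<in>I. f i p)"
  by (induction I rule: infinite_finite_induct) (auto intro: smooth_mult)

lemma smooth_power: "smooth f \<Longrightarrow> smooth (\<lambda>p. f p ^ k)"
  by (induction k) (auto intro: smooth_mult)

text \<open>Bootstrapping from a differential equation: each derivative is a smooth multiple of \<open>g\<close>.\<close>

lemma smooth_log_derivative:
  assumes g: "\<And>p. p \<in> S \<Longrightarrow> (g has_derivative (\<lambda>v. h p v * g p)) (at p within S)"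
    and h: "\<And>v. v \<in> T \<Longrightarrow> smooth (\<lambda>p. h p v)"
  shows "smooth g"
  unfolding smooth_def
proof
  fix r show "Ck_rel r T S g"
  proof (induction r)
    case 0
    then show ?case using g
      by (auto simp: continuous_on_eq_continuous_within intro: has_derivative_continuous)
  next
    case (Suc r)
    then show ?case
      using h Ck_rel_SucI[of g "\<lambda>p v. h p v * g p" r] g Ck_rel_mult unfolding smooth_def by blast
  qed
qed

lemma smooth_derivative:
  assumes "smooth f" "v \<in> T" "\<And>p. p \<in> S \<Longrightarrow> (f has_derivative f' p) (at p within S)"
  shows "smooth (\<lambda>p. f' p v)"
  using smooth_dir_deriv[OF assms(1,2)] smooth_cong[of "dir_deriv v f" "\<lambda>p. f' p v"]
    dir_deriv_eq assms(2,3) by blast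

lemma smooth_obtain_derivative:
  assumes "smooth f"
  obtains f' where "\<And>p. p \<in> S \<Longrightarrow> (f has_derivative f' p) (at p within S)"
    "\<And>v. v \<in> T \<Longrightarrow> smooth (\<lambda>p. f' p v)"
proof -
  obtain f' where f': "\<And>p. p \<in> S \<Longrightarrow> (f has_derivative f' p) (at p within S)"
    using smooth_has_derivative[OF assms] by metis
  then show ?thesis using that smooth_derivative[OF assms] by blast
qed

text \<open>The derivative of 1/f is - f'/f^2, a product of factors 1/f with a smooth function, so
  the induction on the order gains one derivative at each step.\<close>

lemma smooth_inverse:
  assumes f: "smooth f" and nz: "\<And>p. p \<in> S \<Longrightarrow> f p \<noteq> 0"
  shows "smooth (\<lambda>p. inverse (f p))"
proof -
  obtain f' where f': "\<And>p. p \<in> S \<Longrightarrow> (f has_derivative f' p) (at p within S)"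
    "\<And>v. v \<in> T \<Longrightarrow> smooth (\<lambda>p. f' p v)" using smooth_obtain_derivative[OF f] by blast
  show ?thesis unfolding smooth_def
  proof
    fix r show "Ck_rel r T S (\<lambda>p. inverse (f p))"
    proof (induction r)
      case 0
      then show ?case using smooth_continuous_on[OF f] nz by (auto intro: continuous_intros)
    next
      case (Suc r)
      show ?case
      proof (rule Ck_rel_SucI[where f' = "\<lambda>p v. (-1) * (inverse (f p) * f' p v * inverse (f p))"])
        show "((\<lambda>p. inverse (f p)) has_derivative (\<lambda>v. (-1) * (inverse (f p) * f' p v * inverse (f p))))
          (at p within S)" if "p \<in> S" for p
          using Deriv.has_derivative_inverse[OF nz[OF that] f'(1)[OF that]] by simp
        show "Ck_rel r T S (\<lambda>p. (-1) * (inverse (f p) * f' p v * inverse (f p)))" if "v \<in> T" for v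
          using Ck_rel_mult[OF Ck_rel_const[of r "-1"] Ck_rel_mult[OF Ck_rel_mult[OF Suc _] Suc]]
            f'(2)[OF that] unfolding smooth_def by blast
      qed
    qed
  qed
qed

lemma smooth_powi:
  assumes "smooth f" "\<And>p. p \<in> S \<Longrightarrow> f p \<noteq> 0"
  shows "smooth (\<lambda>p. f p powi k)"
  using smooth_power[OF assms(1)] smooth_power[OF smooth_inverse[OF assms]]
  by (cases "k \<ge> 0") (simp_all add: power_int_def)

lemma smooth_exp:
  assumes f: "smooth f"
  shows "smooth (\<lambda>p. exp (f p))"
proof -
  obtain f' where f': "\<And>p. p \<in> S \<Longrightarrow> (f has_derivative f' p) (at p within S)"
    "\<And>v. v \<in> T \<Longrightarrow> smooth (\<lambda>p. f' p v)" using smooth_obtain_derivative[OF f] by blast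
  show ?thesis
  proof (rule smooth_log_derivative[where h = f'])
    show "((\<lambda>p. exp (f p)) has_derivative (\<lambda>v. f' p v * exp (f p))) (at p within S)" if "p \<in> S" for p
      using has_derivative_compose[OF f'(1)[OF that] DERIV_exp[unfolded has_field_derivative_def]]
      by (simp add: mult.commute)
  qed (use f' in auto)
qed

lemma smooth_cnj:
  assumes f: "smooth f"
  shows "smooth (\<lambda>p. cnj (f p))"
proof -
  have "Ck_rel r T S f \<Longrightarrow> Ck_rel r T S (\<lambda>p. cnj (f p))" for r and f :: "'a \<Rightarrow> complex"
  proof (induction r arbitrary: f)
    case 0
    then show ?case by (auto intro: continuous_intros)
  next
    case (Suc r)
    obtain f' where f': "\<And>p. p \<in> S \<Longrightarrow> (f has_derivative f' p) (at p within S)"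
      "\<And>v. v \<in> T \<Longrightarrow> Ck_rel r T S (\<lambda>p. f' p v)" using Suc.prems by auto
    show ?case
      by (rule Ck_rel_SucI[where f' = "\<lambda>p v. cnj (f' p v)"])
         (use f' Suc.IH in \<open>auto intro: has_derivative_cnj\<close>)
  qed
  then show ?thesis using f unfolding smooth_def by blast
qed

lemma smooth_Re: "smooth f \<Longrightarrow> smooth (\<lambda>p. of_real (Re (f p)))"
  and smooth_Im: "smooth f \<Longrightarrow> smooth (\<lambda>p. of_real (Im (f p)))"
proof -
  assume f: "smooth f"
  have "(\<lambda>p. of_real (Re (f p))) = (\<lambda>p. (f p + cnj (f p)) / 2)"
    by (simp add: fun_eq_iff complex_eq_iff)
  then show "smooth (\<lambda>p. of_real (Re (f p)))"
    using smooth_divide_const[OF smooth_add[OF f smooth_cnj[OF f]]] by simp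
  have Im_eq: "complex_of_real (Im (f p)) = (f p - cnj (f p)) / (2 * \<i>)" for p
    by (simp add: complex_eq_iff)
  show "smooth (\<lambda>p. of_real (Im (f p)))"
    unfolding Im_eq by (rule smooth_divide_const[OF smooth_diff[OF f smooth_cnj[OF f]]])
qed

lemmas smooth_intros = smooth_const smooth_add smooth_mult smooth_diff smooth_minus
  smooth_divide_const smooth_sum smooth_prod smooth_cnj smooth_Re smooth_Im smooth_exp

lemma smooth_powr:
  fixes f :: "'a \<Rightarrow> real"
  assumes f: "smooth (\<lambda>p. of_real (f p))" and pos: "\<And>p. p \<in> S \<Longrightarrow> f p > 0"
  shows "smooth (\<lambda>p. of_real (f p powr s))"
proof -
  obtain f' where f': "\<And>p. p \<in> S \<Longrightarrow> ((\<lambda>p. complex_of_real (f p)) has_derivative f' p) (at p within S)"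
    "\<And>v. v \<in> T \<Longrightarrow> smooth (\<lambda>p. f' p v)" using smooth_obtain_derivative[OF f] by blast
  have fr: "(f has_derivative (\<lambda>v. Re (f' p v))) (at p within S)" if "p \<in> S" for p
    using has_derivative_Re[OF f'(1)[OF that]] by simp
  show ?thesis
  \<comment> \<open>The logarithmic derivative s f'/f is smooth since f is positive;
    \<open>Re\<close> only turns the derivative of the complex-valued copy of f back into a real
    one.\<close>
  proof (rule smooth_log_derivative[where h = "\<lambda>p v. of_real s * (of_real (Re (f' p v)) * inverse (of_real (f p)))"])
    fix p assume p: "p \<in> S"
    have "((\<lambda>p. f p powr s) has_derivative (\<lambda>v. s * (Re (f' p v) * inverse (f p)) * f p powr s)) (at p within S)"
      using pos[OF p] p fr[OF p]
      by (auto intro!: derivative_eq_intros simp: fun_eq_iff field_simps powr_diff)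
    then show "((\<lambda>p. complex_of_real (f p powr s)) has_derivative
       (\<lambda>v. of_real s * (of_real (Re (f' p v)) * inverse (of_real (f p))) * of_real (f p powr s))) (at p within S)"
      by (rule has_derivative_eq_rhs[OF has_derivative_of_real]) (simp add: of_real_inverse)
  next
    fix v assume v: "v \<in> T"
    show "smooth (\<lambda>p. of_real s * (of_real (Re (f' p v)) * inverse (of_real (f p))))"
      using smooth_mult[OF smooth_const smooth_mult[OF smooth_Re[OF f'(2)[OF v]] smooth_inverse[OF f]]] pos
      by force
  qed
qed

text \<open>Two applications of the mean value theorem to the second difference of \<open>g\<close>, one in each order.\<close>

lemma mixed_partials_meet:
  fixes g :: "real \<Rightarrow> real \<Rightarrow> real"
  assumes d: "d > 0"
    and gs: "\<And>s t. \<lbrakk>s \<in> {0..d}; t \<in> {0..d}\<rbrakk> \<Longrightarrow> ((\<lambda>s. g s t) has_real_derivative gs s t) (at s)"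
    and gt: "\<And>s t. \<lbrakk>s \<in> {0..d}; t \<in> {0..d}\<rbrakk> \<Longrightarrow> ((\<lambda>t. g s t) has_real_derivative gt s t) (at t)"
    and gst: "\<And>s t. \<lbrakk>s \<in> {0..d}; t \<in> {0..d}\<rbrakk> \<Longrightarrow> ((\<lambda>t. gs s t) has_real_derivative gst s t) (at t)"
    and gts: "\<And>s t. \<lbrakk>s \<in> {0..d}; t \<in> {0..d}\<rbrakk> \<Longrightarrow> ((\<lambda>s. gt s t) has_real_derivative gts s t) (at s)"
  shows "\<exists>s t s' t'. {s, t, s', t'} \<subseteq> {0..d} \<and> gst s t = gts s' t'"
proof -
  have "\<exists>s>0. s < d \<and> (g d d - g d 0) - (g 0 d - g 0 0) = (d - 0) * (gs s d - gs s 0)"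
    by (rule MVT2[OF d, of "\<lambda>s. g s d - g s 0"]) (use d gs in \<open>auto intro!: derivative_eq_intros\<close>)
  then obtain s where s: "0 < s" "s < d" "(g d d - g d 0) - (g 0 d - g 0 0) = d * (gs s d - gs s 0)"
    by auto
  have "\<exists>t>0. t < d \<and> gs s d - gs s 0 = (d - 0) * gst s t"
    by (rule MVT2[OF d]) (use s gst in auto)
  then obtain t where t: "0 < t" "t < d" "gs s d - gs s 0 = d * gst s t" by auto
  have "\<exists>t>0. t < d \<and> (g d d - g 0 d) - (g d 0 - g 0 0) = (d - 0) * (gt d t - gt 0 t)"
    by (rule MVT2[OF d, of "\<lambda>t. g d t - g 0 t"]) (use d gt in \<open>auto intro!: derivative_eq_intros\<close>)
  then obtain t' where t': "0 < t'" "t' < d" "(g d d - g 0 d) - (g d 0 - g 0 0) = d * (gt d t' - gt 0 t')"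
    by auto
  have "\<exists>s>0. s < d \<and> gt d t' - gt 0 t' = (d - 0) * gts s t'"
    by (rule MVT2[OF d]) (use t' gts in auto)
  then obtain s' where s': "0 < s'" "s' < d" "gt d t' - gt 0 t' = d * gts s' t'" by auto
  have "d * (d * gst s t) = d * (d * gts s' t')"
    using s(3) t(3) t'(3) s'(3) by (simp add: algebra_simps)
  then show ?thesis using d s t s' t' by (intro exI[of _ s] exI[of _ t] exI[of _ s'] exI[of _ t']) auto
qed

lemma dir_deriv_along_line:
  assumes f: "smooth f" and q: "p + s *\<^sub>R u \<in> S" and u: "u \<in> T" and h: "bounded_linear h"
  shows "((\<lambda>s. h (f (p + s *\<^sub>R u))) has_real_derivative h (dir_deriv u f (p + s *\<^sub>R u))) (at s)"
proof -
  obtain f' where f': "(f has_derivative f') (at (p + s *\<^sub>R u) within S)"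
    using smooth_has_derivative[OF f q] by blast
  have "((\<lambda>t. f ((p + s *\<^sub>R u) + t *\<^sub>R u)) has_vector_derivative dir_deriv u f (p + s *\<^sub>R u)) (at 0)"
    using has_vector_derivative_line[OF f' q u] dir_deriv_eq[OF f' q u] by simp
  then have "((\<lambda>t. h (f (p + (t + s) *\<^sub>R u))) has_vector_derivative h (dir_deriv u f (p + s *\<^sub>R u))) (at 0)"
    by (intro bounded_linear.has_vector_derivative[OF h]) (simp add: algebra_simps)
  then show ?thesis
    using iffD2[OF DERIV_shift[of "\<lambda>t. h (f (p + t *\<^sub>R u))" "h (dir_deriv u f (p + s *\<^sub>R u))" 0 s]]
    unfolding has_real_derivative_iff_has_vector_derivative[symmetric] by simp
qed

text \<open>The mean value theorem concerns real functions, so f is composed with \<open>h\<close>,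
  which will be \<open>Re\<close> or \<open>Im\<close>. On arbitrarily small squares the two mixed
  derivatives share a value, and continuity transfers this to p.\<close>

lemma dir_deriv_commute:
  assumes f: "smooth f" and p: "p \<in> S" and u: "u \<in> T" and v: "v \<in> T"
  shows "dir_deriv u (dir_deriv v f) p = dir_deriv v (dir_deriv u f) p"
proof -
  let ?q = "\<lambda>s t. p + s *\<^sub>R u + t *\<^sub>R v"
  define F1 where "F1 = dir_deriv v (dir_deriv u f)"
  define F2 where "F2 = dir_deriv u (dir_deriv v f)"
  have sm: "smooth (dir_deriv u f)" "smooth (dir_deriv v f)" "smooth F1" "smooth F2"
    unfolding F1_def F2_def using smooth_dir_deriv f u v by blast+
  have eq: "h (F1 p) = h (F2 p)" if h: "bounded_linear h" for h :: "complex \<Rightarrow> real"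
  proof (rule ccontr)
    assume ne: "h (F1 p) \<noteq> h (F2 p)"
    \<comment> \<open>Both mixed derivatives stay within e of their values at p, so a common value
      on the square would bring these values closer than 2 e, which is their distance.\<close>
    define e where "e = \<bar>h (F1 p) - h (F2 p)\<bar> / 2"
    have e: "e > 0" using ne by (simp add: e_def)
    have cont: "continuous_on S (\<lambda>q. h (F1 q))" "continuous_on S (\<lambda>q. h (F2 q))"
      using smooth_continuous_on sm bounded_linear.continuous_on[OF h] by blast+
    obtain d1 where d1: "d1 > 0" "\<And>q. q \<in> S \<Longrightarrow> dist q p < d1 \<Longrightarrow> dist (h (F1 q)) (h (F1 p)) < e"
      using cont(1) p e unfolding continuous_on_iff by blast
    obtain d2 where d2: "d2 > 0" "\<And>q. q \<in> S \<Longrightarrow> dist q p < d2 \<Longrightarrow> dist (h (F2 q)) (h (F2 p)) < e"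
      using cont(2) p e unfolding continuous_on_iff by blast
    obtain d3 where d3: "d3 > 0" "\<And>q. q \<in> T \<Longrightarrow> dist q p < d3 \<Longrightarrow> q \<in> S"
      using rel_open[OF p] by blast
    define D where "D = Min {d1, d2, d3}"
    have D: "D > 0" "D \<le> d1" "D \<le> d2" "D \<le> d3" using d1 d2 d3 by (auto simp: D_def)
    \<comment> \<open>The summand 1 keeps N positive when u = v = 0; with side D / (2 N) the square
      spanned by u and v lies within distance D of p.\<close>
    define N where "N = norm u + norm v + 1"
    have N: "N > 0" by (simp add: N_def add_nonneg_pos)
    define d where "d = D / (2 * N)"
    have d: "d > 0" using D N by (simp add: d_def)
    have near: "?q s t \<in> S \<and> dist (?q s t) p < D"
      if "s \<in> {0..d}" "t \<in> {0..d}" for s t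
    proof -
      have "dist (?q s t) p = norm (s *\<^sub>R u + t *\<^sub>R v)" by (simp add: dist_norm algebra_simps)
      also have "\<dots> \<le> s * norm u + t * norm v"
        using norm_triangle_ineq[of "s *\<^sub>R u" "t *\<^sub>R v"] that by simp
      also have "\<dots> \<le> d * norm u + d * norm v"
        using that by (intro add_mono mult_right_mono) auto
      also have "\<dots> \<le> d * N" using d by (simp add: N_def algebra_simps)
      also have "\<dots> < D" using D N by (simp add: d_def)
      finally have lt: "dist (?q s t) p < D" .
      have "?q s t \<in> T"
        using p u v S_sub_T subspace_T by (meson subsetD subspace_add subspace_scale)
      then show ?thesis using d3(2) lt D by auto
    qed
    have swap: "p + s *\<^sub>R u + t *\<^sub>R v = p + t *\<^sub>R v + s *\<^sub>R u" for s t by simp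
    have "\<exists>s t s' t'. {s, t, s', t'} \<subseteq> {0..d} \<and>
       h (F1 (?q s t)) = h (F2 (?q s' t'))"
    proof (rule mixed_partials_meet[OF d, where g = "\<lambda>s t. h (f (?q s t))"
          and gs = "\<lambda>s t. h (dir_deriv u f (?q s t))"
          and gt = "\<lambda>s t. h (dir_deriv v f (?q s t))"])
      fix s t assume st: "s \<in> {0..d}" "t \<in> {0..d}"
      have S1: "?q s t \<in> S" and S2: "p + t *\<^sub>R v + s *\<^sub>R u \<in> S"
        using near[OF st] by (simp_all add: swap)
      show "((\<lambda>t. h (f (?q s t))) has_real_derivative
          h (dir_deriv v f (?q s t))) (at t)"
        by (rule dir_deriv_along_line[OF f S1 v h])
      show "((\<lambda>t. h (dir_deriv u f (?q s t))) has_real_derivative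
          h (F1 (?q s t))) (at t)"
        unfolding F1_def by (rule dir_deriv_along_line[OF sm(1) S1 v h])
      show "((\<lambda>s. h (f (?q s t))) has_real_derivative
          h (dir_deriv u f (?q s t))) (at s)"
        unfolding swap by (rule dir_deriv_along_line[OF f S2 u h])
      show "((\<lambda>s. h (dir_deriv v f (?q s t))) has_real_derivative
          h (F2 (?q s t))) (at s)"
        unfolding swap F2_def by (rule dir_deriv_along_line[OF sm(2) S2 u h])
    qed
    then obtain s t s' t' where st: "{s, t, s', t'} \<subseteq> {0..d}"
      "h (F1 (?q s t)) = h (F2 (?q s' t'))" by blast
    have "dist (h (F1 (?q s t))) (h (F1 p)) < e"
      using near[of s t] st(1) d1(2) D by auto
    moreover have "dist (h (F2 (?q s' t'))) (h (F2 p)) < e"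
      using near[of s' t'] st(1) d2(2) D by auto
    ultimately have "\<bar>h (F1 p) - h (F2 p)\<bar> < 2 * e" using st(2) by (simp add: dist_real_def)
    then show False by (simp add: e_def)
  qed
  show ?thesis
    using eq[OF bounded_linear_Re] eq[OF bounded_linear_Im] unfolding F1_def F2_def
    by (simp add: complex_eq_iff)
qed

end

text \<open>Derivatives of \<open>f\<close> are controlled only in directions of \<open>T2\<close>,
  so \<open>\<phi>\<close> is expanded in an orthonormal basis of \<open>T2\<close> instead of the
  standard basis: its values on \<open>S1\<close> lie in \<open>T2\<close>, hence its derivative is
  a combination of vectors along which \<open>f\<close> may be differentiated.\<close>

lemma smooth_compose:
  fixes \<phi> :: "'a::euclidean_space \<Rightarrow> 'b::euclidean_space"
  assumes 1: "rel_open_set T1 S1" and 2: "rel_open_set T2 S2"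
    and maps: "\<And>p. p \<in> S1 \<Longrightarrow> \<phi> p \<in> S2"
    and coords: "\<And>w. rel_open_set.smooth T1 S1 (\<lambda>p. of_real (\<phi> p \<bullet> w))"
    and f: "rel_open_set.smooth T2 S2 f"
  shows "rel_open_set.smooth T1 S1 (\<lambda>p. f (\<phi> p))"
proof -
  interpret A: rel_open_set T1 S1 by fact
  interpret B: rel_open_set T2 S2 by fact
  obtain B where B: "B \<subseteq> T2" "pairwise orthogonal B" "\<And>x. x \<in> B \<Longrightarrow> norm x = 1"
    "independent B" "span B = T2"
    using orthonormal_basis_subspace[OF B.subspace_T] by metis
  have fB: "finite B" using B(4) by (rule independent_imp_finite)
  have expand: "(\<Sum>b\<in>B. (u \<bullet> b) *\<^sub>R b) = u" if "u \<in> T2" for u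
    by (rule orthonormal_basis_expand[OF B(2,3) _ fB]) (use that B(5) in auto)
  have "\<exists>c'. \<forall>p\<in>S1. ((\<lambda>p. complex_of_real (\<phi> p \<bullet> b)) has_derivative c' p) (at p within S1)" for b
    using A.smooth_has_derivative[OF coords[of b]] by metis
  then obtain c' where c': "\<And>b p. p \<in> S1 \<Longrightarrow>
      ((\<lambda>p. complex_of_real (\<phi> p \<bullet> b)) has_derivative c' b p) (at p within S1)"
    by metis
  have sm_c': "A.smooth (\<lambda>p. complex_of_real (Re (c' b p v)))" if "v \<in> T1" for b v
    using A.smooth_Re[OF A.smooth_derivative[OF coords that c']] .
  have \<phi>': "(\<phi> has_derivative (\<lambda>v. \<Sum>b\<in>B. Re (c' b p v) *\<^sub>R b)) (at p within S1)" if p: "p \<in> S1" for p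
  proof -
    have "((\<lambda>p. \<Sum>b\<in>B. (\<phi> p \<bullet> b) *\<^sub>R b) has_derivative (\<lambda>v. \<Sum>b\<in>B. Re (c' b p v) *\<^sub>R b)) (at p within S1)"
      using has_derivative_Re[OF c'[OF p]]
      by (intro has_derivative_sum has_derivative_scaleR_left) simp
    then show ?thesis
    proof (rule has_derivative_transform[OF p, rotated])
      show "\<phi> q = (\<Sum>b\<in>B. (\<phi> q \<bullet> b) *\<^sub>R b)" if "q \<in> S1" for q
        using expand maps[OF that] B.S_sub_T by (metis subsetD)
    qed
  qed
  have "Ck_rel r T2 S2 f \<Longrightarrow> Ck_rel r T1 S1 (\<lambda>p. f (\<phi> p))" for r and f :: "'b \<Rightarrow> complex"
  proof (induction r arbitrary: f)
    case 0
    have "continuous_on S1 \<phi>"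
      using \<phi>' by (auto simp: continuous_on_eq_continuous_within intro: has_derivative_continuous)
    then show ?case using 0 continuous_on_compose2[of S2 f S1 \<phi>] maps by auto
  next
    case (Suc r)
    obtain f' where f': "\<And>p. p \<in> S2 \<Longrightarrow> (f has_derivative f' p) (at p within S2)"
      "\<And>v. v \<in> T2 \<Longrightarrow> Ck_rel r T2 S2 (\<lambda>p. f' p v)"
      by (rule B.Ck_rel_SucE[OF Suc.prems]) blast
    show ?case
    proof (rule A.Ck_rel_SucI[where f' = "\<lambda>p v. \<Sum>b\<in>B. of_real (Re (c' b p v)) * f' (\<phi> p) b"])
      fix p assume p: "p \<in> S1"
      have sub: "(f has_derivative f' (\<phi> p)) (at (\<phi> p) within \<phi> ` S1)"
        using has_derivative_subset[OF f'(1)[OF maps[OF p]]] maps by blast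
      have lin: "linear (f' (\<phi> p))" using has_derivative_linear[OF sub] .
      show "((\<lambda>p. f (\<phi> p)) has_derivative (\<lambda>v. \<Sum>b\<in>B. of_real (Re (c' b p v)) * f' (\<phi> p) b)) (at p within S1)"
        using has_derivative_in_compose[OF \<phi>'[OF p] sub]
        by (simp add: linear_sum[OF lin] linear_cmul[OF lin] scaleR_conv_of_real)
    next
      fix v assume v: "v \<in> T1"
      have summand: "Ck_rel r T1 S1 (\<lambda>p. of_real (Re (c' b p v)) * f' (\<phi> p) b)" if "b \<in> B" for b
        using A.Ck_rel_mult sm_c'[OF v] Suc.IH[OF f'(2)] that B(1) unfolding A.smooth_def by blast
      have "finite B' \<Longrightarrow> B' \<subseteq> B \<Longrightarrow>
          Ck_rel r T1 S1 (\<lambda>p. \<Sum>b\<in>B'. of_real (Re (c' b p v)) * f' (\<phi> p) b)" for B'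
        by (induction B' rule: finite_induct) (use summand in \<open>auto intro: A.Ck_rel_const A.Ck_rel_add\<close>)
      then show "Ck_rel r T1 S1 (\<lambda>p. \<Sum>b\<in>B. of_real (Re (c' b p v)) * f' (\<phi> p) b)"
        using fB by blast
    qed
  qed
  then show ?thesis using f unfolding A.smooth_def B.smooth_def by blast
qed

subsection \<open>The Siegel upper half space and the Siegel--Jacobi space\<close>

lemma matrix_diff_ldistrib: "(A :: 'a::ring_1^'n^'m) ** (B - C) = A ** B - A ** C"
  and matrix_diff_rdistrib: "((D - E) :: 'a::ring_1^'n^'m) ** F = D ** F - E ** F"
  and matrix_add_rdistrib: "(D + E) ** F = D ** F + E ** F"
  and matrix_minus_mult: "(- D) ** F = - (D ** F)"
  and matrix_mult_minus: "D ** (- F) = - (D ** F)"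
  by (simp_all add: matrix_matrix_mult_def vec_eq_iff algebra_simps sum.distrib sum_subtractf sum_negf)

lemmas matrix_distribs = matrix_add_ldistrib matrix_add_rdistrib matrix_diff_ldistrib
  matrix_diff_rdistrib matrix_minus_mult matrix_mult_minus

lemma transpose_add: "transpose (A + B) = transpose A + transpose B"
  and transpose_diff: "transpose (C - D) = transpose C - transpose D"
  and transpose_uminus: "transpose (- E) = - transpose E"
  by (simp_all add: transpose_def vec_eq_iff)

lemmas transpose_simps = transpose_add transpose_diff transpose_uminus matrix_transpose_mul
  transpose_transpose transpose_mat

lemma matrix_inv_eqI:
  fixes A :: "'a::field^'n^'n"
  assumes "A ** B = mat 1"
  shows "matrix_inv A = B"
proof -
  have "B ** A = mat 1" using assms matrix_left_right_inverse by blast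
  then have "A ** matrix_inv A = mat 1 \<and> matrix_inv A ** A = mat 1"
    unfolding matrix_inv_def
    using someI[of "\<lambda>A'. A ** A' = mat 1 \<and> A' ** A = mat 1" B] assms by blast
  then have "matrix_inv A ** (A ** B) = B" by (simp add: matrix_mul_assoc)
  then show ?thesis using assms by simp
qed

lemma
  fixes A :: "'a::field^'n^'n"
  assumes "det A \<noteq> 0"
  shows matrix_inv_right: "A ** matrix_inv A = mat 1" and matrix_inv_left: "matrix_inv A ** A = mat 1"
proof -
  obtain B where "A ** B = mat 1" "B ** A = mat 1"
    using assms invertible_det_nz invertible_def by blast
  then show "A ** matrix_inv A = mat 1" "matrix_inv A ** A = mat 1"
    using matrix_inv_eqI by metis+
qed

lemma det_matrix_inv:
  fixes A :: "'a::field^'n^'n"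
  assumes "det A \<noteq> 0"
  shows "det (matrix_inv A) = inverse (det A)"
  using arg_cong[OF matrix_inv_right[OF assms], of det] assms
  by (simp add: det_mul inverse_unique)

lemma matrix_inv_matrix_mult:
  fixes A B :: "'a::field^'n^'n"
  assumes "det A \<noteq> 0" "det B \<noteq> 0"
  shows "matrix_inv (A ** B) = matrix_inv B ** matrix_inv A"
proof (rule matrix_inv_eqI)
  have "A ** B ** (matrix_inv B ** matrix_inv A) = A ** (B ** matrix_inv B) ** matrix_inv A"
    by (simp add: matrix_mul_assoc)
  then show "A ** B ** (matrix_inv B ** matrix_inv A) = mat 1"
    using assms by (simp add: matrix_inv_right)
qed

lemma matrix_inv_transpose:
  fixes A :: "'a::field^'n^'n"
  assumes "det A \<noteq> 0"
  shows "matrix_inv (transpose A) = transpose (matrix_inv A)"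
  by (rule matrix_inv_eqI) (simp add: matrix_transpose_mul[symmetric] matrix_inv_left[OF assms])

lemma det_nz_of_ker:
  fixes A :: "'a::field^'n^'n"
  assumes "\<And>x. A *v x = 0 \<Longrightarrow> x = 0"
  shows "det A \<noteq> 0"
proof -
  have "\<exists>B. B ** A = mat 1" unfolding matrix_left_invertible_ker using assms by blast
  then show ?thesis using invertible_left_inverse invertible_det_nz by blast
qed

lemma map_matrix_of_real_mult: "map_matrix of_real (A ** B) =
    (map_matrix of_real A ** map_matrix of_real B :: 'a::{real_algebra_1,semiring_1}^'p^'m)"
  and map_matrix_of_int_mult: "map_matrix of_int (C ** D) =
    (map_matrix of_int C ** map_matrix of_int D :: 'b::ring_1^'p^'m)"
  by (simp_all add: matrix_matrix_mult_def vec_eq_iff)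

lemma map_matrix_add: "cmat_of_real (A + B) = cmat_of_real A + cmat_of_real B"
  and map_matrix_diff: "cmat_of_real (A - B) = cmat_of_real A - cmat_of_real B"
  and map_matrix_mat1: "cmat_of_real (mat 1) = mat 1"
  by (simp_all add: vec_eq_iff mat_def)

lemma transpose_map_matrix: "transpose (map_matrix f A) = map_matrix f (transpose A)"
  by (simp add: transpose_def vec_eq_iff)

lemma det_cmat_of_real: "det (cmat_of_real A) = of_real (det A)"
  by (simp add: det_def)

lemma matrix_inv_cmat_of_real:
  assumes "det A \<noteq> 0"
  shows "matrix_inv (cmat_of_real A) = cmat_of_real (matrix_inv A)"
  by (rule matrix_inv_eqI)
     (simp add: map_matrix_of_real_mult[symmetric] matrix_inv_right[OF assms] map_matrix_mat1)

section \<open>Smooth matrix-valued functions\<close>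

context rel_open_set
begin

lemma smooth_det:
  fixes A :: "'a \<Rightarrow> complex^'n^'n"
  assumes "\<And>i j. smooth (\<lambda>p. A p $ i $ j)"
  shows "smooth (\<lambda>p. det (A p))"
  unfolding det_def by (intro smooth_sum smooth_mult smooth_prod smooth_const assms)

lemma smooth_matrix_mult:
  fixes A :: "'a \<Rightarrow> complex^'n^'m" and B :: "'a \<Rightarrow> complex^'k^'n"
  assumes "\<And>i j. smooth (\<lambda>p. A p $ i $ j)" "\<And>i j. smooth (\<lambda>p. B p $ i $ j)"
  shows "smooth (\<lambda>p. (A p ** B p) $ i $ j)"
  unfolding matrix_matrix_mult_def vec_lambda_beta by (intro smooth_sum smooth_mult assms)

text \<open>Cramer's rule: the (i, j) entry of the inverse is the i-th component of the solution of
  A x = e_j, hence a quotient of two determinants, which are polynomials in the entries.\<close>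

lemma smooth_matrix_inv:
  fixes A :: "'a \<Rightarrow> complex^'n^'n"
  assumes A: "\<And>i j. smooth (\<lambda>p. A p $ i $ j)" and nz: "\<And>p. p \<in> S \<Longrightarrow> det (A p) \<noteq> 0"
  shows "smooth (\<lambda>p. matrix_inv (A p) $ i $ j)"
proof -
  let ?C = "\<lambda>p. (\<chi> k l. if l = i then axis j 1 $ k else A p $ k $ l) :: complex^'n^'n"
  have eq: "det (?C p) * inverse (det (A p)) = matrix_inv (A p) $ i $ j" if "p \<in> S" for p
  proof -
    have "A p *v column j (matrix_inv (A p)) = axis j 1"
      using matrix_inv_right[OF nz[OF that]]
      by (simp add: vec_eq_iff matrix_vector_mult_def column_def matrix_matrix_mult_def mat_def axis_def)
    then have "column j (matrix_inv (A p)) $ i = det (?C p) / det (A p)"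
      unfolding cramer[OF nz[OF that]] by simp
    then show ?thesis by (simp add: column_def divide_inverse)
  qed
  have "smooth (\<lambda>p. ?C p $ k $ l)" for k l
    using A by (cases "l = i") auto
  then have "smooth (\<lambda>p. det (?C p) * inverse (det (A p)))"
    by (intro smooth_mult smooth_inverse smooth_det A nz)
  then show ?thesis by (rule smooth_transform) (rule eq)
qed

end

section \<open>Openness of the positive definite cone among symmetric matrices\<close>

definition sym_mats :: "(complex^'n::finite^'n) set" where
  "sym_mats = {U. symmetric_mat U}"

definition siegel :: "(complex^'n::finite^'n) set" where
  "siegel = {Z. symmetric_mat Z \<and> positive_definite (Im_mat Z)}"

lemma symmetric_mat_iff: "symmetric_mat A \<longleftrightarrow> (\<forall>i j. A $ i $ j = A $ j $ i)"
  by (auto simp: symmetric_mat_def transpose_def vec_eq_iff)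

lemma sym_mats_iff: "U \<in> sym_mats \<longleftrightarrow> (\<forall>i j. U $ i $ j = U $ j $ i)"
  by (simp add: sym_mats_def symmetric_mat_iff)

lemma siegel_sym: "Z \<in> siegel \<Longrightarrow> Z \<in> sym_mats"
  by (simp add: siegel_def sym_mats_def)

lemma sym_mats_transpose: "U \<in> sym_mats \<longleftrightarrow> transpose U = U"
  by (simp add: sym_mats_def symmetric_mat_def)

text \<open>On the unit sphere the form of Y attains a minimum c > 0 by compactness, and a
  perturbation of norm below c / K moves it by less than c, where K bounds the bilinear map (A, x)
  \<mapsto> A x.\<close>

lemma positive_definite_open:
  fixes Y :: "real^'n^'n"
  assumes Y: "positive_definite Y"
  shows "\<exists>e>0. \<forall>Y'. symmetric_mat Y' \<longrightarrow> dist Y' Y < e \<longrightarrow> positive_definite Y'"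
proof -
  let ?s = "sphere (0::real^'n) 1"
  have sphere: "compact ?s" "?s \<noteq> {}" by auto
  have "continuous_on ?s (\<lambda>x. x \<bullet> (Y *v x))"
    by (intro continuous_intros linear_continuous_on matrix_vector_mul_bounded_linear)
  from continuous_attains_inf[OF sphere this]
  obtain x0 where x0: "x0 \<in> ?s" "\<And>x. x \<in> ?s \<Longrightarrow> x0 \<bullet> (Y *v x0) \<le> x \<bullet> (Y *v x)"
    by blast
  define c where "c = x0 \<bullet> (Y *v x0)"
  have "x0 \<noteq> 0" using x0(1) by auto
  then have c: "c > 0" using Y unfolding positive_definite_def c_def by blast
  have "bilinear (\<lambda>(A :: real^'n^'n) x. A *v x)"
    unfolding bilinear_def
    by (auto intro!: linearI simp: algebra_simps matrix_vector_mult_def vec_eq_iff sum.distrib sum_distrib_left)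
  then have "bounded_bilinear (\<lambda>(A :: real^'n^'n) x. A *v x)"
    by (simp add: bilinear_conv_bounded_bilinear)
  then obtain K where K: "K > 0" "\<And>(A :: real^'n^'n) x. norm (A *v x) \<le> norm A * norm x * K"
    using bounded_bilinear.pos_bounded by blast
  show ?thesis
  proof (intro exI[of _ "c / K"] conjI allI impI)
    show "c / K > 0" using c K by simp
    fix Y' :: "real^'n^'n" assume Y': "symmetric_mat Y'" "dist Y' Y < c / K"
    have unit: "x \<bullet> (Y' *v x) > 0" if x: "norm x = 1" for x
    proof -
      have "\<bar>x \<bullet> ((Y' - Y) *v x)\<bar> \<le> norm x * norm ((Y' - Y) *v x)" by (rule Cauchy_Schwarz_ineq2)
      also have "\<dots> \<le> norm (Y' - Y) * K" using K(2)[of "Y' - Y" x] x by simp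
      also have "\<dots> < c" using Y'(2) K(1) by (simp add: dist_norm field_simps)
      finally have "\<bar>x \<bullet> ((Y' - Y) *v x)\<bar> < c" .
      moreover have "c \<le> x \<bullet> (Y *v x)" using x0(2) x by (simp add: c_def)
      ultimately show ?thesis by (simp add: matrix_vector_mult_diff_rdistrib inner_diff_right)
    qed
    show "positive_definite Y'"
      unfolding positive_definite_def
    proof (intro conjI allI impI)
      fix x :: "real^'n" assume x: "x \<noteq> 0"
      then have "0 < (x /\<^sub>R norm x) \<bullet> (Y' *v (x /\<^sub>R norm x))" by (intro unit) simp
      also have "\<dots> = inverse (norm x ^ 2) * (x \<bullet> (Y' *v x))"
        by (simp add: matrix_vector_mult_scaleR power2_eq_square)
      finally show "0 < x \<bullet> (Y' *v x)" using x by (simp add: zero_less_mult_iff)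
    qed (use Y' in auto)
  qed
qed

lemma bounded_linear_mat_entry: "bounded_linear (\<lambda>Z :: 'a::real_normed_vector^'n^'m. Z $ i $ j)"
  using bounded_linear_compose[OF bounded_linear_vec_nth bounded_linear_vec_nth] .

lemma linear_Im_mat: "linear Im_mat"
  by (auto intro!: linearI simp: vec_eq_iff)

lemma Im_mat_close:
  assumes "e > 0"
  shows "\<exists>d>0. \<forall>Z' :: complex^'n^'m. dist Z' Z < d \<longrightarrow> dist (Im_mat Z') (Im_mat Z) < e"
  using linear_continuous_at[OF linear_conv_bounded_linear[THEN iffD1, OF linear_Im_mat], of Z] assms
  unfolding continuous_at_eps_delta by blast

interpretation H: rel_open_set sym_mats siegel
proof
  show "subspace sym_mats"
    by (auto simp: subspace_def sym_mats_iff)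
  show "siegel \<subseteq> sym_mats" using siegel_sym by blast
  fix Z :: "complex^'n^'n" assume Z: "Z \<in> siegel"
  then obtain e where e: "e > 0" "\<And>Y'. symmetric_mat Y' \<Longrightarrow> dist Y' (Im_mat Z) < e \<Longrightarrow> positive_definite Y'"
    using positive_definite_open unfolding siegel_def by blast
  obtain d where d: "d > 0" "\<And>Z'. dist Z' Z < d \<Longrightarrow> dist (Im_mat Z') (Im_mat Z) < e"
    using Im_mat_close[OF e(1)] by blast
  show "\<exists>e>0. \<forall>q\<in>sym_mats. dist q Z < e \<longrightarrow> q \<in> siegel"
    using d e(2) by (auto simp: siegel_def sym_mats_def symmetric_mat_iff intro!: exI[of _ d])
qed

interpretation sj: rel_open_set sj_tangent siegel_jacobi_space
proof
  show "subspace sj_tangent"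
    by (auto simp: subspace_def sj_tangent_def symmetric_mat_iff zero_prod_def)
  show "siegel_jacobi_space \<subseteq> sj_tangent"
    by (auto simp: siegel_jacobi_space_def sj_tangent_def)
  fix p :: "('n::finite, 'm::finite) sj_point" assume p: "p \<in> siegel_jacobi_space"
  then have "fst p \<in> siegel" by (auto simp: siegel_jacobi_space_def siegel_def)
  then obtain e where e: "e > 0" "\<And>Z'. Z' \<in> sym_mats \<Longrightarrow> dist Z' (fst p) < e \<Longrightarrow> Z' \<in> siegel"
    using H.rel_open by blast
  have "q \<in> siegel_jacobi_space" if q: "q \<in> sj_tangent" "dist q p < e" for q
  proof -
    have "dist (fst q) (fst p) < e" using dist_fst_le[of q p] q(2) by linarith
    then have "fst q \<in> siegel" using e(2) q(1) by (auto simp: sj_tangent_def sym_mats_def)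
    then show ?thesis by (auto simp: siegel_jacobi_space_def siegel_def split: prod.splits)
  qed
  then show "\<exists>e>0. \<forall>q\<in>sj_tangent. dist q p < e \<longrightarrow> q \<in> siegel_jacobi_space" using e(1) by blast
qed

lemma sj_space_iff: "(Z, W) \<in> siegel_jacobi_space \<longleftrightarrow> Z \<in> siegel"
  by (simp add: siegel_jacobi_space_def siegel_def)

lemma smooth_sj_iff: "smooth_sj f \<longleftrightarrow> sj.smooth f"
  by (simp add: smooth_sj_def sj.smooth_def)

text \<open>The segment from the identity to Y consists of matrices with positive form, whose
  determinant has no zero; being 1 at the start, it stays positive by the intermediate value
  theorem.\<close>

lemma positive_definite_det_pos:
  fixes Y :: "real^'n^'n"
  assumes Y: "positive_definite Y"
  shows "det Y > 0"
proof (rule ccontr)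
  assume neg: "\<not> det Y > 0"
  let ?P = "\<lambda>t::real. (1 - t) *\<^sub>R mat 1 + t *\<^sub>R Y"
  have "continuous_on {0..1} (\<lambda>t. det (?P t))"
    unfolding det_def by (intro continuous_intros)
  then obtain t where t: "0 \<le> t" "t \<le> 1" "det (?P t) = 0"
    using IVT2'[of "\<lambda>t. det (?P t)" 1 0 0] neg by auto
  have "det (?P t) \<noteq> 0"
  proof (rule det_nz_of_ker, rule ccontr)
    fix x assume x: "?P t *v x = 0" "x \<noteq> 0"
    have "x \<bullet> (?P t *v x) = (1 - t) * (x \<bullet> x) + t * (x \<bullet> (Y *v x))"
      by (simp add: matrix_vector_mult_add_rdistrib scaleR_matrix_vector_assoc[symmetric] inner_add_right)
    moreover have "x \<bullet> x > 0" "x \<bullet> (Y *v x) > 0" using x Y unfolding positive_definite_def by auto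
    then have "(1 - t) * (x \<bullet> x) + t * (x \<bullet> (Y *v x)) > 0"
      using t by (cases "t = 0") (auto intro: add_nonneg_pos)
    ultimately show False using x by simp
  qed
  then show False using t by simp
qed

lemma siegel_det_pos: "Z \<in> siegel \<Longrightarrow> det (Im_mat Z) > 0"
  by (simp add: siegel_def positive_definite_det_pos)

lemma smooth_entry: "H.smooth (\<lambda>Z. Z $ i $ j)"
  by (rule H.smooth_linear[OF bounded_linear_mat_entry])

lemma siegel_smooth_det_Im: "H.smooth (\<lambda>Z. of_real (det (Im_mat Z)))"
  unfolding det_cmat_of_real[symmetric]
  by (rule H.smooth_det) (simp add: H.smooth_Im[OF smooth_entry])

lemma sj_smooth_Z: "sj.smooth (\<lambda>q. fst q $ i $ j)"
  by (rule sj.smooth_linear[OF bounded_linear_compose[OF bounded_linear_mat_entry bounded_linear_fst]])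

lemma sj_smooth_W: "sj.smooth (\<lambda>q. snd q $ i $ j)"
  by (rule sj.smooth_linear[OF bounded_linear_compose[OF bounded_linear_mat_entry bounded_linear_snd]])

lemma sj_smooth_det_Im: "sj.smooth (\<lambda>q. of_real (det (Im_mat (fst q))))"
  unfolding det_cmat_of_real[symmetric]
  by (rule sj.smooth_det) (simp add: sj.smooth_Im[OF sj_smooth_Z])

lemma sj_det_pos: "q \<in> siegel_jacobi_space \<Longrightarrow> det (Im_mat (fst q)) > 0"
  by (cases q) (simp add: sj_space_iff siegel_det_pos)

lemma sj_smooth_Im_inv: "sj.smooth (\<lambda>q. of_real (matrix_inv (Im_mat (fst q)) $ i $ j))"
proof -
  have "sj.smooth (\<lambda>q. matrix_inv (cmat_of_real (Im_mat (fst q))) $ i $ j)"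
    by (rule sj.smooth_matrix_inv)
       (auto simp: sj.smooth_Im[OF sj_smooth_Z] det_cmat_of_real dest: sj_det_pos)
  then show ?thesis
  proof (rule sj.smooth_transform)
    show "matrix_inv (cmat_of_real (Im_mat (fst q))) $ i $ j = of_real (matrix_inv (Im_mat (fst q)) $ i $ j)"
      if "q \<in> siegel_jacobi_space" for q
      using matrix_inv_cmat_of_real[of "Im_mat (fst q)"] sj_det_pos[OF that] by simp
  qed
qed

lemma sj_smooth_trace_MVYV: "sj.smooth (\<lambda>q. of_real (trace_MVYV M q))"
proof -
  have "of_real (trace_MVYV M q) = trace (cmat_of_real M ** cmat_of_real (Im_mat (snd q)) **
      cmat_of_real (matrix_inv (Im_mat (fst q))) ** cmat_of_real (transpose (Im_mat (snd q))))" for q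
    unfolding map_matrix_of_real_mult[symmetric]
    by (cases q) (simp add: trace_MVYV_def trace_def)
  note eq = this
  show ?thesis
    unfolding eq trace_def
    by (intro sj.smooth_sum sj.smooth_matrix_mult)
       (simp_all add: transpose_def sj_smooth_Im_inv sj.smooth_Im[OF sj_smooth_W])
qed

subsection \<open>Holomorphic directional derivatives and operator determinants\<close>

definition cscale :: "complex \<Rightarrow> complex^'n^'m \<Rightarrow> complex^'n^'m" where
  "cscale c U = (\<chi> i j. c * U $ i $ j)"

lemma cscale_nth [simp]: "cscale c U $ i $ j = c * U $ i $ j"
  by (simp add: cscale_def)

lemma cscale_sym_mats: "U \<in> sym_mats \<Longrightarrow> cscale c U \<in> sym_mats"
  by (simp add: sym_mats_iff)

lemma sym_mats_add: "U \<in> sym_mats \<Longrightarrow> V \<in> sym_mats \<Longrightarrow> U + V \<in> sym_mats"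
  and sym_mats_sum: "(\<And>i. i \<in> I \<Longrightarrow> f i \<in> sym_mats) \<Longrightarrow> sum f I \<in> sym_mats"
  using H.subspace_T by (auto intro: subspace_add subspace_sum)

text \<open>The complex linear part of the real differential of F, evaluated at U: linear over the
  complex numbers in U, and zero on antiholomorphic functions. Directions are used in place of
  coordinates because substitutions mix the coordinates of Z.\<close>

definition wd :: "complex^'n::finite^'n \<Rightarrow> (complex^'n^'n \<Rightarrow> complex) \<Rightarrow> complex^'n^'n \<Rightarrow> complex" where
  "wd U F Z = (dir_deriv U F Z - \<i> * dir_deriv (cscale \<i> U) F Z) / 2"

lemma wd_eq:
  assumes "(F has_derivative L) (at Z within siegel)" "Z \<in> siegel" "U \<in> sym_mats"
  shows "wd U F Z = (L U - \<i> * L (cscale \<i> U)) / 2"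
  using assms H.dir_deriv_eq cscale_sym_mats unfolding wd_def by metis

lemma wd_smooth:
  assumes "H.smooth F" "U \<in> sym_mats"
  shows "H.smooth (wd U F)"
  unfolding wd_def
  by (intro H.smooth_intros H.smooth_dir_deriv assms cscale_sym_mats)

lemma wd_cong:
  assumes "H.smooth F" "\<And>Z. Z \<in> siegel \<Longrightarrow> F Z = G Z" "Z \<in> siegel" "U \<in> sym_mats"
  shows "wd U F Z = wd U G Z"
proof -
  obtain L where L: "(F has_derivative L) (at Z within siegel)"
    using H.smooth_has_derivative[OF assms(1,3)] by blast
  moreover have "(G has_derivative L) (at Z within siegel)"
    by (rule has_derivative_transform[OF assms(3) _ L]) (simp add: assms(2))
  ultimately show ?thesis using wd_eq assms(3,4) by metis
qed

lemma wd_const [simp]: "Z \<in> siegel \<Longrightarrow> U \<in> sym_mats \<Longrightarrow> wd U (\<lambda>_. c) Z = 0"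
  by (subst wd_eq[OF has_derivative_const]) auto

lemma
  assumes F: "H.smooth F" and Z: "Z \<in> siegel" and U: "U \<in> sym_mats"
  shows wd_cscale: "wd (cscale c U) F Z = c * wd U F Z"
    and wd_add_dir: "V \<in> sym_mats \<Longrightarrow> wd (U + V) F Z = wd U F Z + wd V F Z"
proof -
  obtain L where L: "(F has_derivative L) (at Z within siegel)"
    using H.smooth_has_derivative[OF F Z] by blast
  note lin = has_derivative_linear[OF L]
  have 1: "cscale c U = Re c *\<^sub>R U + Im c *\<^sub>R cscale \<i> U"
    by (simp add: vec_eq_iff complex_eq_iff)
  have 2: "cscale \<i> (cscale c U) = Re c *\<^sub>R cscale \<i> U - Im c *\<^sub>R U"
    by (simp add: vec_eq_iff complex_eq_iff)
  have "wd (cscale c U) F Z = (L (cscale c U) - \<i> * L (cscale \<i> (cscale c U))) / 2"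
    by (rule wd_eq[OF L Z cscale_sym_mats[OF U]])
  also have "\<dots> = (of_real (Re c) + \<i> * of_real (Im c)) * ((L U - \<i> * L (cscale \<i> U)) / 2)"
    unfolding 2 unfolding 1
    by (simp add: linear_add[OF lin] linear_diff[OF lin] linear_cmul[OF lin] scaleR_conv_of_real[where 'a = complex]
        field_simps)
  finally show "wd (cscale c U) F Z = c * wd U F Z"
    by (simp add: wd_eq[OF L Z U] complex_eq[symmetric])
  assume V: "V \<in> sym_mats"
  have 3: "cscale \<i> (U + V) = cscale \<i> U + cscale \<i> V"
    by (simp add: vec_eq_iff algebra_simps)
  show "wd (U + V) F Z = wd U F Z + wd V F Z"
    unfolding wd_eq[OF L Z U] wd_eq[OF L Z V] wd_eq[OF L Z sym_mats_add[OF U V]] 3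
    by (simp add: linear_add[OF lin] field_simps)
qed

lemma wd_zero_dir:
  fixes F :: "complex^'n::finite^'n \<Rightarrow> complex"
  assumes "H.smooth F" "Z \<in> siegel"
  shows "wd 0 F Z = 0"
proof -
  have 0: "(0 :: complex^'n^'n) \<in> sym_mats" by (simp add: sym_mats_iff)
  have "cscale 0 (0 :: complex^'n^'n) = 0" by (simp add: vec_eq_iff)
  then show ?thesis using wd_cscale[OF assms 0, of 0] by simp
qed

lemma wd_sum_dir:
  assumes "H.smooth F" "Z \<in> siegel" "\<And>i. i \<in> I \<Longrightarrow> f i \<in> sym_mats"
  shows "wd (\<Sum>i\<in>I. f i) F Z = (\<Sum>i\<in>I. wd (f i) F Z)"
  using assms(3)
proof (induction I rule: infinite_finite_induct)
  case (insert i I)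
  then show ?case by (simp add: wd_add_dir[OF assms(1,2)] sym_mats_sum)
qed (use wd_zero_dir[OF assms(1,2)] in auto)

lemma
  assumes F: "H.smooth F" and G: "H.smooth G" and Z: "Z \<in> siegel" and U: "U \<in> sym_mats"
  shows wd_add: "wd U (\<lambda>Z. F Z + G Z) Z = wd U F Z + wd U G Z"
    and wd_mult: "wd U (\<lambda>Z. F Z * G Z) Z = wd U F Z * G Z + F Z * wd U G Z"
proof -
  obtain L where L: "(F has_derivative L) (at Z within siegel)"
    using H.smooth_has_derivative[OF F Z] by blast
  obtain L' where L': "(G has_derivative L') (at Z within siegel)"
    using H.smooth_has_derivative[OF G Z] by blast
  show "wd U (\<lambda>Z. F Z + G Z) Z = wd U F Z + wd U G Z"
    unfolding wd_eq[OF L Z U] wd_eq[OF L' Z U] wd_eq[OF has_derivative_add[OF L L'] Z U]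
    by (simp add: field_simps)
  show "wd U (\<lambda>Z. F Z * G Z) Z = wd U F Z * G Z + F Z * wd U G Z"
    unfolding wd_eq[OF L Z U] wd_eq[OF L' Z U] wd_eq[OF has_derivative_mult[OF L L'] Z U]
    by (simp add: field_simps)
qed

lemma wd_cmult:
  assumes "H.smooth F" "Z \<in> siegel" "U \<in> sym_mats"
  shows "wd U (\<lambda>Z. c * F Z) Z = c * wd U F Z"
  using wd_mult[OF H.smooth_const assms] assms by simp

lemma wd_sum:
  assumes "\<And>i. i \<in> I \<Longrightarrow> H.smooth (f i)" "Z \<in> siegel" "U \<in> sym_mats"
  shows "wd U (\<lambda>Z. \<Sum>i\<in>I. f i Z) Z = (\<Sum>i\<in>I. wd U (f i) Z)"
  using assms(1)
proof (induction I rule: infinite_finite_induct)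
  case (insert i I)
  then show ?case by (simp add: wd_add[OF _ H.smooth_sum assms(2,3)])
qed (use assms in auto)

text \<open>Four instances of the symmetry of real mixed derivatives, for U, V and their multiples
  by i.\<close>

lemma wd_commute:
  assumes F: "H.smooth F" and Z: "Z \<in> siegel" and U: "U \<in> sym_mats" and V: "V \<in> sym_mats"
  shows "wd U (wd V F) Z = wd V (wd U F) Z"
proof -
  have comb: "dir_deriv A (\<lambda>p. (f p - \<i> * g p) / 2) Z = (dir_deriv A f Z - \<i> * dir_deriv A g Z) / 2"
    if sm: "H.smooth f" "H.smooth g" and A: "A \<in> sym_mats" for f g A
  proof -
    obtain L where L: "(f has_derivative L) (at Z within siegel)"
      using H.smooth_has_derivative[OF sm(1) Z] by blast
    obtain L' where L': "(g has_derivative L') (at Z within siegel)"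
      using H.smooth_has_derivative[OF sm(2) Z] by blast
    have "((\<lambda>p. (f p - \<i> * g p) * (1/2)) has_derivative (\<lambda>v. (L v - \<i> * L' v) * (1/2))) (at Z within siegel)"
      by (intro has_derivative_mult_left has_derivative_diff has_derivative_mult_right L L')
    then show ?thesis
      using H.dir_deriv_eq[OF L Z A] H.dir_deriv_eq[OF L' Z A]
        H.dir_deriv_eq[OF _ Z A] by fastforce
  qed
  note sm = H.smooth_dir_deriv[OF F]
  note iU = cscale_sym_mats[OF U, of \<i>] and iV = cscale_sym_mats[OF V, of \<i>]
  note comm = H.dir_deriv_commute[OF F Z]
  show ?thesis
    unfolding wd_def
    by (simp add: comb[OF sm sm] U V iU iV comm[OF U V] comm[OF iU V] comm[OF U iV] comm[OF iU iV]
        field_simps)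
qed

text \<open>That \<open>\<phi>'\<close> commutes with multiplication by i at U is holomorphy of
  \<open>\<phi>\<close> in this direction; it removes the antiholomorphic derivative of F from the
  chain rule.\<close>

lemma wd_compose:
  assumes F: "H.smooth F" and maps: "\<And>Z. Z \<in> siegel \<Longrightarrow> \<phi> Z \<in> siegel" and Z: "Z \<in> siegel"
    and \<phi>': "(\<phi> has_derivative \<phi>') (at Z within siegel)"
    and U: "U \<in> sym_mats" "\<phi>' U \<in> sym_mats" "\<phi>' (cscale \<i> U) = cscale \<i> (\<phi>' U)"
  shows "wd U (\<lambda>Z. F (\<phi> Z)) Z = wd (\<phi>' U) F (\<phi> Z)"
proof -
  obtain L where L: "(F has_derivative L) (at (\<phi> Z) within siegel)"
    using H.smooth_has_derivative[OF F maps[OF Z]] by blast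
  have "(F has_derivative L) (at (\<phi> Z) within \<phi> ` siegel)"
    using has_derivative_subset[OF L] maps by blast
  then have "((\<lambda>Z. F (\<phi> Z)) has_derivative (\<lambda>V. L (\<phi>' V))) (at Z within siegel)"
    using has_derivative_in_compose[OF \<phi>'] by blast
  then show ?thesis
    using wd_eq[OF _ Z U(1)] wd_eq[OF L maps[OF Z] U(2)] U(3) by metis
qed

lemma of_real_inner_matrix:
  fixes A w :: "complex^'n^'m"
  shows "complex_of_real (A \<bullet> w) = (\<Sum>i\<in>UNIV. \<Sum>j\<in>UNIV. of_real (Re (A $ i $ j)) * of_real (Re (w $ i $ j))
      + of_real (Im (A $ i $ j)) * of_real (Im (w $ i $ j)))"
  by (simp add: inner_vec_def inner_complex_def)

lemma siegel_smooth_compose: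
  assumes maps: "\<And>Z. Z \<in> siegel \<Longrightarrow> \<phi> Z \<in> siegel"
    and entries: "\<And>i j. H.smooth (\<lambda>Z. \<phi> Z $ i $ j)" and F: "H.smooth F"
  shows "H.smooth (\<lambda>Z. F (\<phi> Z))"
proof (rule smooth_compose[OF H.rel_open_set_axioms H.rel_open_set_axioms maps _ F])
  fix w :: "complex^'b^'b"
  show "H.smooth (\<lambda>Z. complex_of_real (\<phi> Z \<bullet> w))"
    unfolding of_real_inner_matrix
    by (intro H.smooth_intros entries)
qed

text \<open>Totalised so that these operators commute on all functions without side conditions, which
  makes an iterated derivative over a finite index set a \<^const>\<open>Finite_Set.fold\<close>.\<close>

definition wd_total :: "complex^'n::finite^'n \<Rightarrow> (complex^'n^'n \<Rightarrow> complex) \<Rightarrow> complex^'n^'n \<Rightarrow> complex" where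
  "wd_total U F Z = (if H.smooth F \<and> U \<in> sym_mats \<and> Z \<in> siegel then wd U F Z else 0)"

lemma wd_total_eq [simp]:
  "H.smooth F \<Longrightarrow> U \<in> sym_mats \<Longrightarrow> Z \<in> siegel \<Longrightarrow> wd_total U F Z = wd U F Z"
  by (simp add: wd_total_def)

lemma wd_total_smooth: "H.smooth (wd_total U F)"
proof (cases "H.smooth F \<and> U \<in> sym_mats")
  case True
  then show ?thesis
    using H.smooth_transform[OF wd_smooth[of F U], of "wd_total U F"] by simp
next
  case False
  then have "wd_total U F = (\<lambda>_. 0)" by (auto simp: wd_total_def)
  then show ?thesis by simp
qed

lemma wd_total_zero [simp]: "wd_total U (\<lambda>_. 0) = (\<lambda>_. 0)"
  by (auto simp: wd_total_def fun_eq_iff)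

lemma wd_wd_total:
  "H.smooth F \<Longrightarrow> U \<in> sym_mats \<Longrightarrow> V \<in> sym_mats \<Longrightarrow> Z \<in> siegel \<Longrightarrow>
    wd U (wd_total V F) Z = wd U (wd V F) Z"
  using wd_cong[OF wd_total_smooth, of V F "wd V F" Z U] by simp

lemma wd_total_commute:
  fixes U V :: "complex^'n::finite^'n"
  shows "wd_total U (wd_total V F) = wd_total V (wd_total U F)"
proof (cases "H.smooth F \<and> U \<in> sym_mats \<and> V \<in> sym_mats")
  case True
  then show ?thesis
    by (auto simp: fun_eq_iff wd_total_smooth wd_wd_total wd_commute wd_total_def[of U "wd_total V F"]
        wd_total_def[of V "wd_total U F"])
next
  case False
  have "wd_total A G = (\<lambda>_. 0)" if "\<not> (H.smooth G \<and> A \<in> sym_mats)" for G    and A :: "complex^'n^'n"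
    using that by (auto simp: wd_total_def)
  then show ?thesis using False by auto
qed

section \<open>Iterated derivatives in constant directions\<close>

definition wd_fold :: "'a set \<Rightarrow> ('a \<Rightarrow> complex^'n::finite^'n) \<Rightarrow> (complex^'n^'n \<Rightarrow> complex) \<Rightarrow> complex^'n^'n \<Rightarrow> complex" where
  "wd_fold A u F = Finite_Set.fold (\<lambda>a. wd_total (u a)) F A"

lemma wd_fold_commute: "comp_fun_commute_on UNIV (\<lambda>a. wd_total (u a))"
  by standard (simp add: fun_eq_iff wd_total_commute o_def)

lemma wd_fold_empty [simp]: "wd_fold {} u F = F"
  by (simp add: wd_fold_def)

lemma wd_fold_insert:
  assumes "finite A" "a \<notin> A"
  shows "wd_fold (insert a A) u F = wd_total (u a) (wd_fold A u F)"
  unfolding wd_fold_def by (rule comp_fun_commute_on.fold_insert[OF wd_fold_commute subset_UNIV assms])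

lemma wd_fold_smooth: "finite A \<Longrightarrow> H.smooth F \<Longrightarrow> H.smooth (wd_fold A u F)"
  by (induction A rule: finite_induct) (auto simp: wd_fold_insert wd_total_smooth)

lemma wd_fold_cong:
  assumes "finite A" "\<And>a. a \<in> A \<Longrightarrow> u a = v a"
  shows "wd_fold A u F = wd_fold A v F"
  using assms by (induction A rule: finite_induct) (auto simp: wd_fold_insert)

lemma wd_fold_permutes:
  assumes "\<pi> permutes (UNIV :: 'a::finite set)"
  shows "wd_fold UNIV (\<lambda>a. u (\<pi> a)) F = wd_fold UNIV u F"
  unfolding wd_fold_def
  using fold_image[OF permutes_inj[OF assms], of "\<lambda>a. wd_total (u a)" F] permutes_surj[OF assms]
  by (simp add: o_def)

lemma wd_total_cong:
  assumes "H.smooth F" "\<And>Z. Z \<in> siegel \<Longrightarrow> F Z = G Z"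
  shows "wd_total U F = wd_total U G"
proof -
  have "H.smooth G" using H.smooth_transform[OF assms] .
  then show ?thesis
    using assms wd_cong[OF assms] by (auto simp: wd_total_def fun_eq_iff)
qed

lemma wd_fold_cong_fun:
  assumes "finite A" "H.smooth F" "\<And>Z. Z \<in> siegel \<Longrightarrow> F Z = G Z" "Z \<in> siegel"
  shows "wd_fold A u F Z = wd_fold A u G Z"
  using assms(1,4)
proof (induction A arbitrary: Z rule: finite_induct)
  case (insert a A)
  then show ?case
    using wd_total_cong[OF wd_fold_smooth[OF insert(1) assms(2)] insert(3)] by (simp add: wd_fold_insert)
qed (use assms in auto)

text \<open>If one derivative passes through \<open>q * (G \<circ> \<phi>)\<close> for every smooth
  \<open>G\<close> without producing a second term, then so does an iterated one: the directions
  \<open>v a\<close> do not depend on Z, so each step ends in the form in which the next begins.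
  Affine substitutions, antiholomorphic factors and the directions untouched by a rank one inversion
  are instances.\<close>

lemma wd_fold_transfer:
  assumes maps: "\<And>Z. Z \<in> siegel \<Longrightarrow> \<phi> Z \<in> siegel"
    and smooth: "\<And>G. H.smooth G \<Longrightarrow> H.smooth (\<lambda>Z. q Z * G (\<phi> Z))"
    and step: "\<And>a G Z. a \<in> A \<Longrightarrow> H.smooth G \<Longrightarrow> Z \<in> siegel \<Longrightarrow>
      wd (u a) (\<lambda>Z. q Z * G (\<phi> Z)) Z = q Z * wd (v a) G (\<phi> Z)"
    and sym: "\<And>a. a \<in> A \<Longrightarrow> u a \<in> sym_mats \<and> v a \<in> sym_mats"
    and A: "finite A" and F: "H.smooth F" and Z: "Z \<in> siegel"
  shows "wd_fold A u (\<lambda>Z. q Z * F (\<phi> Z)) Z = q Z * wd_fold A v F (\<phi> Z)"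
  using A step sym Z
proof (induction A arbitrary: Z rule: finite_induct)
  case (insert a A)
  note sm = wd_fold_smooth[OF insert(1)]
  have "wd_fold (insert a A) u (\<lambda>Z. q Z * F (\<phi> Z)) Z = wd (u a) (\<lambda>Z. q Z * wd_fold A v F (\<phi> Z)) Z"
    using insert wd_cong[OF sm[OF smooth[OF F]], of u "\<lambda>Z. q Z * wd_fold A v F (\<phi> Z)" Z "u a"]
    by (simp add: wd_fold_insert sm smooth[OF F])
  then show ?case
    using insert by (simp add: wd_fold_insert sm F maps)
qed auto

lemma wd_fold_cmult:
  assumes "finite A" "H.smooth F" "\<And>a. a \<in> A \<Longrightarrow> u a \<in> sym_mats" "Z \<in> siegel"
  shows "wd_fold A u (\<lambda>Z. c * F Z) Z = c * wd_fold A u F Z"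
  by (rule wd_fold_transfer[where \<phi> = "\<lambda>Z. Z"])
     (use assms in \<open>auto intro: H.smooth_mult simp: wd_cmult\<close>)

text \<open>Expanding a product of linear combinations gives one summand for each choice function
  \<open>h\<close>; the coefficients \<open>g a c\<close> are constants, so no derivative falls on
  them.\<close>

lemma wd_fold_multilinear:
  fixes g :: "'a \<Rightarrow> 'b::finite \<Rightarrow> complex"
  assumes "finite A" "H.smooth F" "\<And>a c. x a c \<in> sym_mats" "Z \<in> siegel"
  shows "wd_fold A (\<lambda>a. \<Sum>c\<in>UNIV. cscale (g a c) (x a c)) F Z =
    (\<Sum>h\<in>PiE A (\<lambda>_. UNIV). (\<Prod>a\<in>A. g a (h a)) * wd_fold A (\<lambda>a. x a (h a)) F Z)"
  using assms(1,4)
proof (induction A arbitrary: Z rule: finite_induct)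
  case (insert a A)
  let ?u = "\<lambda>a. \<Sum>c\<in>UNIV. cscale (g a c) (x a c)"
  let ?G = "\<lambda>h Z. (\<Prod>a\<in>A. g a (h a)) * wd_fold A (\<lambda>a. x a (h a)) F Z"
  let ?P = "PiE A (\<lambda>_. UNIV :: 'b set)"
  have sG: "H.smooth (?G h)" for h
    using insert(1) by (intro H.smooth_intros wd_fold_smooth assms)
  have sS: "H.smooth (\<lambda>Z. \<Sum>h\<in>?P. ?G h Z)" by (intro H.smooth_sum sG)
  have "wd_fold (insert a A) ?u F Z = wd (?u a) (wd_fold A ?u F) Z"
    using insert assms by (simp add: wd_fold_insert wd_fold_smooth sym_mats_sum cscale_sym_mats)
  also have "\<dots> = wd (?u a) (\<lambda>Z. \<Sum>h\<in>?P. ?G h Z) Z"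
    using insert assms by (intro wd_cong wd_fold_smooth sym_mats_sum cscale_sym_mats)
  also have "\<dots> = (\<Sum>c\<in>UNIV. g a c * (\<Sum>h\<in>?P. wd (x a c) (?G h) Z))"
    using insert assms sG sS
    by (subst wd_sum_dir) (auto simp: wd_cscale wd_sum cscale_sym_mats sum_distrib_left)
  also have "\<dots> = (\<Sum>c\<in>UNIV. \<Sum>h\<in>?P. g a c * (\<Prod>a\<in>A. g a (h a)) * wd_fold (insert a A) (\<lambda>b. x b ((h(a := c)) b)) F Z)"
  proof (intro sum.cong refl)
    fix c
    have "wd (x a c) (?G h) Z = (\<Prod>a\<in>A. g a (h a)) * wd_fold (insert a A) (\<lambda>b. x b ((h(a := c)) b)) F Z" for h
    proof -
      have "wd_fold A (\<lambda>b. x b ((h(a := c)) b)) F = wd_fold A (\<lambda>a. x a (h a)) F"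
        using insert by (intro wd_fold_cong) auto
      then show ?thesis
        using insert assms by (simp add: wd_fold_insert wd_fold_smooth wd_cmult)
    qed
    then show "g a c * (\<Sum>h\<in>?P. wd (x a c) (?G h) Z) =
      (\<Sum>h\<in>?P. g a c * (\<Prod>a\<in>A. g a (h a)) * wd_fold (insert a A) (\<lambda>b. x b ((h(a := c)) b)) F Z)"
      by (simp add: sum_distrib_left mult.assoc)
  qed
  also have "\<dots> = (\<Sum>(c, h)\<in>UNIV \<times> ?P. (\<Prod>b\<in>insert a A. g b ((h(a := c)) b)) *
      wd_fold (insert a A) (\<lambda>b. x b ((h(a := c)) b)) F Z)"
  proof -
    have "(\<Prod>b\<in>A. g b ((h(a := c)) b)) = (\<Prod>b\<in>A. g b (h b))" for h c
      using insert by (intro prod.cong) auto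
    then show ?thesis using insert
      by (simp add: sum.cartesian_product)
  qed
  \<comment> \<open>A choice function on \<open>insert a A\<close> is a choice at \<open>a\<close>
    together with one on \<open>A\<close>.\<close>
  also have "\<dots> = (\<Sum>h\<in>PiE (insert a A) (\<lambda>_. UNIV). (\<Prod>b\<in>insert a A. g b (h b)) *
      wd_fold (insert a A) (\<lambda>b. x b (h b)) F Z)"
    unfolding PiE_insert_eq
    using inj_combinator[of a A "\<lambda>_. UNIV :: 'b set"] insert
    by (subst sum.reindex) (auto simp: case_prod_unfold)
  finally show ?case .
qed auto

section \<open>Determinants of commuting directional derivatives\<close>

definition wd_det :: "('n \<Rightarrow> 'n \<Rightarrow> complex^'n::finite^'n) \<Rightarrow> (complex^'n^'n \<Rightarrow> complex) \<Rightarrow> complex^'n^'n \<Rightarrow> complex" where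
  "wd_det X F Z = (\<Sum>s | s permutes UNIV. of_int (sign s) * wd_fold UNIV (\<lambda>a. X a (s a)) F Z)"

lemma permutation_of_permutes: "s permutes (UNIV :: 'n::finite set) \<Longrightarrow> permutation s"
  unfolding permutation_permutes by (intro exI[of _ UNIV]) simp

text \<open>The alternating property in the rows: a permutation \<open>h\<close> reindexes the sum
  at the cost of its sign, and if \<open>h\<close> repeats a row, composition with the transposition
  of the two positions shows that the sum equals its own negative. Commutativity of the derivatives
  is what permits the reindexing.\<close>

lemma wd_fold_alternating:
  fixes h :: "'n::finite \<Rightarrow> 'n"
  shows "(\<Sum>s | s permutes UNIV. of_int (sign s) * wd_fold UNIV (\<lambda>a. X (h a) (s a)) F Z) =
    (if h permutes UNIV then of_int (sign h) * wd_det X F Z else 0)"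
proof (cases "h permutes UNIV")
  case True
  have "(\<Sum>s | s permutes UNIV. of_int (sign s) * wd_fold UNIV (\<lambda>a. X (h a) (s a)) F Z) =
      (\<Sum>s | s permutes UNIV. of_int (sign (s \<circ> h)) * wd_fold UNIV (\<lambda>a. X (h a) ((s \<circ> h) a)) F Z)"
    by (rule sum_permutations_compose_right[OF True])
  also have "\<dots> = (\<Sum>s | s permutes UNIV. of_int (sign h) * (of_int (sign s) * wd_fold UNIV (\<lambda>a. X a (s a)) F Z))"
    using wd_fold_permutes[OF True, of "\<lambda>a. X a (s a)" F for s]
    by (intro sum.cong refl) (simp add: sign_compose permutation_of_permutes True)
  finally show ?thesis using True by (simp add: wd_det_def sum_distrib_left)
next
  case False
  then have "\<not> inj h"
    using finite_UNIV_inj_surj[of h] bij_imp_permutes[of h UNIV] by (auto simp: bij_def)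
  then obtain a b where ab: "a \<noteq> b" "h a = h b" by (auto simp: inj_def)
  let ?r = "Transposition.transpose a b"
  have r: "?r permutes UNIV" by (rule permutes_swap_id) auto
  have hr: "h (?r c) = h c" for c using ab by (auto simp: Transposition.transpose_def)
  let ?s = "\<Sum>s | s permutes UNIV. of_int (sign s) * wd_fold UNIV (\<lambda>a. X (h a) (s a)) F Z"
  have "?s = (\<Sum>s | s permutes UNIV. of_int (sign (s \<circ> ?r)) * wd_fold UNIV (\<lambda>a. X (h a) ((s \<circ> ?r) a)) F Z)"
    by (rule sum_permutations_compose_right[OF r])
  also have "\<dots> = (\<Sum>s | s permutes UNIV. - (of_int (sign s) * wd_fold UNIV (\<lambda>a. X (h a) (s a)) F Z))"
  proof (intro sum.cong refl)
    fix s :: "'n \<Rightarrow> 'n" assume "s \<in> {s. s permutes UNIV}"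
    then have "sign (s \<circ> ?r) = - sign s"
      using ab permutation_of_permutes[of s] permutation_swap_id[of a b]
      by (simp add: sign_compose sign_swap_id)
    moreover have "wd_fold UNIV (\<lambda>c. X (h c) ((s \<circ> ?r) c)) F = wd_fold UNIV (\<lambda>a. X (h a) (s a)) F"
      using wd_fold_permutes[OF r, of "\<lambda>c. X (h c) (s c)" F] by (simp add: hr)
    ultimately show "of_int (sign (s \<circ> ?r)) * wd_fold UNIV (\<lambda>a. X (h a) ((s \<circ> ?r) a)) F Z =
      - (of_int (sign s) * wd_fold UNIV (\<lambda>a. X (h a) (s a)) F Z)" by simp
  qed
  also have "\<dots> = - ?s" by (rule sum_negf)
  finally have "?s = 0" by simp
  then show ?thesis using False by simp
qed

text \<open>Multiplicativity det(g X) = det g det X for a constant matrix \<open>g\<close>: in the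
  multilinear expansion only those choice functions survive that are permutations, and their
  coefficients assemble to det g.\<close>

lemma wd_det_rows:
  fixes g :: "complex^'n::finite^'n"
  assumes "H.smooth F" "\<And>a b. X a b \<in> sym_mats" "Z \<in> siegel"
  shows "wd_det (\<lambda>a b. \<Sum>c\<in>UNIV. cscale (g $ a $ c) (X c b)) F Z = det g * wd_det X F Z"
proof -
  let ?S = "{s. s permutes (UNIV :: 'n set)}"
  have "wd_det (\<lambda>a b. \<Sum>c\<in>UNIV. cscale (g $ a $ c) (X c b)) F Z =
      (\<Sum>s\<in>?S. \<Sum>h\<in>UNIV. (\<Prod>a\<in>UNIV. g $ a $ h a) * (of_int (sign s) * wd_fold UNIV (\<lambda>a. X (h a) (s a)) F Z))"
    unfolding wd_det_def
    using assms wd_fold_multilinear[of UNIV F "\<lambda>a c. X c (s a)" Z "\<lambda>a c. g $ a $ c" for s]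
    by (intro sum.cong refl) (simp add: sum_distrib_left PiE_UNIV_domain mult.left_commute)
  also have "\<dots> = (\<Sum>h\<in>UNIV. (\<Prod>a\<in>UNIV. g $ a $ h a) *
      (\<Sum>s\<in>?S. of_int (sign s) * wd_fold UNIV (\<lambda>a. X (h a) (s a)) F Z))"
    by (subst sum.swap) (simp add: sum_distrib_left)
  also have "\<dots> = (\<Sum>h\<in>UNIV. (\<Prod>a\<in>UNIV. g $ a $ h a) * (if h \<in> ?S then of_int (sign h) * wd_det X F Z else 0))"
    by (simp add: wd_fold_alternating)
  also have "\<dots> = (\<Sum>h\<in>?S. (\<Prod>a\<in>UNIV. g $ a $ h a) * (of_int (sign h) * wd_det X F Z))"
    by (rule sum.mono_neutral_cong_right) auto
  finally show ?thesis
    by (simp add: det_def sum_distrib_left mult_ac)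
qed

lemma wd_det_flip:
  fixes X :: "'n::finite \<Rightarrow> 'n \<Rightarrow> complex^'n^'n"
  shows "wd_det (\<lambda>a b. X b a) F Z = wd_det X F Z"
proof -
  have "wd_det (\<lambda>a b. X b a) F Z =
     (\<Sum>s | s permutes UNIV. of_int (sign (inv s)) * wd_fold UNIV (\<lambda>a. X (inv s a) a) F Z)"
    unfolding wd_det_def by (rule sum_permutations_inverse)
  also have "\<dots> = wd_det X F Z"
    unfolding wd_det_def
  proof (intro sum.cong refl)
    fix s :: "'n \<Rightarrow> 'n" assume "s \<in> {s. s permutes UNIV}"
    then have s: "s permutes UNIV" by simp
    then have "wd_fold UNIV (\<lambda>a. X (inv s a) a) F = wd_fold UNIV (\<lambda>a. X a (s a)) F"
      using wd_fold_permutes[OF s, of "\<lambda>a. X (inv s a) a" F] by (simp add: permutes_inverses)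
    then show "of_int (sign (inv s)) * wd_fold UNIV (\<lambda>a. X (inv s a) a) F Z =
        of_int (sign s) * wd_fold UNIV (\<lambda>a. X a (s a)) F Z"
      by (simp add: sign_inverse permutation_of_permutes[OF s])
  qed
  finally show ?thesis .
qed

text \<open>For the matrix g X g^t the row rule applies twice, the right factor being turned into a
  row operation by \<open>wd_det_flip\<close>.\<close>

lemma wd_det_congruence:
  fixes g :: "complex^'n::finite^'n"
  assumes "H.smooth F" "\<And>a b. X a b \<in> sym_mats" "Z \<in> siegel"
  shows "wd_det (\<lambda>a b. \<Sum>c\<in>UNIV. cscale (g $ a $ c) (\<Sum>d\<in>UNIV. cscale (g $ b $ d) (X c d))) F Z =
    det g ^ 2 * wd_det X F Z"
proof -
  have sym: "(\<Sum>d\<in>UNIV. cscale (g $ b $ d) (X c d)) \<in> sym_mats" for b c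
    using assms(2) by (intro sym_mats_sum cscale_sym_mats)
  have "wd_det (\<lambda>c b. \<Sum>d\<in>UNIV. cscale (g $ b $ d) (X c d)) F Z =
      wd_det (\<lambda>b c. \<Sum>d\<in>UNIV. cscale (g $ b $ d) (X c d)) F Z"
    using wd_det_flip[of "\<lambda>b c. \<Sum>d\<in>UNIV. cscale (g $ b $ d) (X c d)"] .
  also have "\<dots> = det g * wd_det (\<lambda>d c. X c d) F Z"
    by (rule wd_det_rows) (use assms in auto)
  finally show ?thesis
    using wd_det_rows[OF assms(1) sym assms(3), of g] wd_det_flip[of X F Z]
    by (simp add: power2_eq_square)
qed

subsection \<open>Equivariance of the Maass operator\<close>

text \<open>The symmetrised matrix unit. \<open>wd (Esym a b)\<close> is the (a, b) entry of
  \<partial>/\<partial>Z: for a \<noteq> b the two entries 1/2 encode the factor 1/2 in front of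
  \<partial>/\<partial>z_ab.\<close>

definition Esym :: "'n \<Rightarrow> 'n \<Rightarrow> complex^'n::finite^'n" where
  "Esym a b = (\<chi> i j. ((if i = a \<and> j = b then 1 else 0) + (if i = b \<and> j = a then 1 else 0)) / 2)"

lemma Esym_sym [simp]: "Esym a b \<in> sym_mats"
  unfolding sym_mats_iff Esym_def by (simp add: conj_commute add.commute)

definition congr_mat :: "complex^'n::finite^'n \<Rightarrow> complex^'n^'n \<Rightarrow> complex^'n^'n" where
  "congr_mat B U = transpose B ** U ** B"

lemma congr_mat_sym: "U \<in> sym_mats \<Longrightarrow> congr_mat B U \<in> sym_mats"
  by (simp add: sym_mats_transpose congr_mat_def transpose_simps matrix_mul_assoc)

lemma congr_mat_nth: "congr_mat B U $ i $ j = (\<Sum>d\<in>UNIV. \<Sum>c\<in>UNIV. B $ c $ i * U $ c $ d * B $ d $ j)"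
  by (simp add: congr_mat_def matrix_matrix_mult_def transpose_def sum_distrib_right)

lemma congr_mat_cscale: "congr_mat B (cscale c U) = cscale c (congr_mat B U)"
  by (simp add: vec_eq_iff congr_mat_nth sum_distrib_left mult_ac)

text \<open>Transforming every direction \<open>Esym a b\<close> by U \<mapsto> B^t U B amounts to
  replacing the operator matrix X by B X B^t, so that \<open>wd_det_congruence\<close>
  applies.\<close>

lemma congr_mat_Esym:
  "congr_mat B (Esym a b) = (\<Sum>c\<in>UNIV. cscale (B $ a $ c) (\<Sum>d\<in>UNIV. cscale (B $ b $ d) (Esym c d)))"
proof -
  have ind: "(\<Sum>d\<in>UNIV. \<Sum>c\<in>UNIV. f c d * (if c = a \<and> d = b then 1 else 0)) = f a b"
    for f :: "'a \<Rightarrow> 'a \<Rightarrow> complex" and a b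
  proof -
    have "f c d * (if c = a \<and> d = b then 1 else 0) = (if c = a then (if d = b then f a b else 0) else 0)" for c d
      by simp
    then show ?thesis by simp
  qed
  have ind': "(\<Sum>d\<in>UNIV. \<Sum>c\<in>UNIV. f d c * (if a = d \<and> b = c then 1 else 0)) = f a b"
    "(\<Sum>d\<in>UNIV. \<Sum>c\<in>UNIV. f d c * (if a = c \<and> b = d then 1 else 0)) = f b a"
    for f :: "'a \<Rightarrow> 'a \<Rightarrow> complex" and a b
    using ind[of "\<lambda>c d. f d c" b a] ind[of "\<lambda>c d. f d c" a b]
    by (simp_all only: eq_commute[of a] eq_commute[of b] conj_commute[of "_ = a"])
  have split1: "p * ((x + y) / 2) * q = (p * q / 2) * x + (p * q / 2) * y"
    and split2: "p * (q * ((x + y) / 2)) = (p * q / 2) * x + (p * q / 2) * y" for p q x y :: complex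
    by (simp_all add: field_simps)
  have l: "congr_mat B (Esym a b) $ i $ j = (B $ a $ i * B $ b $ j + B $ b $ i * B $ a $ j) / 2" for i j
  proof -
    have "congr_mat B (Esym a b) $ i $ j =
      (\<Sum>d\<in>UNIV. \<Sum>c\<in>UNIV. (B $ c $ i * B $ d $ j / 2) * (if c = a \<and> d = b then 1 else 0)) +
      (\<Sum>d\<in>UNIV. \<Sum>c\<in>UNIV. (B $ c $ i * B $ d $ j / 2) * (if c = b \<and> d = a then 1 else 0))"
      unfolding sum.distrib[symmetric] congr_mat_nth Esym_def vec_lambda_beta split1 ..
    then show ?thesis unfolding ind by (simp add: add_divide_distrib)
  qed
  have r: "(\<Sum>c\<in>UNIV. cscale (B $ a $ c) (\<Sum>d\<in>UNIV. cscale (B $ b $ d) (Esym c d))) $ i $ j =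
      (B $ a $ i * B $ b $ j + B $ b $ i * B $ a $ j) / 2" for i j
  proof -
    have "(\<Sum>c\<in>UNIV. cscale (B $ a $ c) (\<Sum>d\<in>UNIV. cscale (B $ b $ d) (Esym c d))) $ i $ j =
      (\<Sum>d\<in>UNIV. \<Sum>c\<in>UNIV. (B $ a $ d * B $ b $ c / 2) * (if i = d \<and> j = c then 1 else 0)) +
      (\<Sum>d\<in>UNIV. \<Sum>c\<in>UNIV. (B $ a $ d * B $ b $ c / 2) * (if i = c \<and> j = d then 1 else 0))"
      unfolding sum.distrib[symmetric] sum_component cscale_nth sum_distrib_left Esym_def
        vec_lambda_beta split2 ..
    then show ?thesis unfolding ind' by (simp add: add_divide_distrib)
  qed
  show ?thesis unfolding vec_eq_iff l r by blast
qed

lemma wd_congr_mat_Esym: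
  assumes "H.smooth F" "Z \<in> siegel"
  shows "wd (congr_mat B (Esym a b)) F Z =
    (\<Sum>c\<in>UNIV. B $ a $ c * (\<Sum>d\<in>UNIV. B $ b $ d * wd (Esym c d) F Z))"
  unfolding congr_mat_Esym
  by (simp add: wd_sum_dir[OF assms] wd_cscale[OF assms] cscale_sym_mats sym_mats_sum)

lemma wd_det_congr_mat:
  assumes "H.smooth F" "Z \<in> siegel"
  shows "wd_det (\<lambda>a b. congr_mat B (Esym a b)) F Z = det B ^ 2 * wd_det Esym F Z"
  unfolding congr_mat_Esym by (rule wd_det_congruence) (use assms in auto)

lemma wd_det_cong_fun:
  assumes "H.smooth F" "\<And>Z. Z \<in> siegel \<Longrightarrow> F Z = G Z" "Z \<in> siegel"
  shows "wd_det X F Z = wd_det X G Z"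
  unfolding wd_det_def by (intro sum.cong refl arg_cong2[where f = "(*)"] wd_fold_cong_fun[OF _ assms]) simp

lemma wd_det_cmult:
  assumes "H.smooth F" "\<And>a b. X a b \<in> sym_mats" "Z \<in> siegel"
  shows "wd_det X (\<lambda>Z. c * F Z) Z = c * wd_det X F Z"
  unfolding wd_det_def sum_distrib_left
  by (intro sum.cong refl) (simp add: wd_fold_cmult[OF _ assms(1) _ assms(3)] assms(2))

section \<open>The Maass operator and slash operators of weight k\<close>

definition kappa :: "'n::finite itself \<Rightarrow> real" where
  "kappa _ = (real CARD('n) + 1) / 2"

definition det_Im_powr :: "real \<Rightarrow> complex^'n::finite^'n \<Rightarrow> complex" where
  "det_Im_powr s Z = of_real (det (Im_mat Z) powr s)"

lemma smooth_det_Im_powr: "H.smooth (det_Im_powr s)"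
  unfolding det_Im_powr_def
  by (intro H.smooth_powr siegel_smooth_det_Im siegel_det_pos)

definition maass :: "int \<Rightarrow> (complex^'n::finite^'n \<Rightarrow> complex) \<Rightarrow> complex^'n^'n \<Rightarrow> complex" where
  "maass k F Z = det_Im_powr (kappa TYPE('n) - of_int k - 1) Z *
     wd_det Esym (\<lambda>Z. det_Im_powr (of_int k + 1 - kappa TYPE('n)) Z * F Z) Z"

lemma maass_cong:
  assumes "H.smooth F" "\<And>Z. Z \<in> siegel \<Longrightarrow> F Z = G Z" "Z \<in> siegel"
  shows "maass k F Z = maass k G Z"
  unfolding maass_def
  by (subst wd_det_cong_fun[OF H.smooth_mult[OF smooth_det_Im_powr assms(1)] _ assms(3)])
     (use assms in auto)

lemma maass_cmult:
  assumes "H.smooth F" "Z \<in> siegel"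
  shows "maass k (\<lambda>Z. c * F Z) Z = c * maass k F Z"
  unfolding maass_def
  using wd_det_cmult[OF H.smooth_mult[OF smooth_det_Im_powr assms(1)] _ assms(2), of Esym c]
  by (simp add: mult.left_commute)

text \<open>With the slash operator F | \<phi> = j^-k (F \<circ> \<phi>) this says that
  \<open>maass k\<close> intertwines weight k with weight k + 2, for every smooth F and not only for
  invariant ones. Preservation of smoothness and of the half space is included so that the property
  is closed under composition.\<close>

definition equivariant :: "(complex^'n::finite^'n \<Rightarrow> complex^'n^'n) \<Rightarrow> (complex^'n^'n \<Rightarrow> complex) \<Rightarrow> bool" where
  "equivariant \<phi> j \<longleftrightarrow> (\<forall>Z\<in>siegel. \<phi> Z \<in> siegel \<and> j Z \<noteq> 0) \<and>
     (\<forall>k F. H.smooth F \<longrightarrow> H.smooth (\<lambda>Z. j Z powi (- k) * F (\<phi> Z)) \<and>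
        (\<forall>Z\<in>siegel. maass k (\<lambda>Z. j Z powi (- k) * F (\<phi> Z)) Z = j Z powi (- k - 2) * maass k F (\<phi> Z)))"

lemma equivariant_cong:
  assumes eq: "equivariant \<phi> j"
    and cong: "\<And>Z. Z \<in> siegel \<Longrightarrow> \<psi> Z = \<phi> Z" "\<And>Z. Z \<in> siegel \<Longrightarrow> i Z = j Z"
  shows "equivariant \<psi> i"
  unfolding equivariant_def
proof (intro conjI ballI allI impI)
  fix k and F :: "complex^'a^'a \<Rightarrow> complex" and Z :: "complex^'a^'a" assume F: "H.smooth F"
  have sm: "H.smooth (\<lambda>Z. j Z powi (- k) * F (\<phi> Z))"
    using eq F unfolding equivariant_def by blast
  show "H.smooth (\<lambda>Z. i Z powi (- k) * F (\<psi> Z))"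
    by (rule H.smooth_transform[OF sm]) (simp add: cong)
  assume Z: "Z \<in> siegel"
  have "maass k (\<lambda>Z. j Z powi (- k) * F (\<phi> Z)) Z = maass k (\<lambda>Z. i Z powi (- k) * F (\<psi> Z)) Z"
    by (rule maass_cong[OF sm _ Z]) (simp add: cong)
  then show "maass k (\<lambda>Z. i Z powi (- k) * F (\<psi> Z)) Z = i Z powi (- k - 2) * maass k F (\<psi> Z)"
    using eq F Z cong unfolding equivariant_def by simp
qed (use assms in \<open>auto simp: equivariant_def\<close>)

lemma equivariant_compose:
  assumes 1: "equivariant \<phi> i" and 2: "equivariant \<psi> j"
  shows "equivariant (\<lambda>Z. \<phi> (\<psi> Z)) (\<lambda>Z. i (\<psi> Z) * j Z)"
  unfolding equivariant_def
proof (intro conjI ballI allI impI)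
  fix k and F :: "complex^'a^'a \<Rightarrow> complex" and Z :: "complex^'a^'a" assume F: "H.smooth F"
  let ?G = "\<lambda>Z. i Z powi (- k) * F (\<phi> Z)"
  have G: "H.smooth ?G" using 1 F unfolding equivariant_def by blast
  have eq: "(i (\<psi> Z) * j Z) powi (- k) * F (\<phi> (\<psi> Z)) = j Z powi (- k) * ?G (\<psi> Z)" for Z
    by (simp add: power_int_mult_distrib mult_ac)
  show "H.smooth (\<lambda>Z. (i (\<psi> Z) * j Z) powi (- k) * F (\<phi> (\<psi> Z)))"
    unfolding eq using 2 G unfolding equivariant_def by blast
  assume Z: "Z \<in> siegel"
  then have "\<psi> Z \<in> siegel" using 2 unfolding equivariant_def by blast
  then have "maass k ?G (\<psi> Z) = i (\<psi> Z) powi (- k - 2) * maass k F (\<phi> (\<psi> Z))"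
    using 1 F unfolding equivariant_def by blast
  moreover have "maass k (\<lambda>Z. j Z powi (- k) * ?G (\<psi> Z)) Z = j Z powi (- k - 2) * maass k ?G (\<psi> Z)"
    using 2 G Z unfolding equivariant_def by blast
  ultimately show "maass k (\<lambda>Z. (i (\<psi> Z) * j Z) powi (- k) * F (\<phi> (\<psi> Z))) Z =
      (i (\<psi> Z) * j Z) powi (- k - 2) * maass k F (\<phi> (\<psi> Z))"
    unfolding eq by (simp add: power_int_mult_distrib mult_ac)
qed (use assms in \<open>auto simp: equivariant_def\<close>)

text \<open>Conjugation by the power of \<open>det Y\<close> turns the weight \<open>k\<close> automorphy factor into
  \<open>j\<^bsup>-k\<^esup>\<bar>j\<bar>\<^bsup>2(k+1-\<kappa>)\<^esup>\<close>, whose holomorphic logarithmic derivative is that of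
  \<open>j\<^bsup>1-\<kappa>\<^esup>\<close>, independently of \<open>k\<close>.\<close>

definition maass_factor :: "int \<Rightarrow> (complex^'n::finite^'n \<Rightarrow> complex) \<Rightarrow> complex^'n^'n \<Rightarrow> complex" where
  "maass_factor k j Z = j Z powi (- k) * of_real ((cmod (j Z) ^ 2) powr (of_int k + 1 - kappa TYPE('n)))"

lemma smooth_maass_factor:
  assumes j: "H.smooth j" and nz: "\<And>Z. Z \<in> siegel \<Longrightarrow> j Z \<noteq> 0"
  shows "H.smooth (maass_factor k j)"
proof -
  have "H.smooth (\<lambda>Z. j Z * cnj (j Z))" by (intro H.smooth_intros j)
  then have sq: "H.smooth (\<lambda>Z. of_real (cmod (j Z) ^ 2))"
    unfolding complex_norm_square .
  show ?thesis
    unfolding maass_factor_def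
    by (intro H.smooth_mult H.smooth_powi H.smooth_powr sq j nz) (use nz in auto)
qed

text \<open>Since det Y = |j|^2 det(Im \<phi>(Z)), the power of det Y inside \<open>maass\<close>
  moves behind \<phi> at the cost of a power of |j|^2, which joins j^-k to form
  \<open>maass_factor\<close>. The outer power of det Y contributes the inverse power of |j|^2, so
  what remains is \<open>core\<close>, a statement free of det Y.\<close>

lemma equivariantI:
  fixes \<phi> :: "complex^'n::finite^'n \<Rightarrow> complex^'n^'n"
  assumes maps: "\<And>Z. Z \<in> siegel \<Longrightarrow> \<phi> Z \<in> siegel" and nz: "\<And>Z. Z \<in> siegel \<Longrightarrow> j Z \<noteq> 0"
    and entries: "\<And>a b. H.smooth (\<lambda>Z. \<phi> Z $ a $ b)" and j: "H.smooth j"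
    and det_Im: "\<And>Z. Z \<in> siegel \<Longrightarrow> det (Im_mat Z) = cmod (j Z) ^ 2 * det (Im_mat (\<phi> Z))"
    and core: "\<And>k F Z. H.smooth F \<Longrightarrow> Z \<in> siegel \<Longrightarrow>
      wd_det Esym (\<lambda>Z. maass_factor k j Z * F (\<phi> Z)) Z = maass_factor k j Z * j Z powi (-2) * wd_det Esym F (\<phi> Z)"
  shows "equivariant \<phi> j"
  unfolding equivariant_def
proof (intro conjI ballI allI impI)
  fix k and F :: "complex^'n^'n \<Rightarrow> complex" and Z :: "complex^'n^'n" assume F: "H.smooth F"
  show "H.smooth (\<lambda>Z. j Z powi (- k) * F (\<phi> Z))"
    by (rule H.smooth_mult[OF H.smooth_powi[OF j nz] siegel_smooth_compose[OF maps entries F]])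
  assume Z: "Z \<in> siegel"
  let ?s = "of_int k + 1 - kappa TYPE('n)"
  have neg: "kappa TYPE('n) - of_int k - 1 = - ?s" by simp
  have powr: "det_Im_powr s Z = of_real ((cmod (j Z) ^ 2) powr s) * det_Im_powr s (\<phi> Z)" if "Z \<in> siegel" for s Z
    using det_Im[OF that] siegel_det_pos[OF maps[OF that]]
    by (simp add: det_Im_powr_def powr_mult)
  have sm: "H.smooth (\<lambda>Z. det_Im_powr ?s Z * F Z)"
    by (intro H.smooth_mult smooth_det_Im_powr F)
  have sm2: "H.smooth (\<lambda>Z. maass_factor k j Z * (det_Im_powr ?s (\<phi> Z) * F (\<phi> Z)))"
    by (rule H.smooth_mult[OF smooth_maass_factor[OF j nz] siegel_smooth_compose[OF maps entries sm]])
  have "wd_det Esym (\<lambda>Z. det_Im_powr ?s Z * (j Z powi (- k) * F (\<phi> Z))) Z =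
      wd_det Esym (\<lambda>Z. maass_factor k j Z * (det_Im_powr ?s (\<phi> Z) * F (\<phi> Z))) Z"
    by (rule wd_det_cong_fun[OF sm2 _ Z, symmetric]) (simp add: powr maass_factor_def)
  also have "\<dots> = maass_factor k j Z * j Z powi (-2) * wd_det Esym (\<lambda>Z. det_Im_powr ?s Z * F Z) (\<phi> Z)"
    using core[OF sm Z] by simp
  finally have "maass k (\<lambda>Z. j Z powi (- k) * F (\<phi> Z)) Z =
      det_Im_powr (- ?s) Z * (maass_factor k j Z * j Z powi (-2) * wd_det Esym (\<lambda>Z. det_Im_powr ?s Z * F Z) (\<phi> Z))"
    by (simp only: maass_def neg)
  also have "\<dots> = (of_real ((cmod (j Z) ^ 2) powr (- ?s)) * of_real ((cmod (j Z) ^ 2) powr ?s)) *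
      (j Z powi (- k) * j Z powi (-2)) * maass k F (\<phi> Z)"
    unfolding maass_def neg powr[OF Z, of "- ?s"] maass_factor_def by (simp only: mult_ac)
  also have "of_real ((cmod (j Z) ^ 2) powr (- ?s)) * of_real ((cmod (j Z) ^ 2) powr ?s) = (1 :: complex)"
    using nz[OF Z] by (simp flip: of_real_mult powr_add)
  also have "j Z powi (- k) * j Z powi (-2) = j Z powi (- k - 2)"
    using nz[OF Z] by (simp flip: power_int_add)
  finally show "maass k (\<lambda>Z. j Z powi (- k) * F (\<phi> Z)) Z = j Z powi (- k - 2) * maass k F (\<phi> Z)" by simp
qed (use maps nz in auto)

section \<open>Affine symplectic maps\<close>

lemma wd_fold_affine:
  assumes F: "H.smooth F" and maps: "\<And>Z. Z \<in> siegel \<Longrightarrow> \<phi> Z \<in> siegel"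
    and entries: "\<And>a b. H.smooth (\<lambda>Z. \<phi> Z $ a $ b)"
    and \<phi>': "\<And>Z. Z \<in> siegel \<Longrightarrow> (\<phi> has_derivative congr_mat B) (at Z within siegel)"
    and A: "finite A" "\<And>a. a \<in> A \<Longrightarrow> u a \<in> sym_mats" and Z: "Z \<in> siegel"
  shows "wd_fold A u (\<lambda>Z. F (\<phi> Z)) Z = wd_fold A (\<lambda>a. congr_mat B (u a)) F (\<phi> Z)"
  using wd_fold_transfer[where q = "\<lambda>_. 1" and \<phi> = \<phi> and F = F and A = A and u = u and Z = Z
      and v = "\<lambda>a. congr_mat B (u a)"] siegel_smooth_compose[OF maps entries] A Z
    wd_compose[OF _ maps _ \<phi>' _ congr_mat_sym congr_mat_cscale]
  by (simp add: maps F congr_mat_sym)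

lemma Im_mat_congr: "Im_mat (cmat_of_real g ** Z ** cmat_of_real h) = g ** Im_mat Z ** h"
  by (simp add: vec_eq_iff matrix_matrix_mult_def)

lemma positive_definite_congr:
  fixes Y :: "real^'n^'n"
  assumes Y: "positive_definite Y" and g: "det g \<noteq> 0"
  shows "positive_definite (g ** Y ** transpose g)"
  unfolding positive_definite_def
proof (intro conjI allI impI)
  show "symmetric_mat (g ** Y ** transpose g)"
    using Y by (simp add: positive_definite_def symmetric_mat_def transpose_simps matrix_mul_assoc)
  fix x :: "real^'n" assume x: "x \<noteq> 0"
  have "transpose g *v x \<noteq> 0"
  proof
    assume 0: "transpose g *v x = 0"
    have "x = (transpose (matrix_inv g) ** transpose g) *v x"
      by (simp add: matrix_transpose_mul[symmetric] matrix_inv_right[OF g])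
    also have "\<dots> = 0" using 0 by (simp only: matrix_vector_mul_assoc[symmetric] matrix_vector_mult_0_right)
    finally show False using x by simp
  qed
  then have "0 < (transpose g *v x) \<bullet> (Y *v (transpose g *v x))"
    using Y unfolding positive_definite_def by blast
  also have "\<dots> = x \<bullet> ((g ** Y ** transpose g) *v x)"
    by (simp only: matrix_vector_mul_assoc[symmetric] dot_lmul_matrix[symmetric] transpose_matrix_vector)
  finally show "0 < x \<bullet> ((g ** Y ** transpose g) *v x)" .
qed

text \<open>The derivative is a constant congruence, so det(\<partial>/\<partial>Z) is multiplied by
  (det g)^2 = j^-2 and no lower order terms arise. The constant j = 1 / det g is the determinant of
  the lower right block g^-t of the corresponding symplectic matrix.\<close>

lemma equivariant_affine:
  fixes g S :: "real^'n::finite^'n"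
  assumes g: "det g \<noteq> 0" and S: "symmetric_mat S"
  shows "equivariant (\<lambda>Z. cmat_of_real g ** Z ** transpose (cmat_of_real g) + cmat_of_real S)
    (\<lambda>_. inverse (of_real (det g)))"
proof (rule equivariantI)
  let ?\<phi> = "\<lambda>Z. cmat_of_real g ** Z ** transpose (cmat_of_real g) + cmat_of_real S"
  let ?B = "transpose (cmat_of_real g)"
  have Im: "Im_mat (?\<phi> Z) = g ** Im_mat Z ** transpose g" for Z
    using Im_mat_congr[of g Z "transpose g"] by (simp add: vec_eq_iff transpose_map_matrix)
  show maps: "?\<phi> Z \<in> siegel" if Z: "Z \<in> siegel" for Z
  proof -
    have "transpose (?\<phi> Z) = ?\<phi> Z"
      using siegel_sym[OF Z] S
      by (simp add: transpose_simps matrix_mul_assoc sym_mats_transpose transpose_map_matrix symmetric_mat_def)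
    then show ?thesis
      using Z positive_definite_congr[OF _ g] Im by (auto simp: siegel_def symmetric_mat_def)
  qed
  show "inverse (complex_of_real (det g)) \<noteq> 0" if "Z \<in> siegel" for Z :: "complex^'n^'n" using g by simp
  show entries: "H.smooth (\<lambda>Z. ?\<phi> Z $ a $ b)" for a b
    by (simp, intro H.smooth_add H.smooth_matrix_mult) (auto intro: smooth_entry)
  show "H.smooth (\<lambda>_. inverse (complex_of_real (det g)))" by simp
  show "det (Im_mat Z) = cmod (inverse (complex_of_real (det g))) ^ 2 * det (Im_mat (?\<phi> Z))" for Z
  proof -
    have "cmod (inverse (complex_of_real (det g))) ^ 2 * det g ^ 2 = 1"
      using g by (simp add: norm_inverse power_inverse)
    then show ?thesis unfolding Im by (simp add: det_mul power2_eq_square mult_ac)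
  qed
  fix k and F :: "complex^'n^'n \<Rightarrow> complex" and Z :: "complex^'n^'n" assume F: "H.smooth F" and Z: "Z \<in> siegel"
  have lin: "linear (congr_mat ?B)"
    by (auto intro!: linearI simp: congr_mat_def matrix_distribs matrix_scalar_ac scalar_matrix_assoc[symmetric])
  have \<phi>': "(?\<phi> has_derivative congr_mat ?B) (at Z within siegel)" for Z
  proof -
    have "(congr_mat ?B has_derivative congr_mat ?B) (at Z within siegel)"
      using lin linear_conv_bounded_linear bounded_linear_imp_has_derivative by blast
    then have "((\<lambda>Z. congr_mat ?B Z + cmat_of_real S) has_derivative congr_mat ?B) (at Z within siegel)"
      by (rule has_derivative_add_const)
    then show ?thesis by (simp add: congr_mat_def)
  qed
  have "wd_det Esym (\<lambda>Z. F (?\<phi> Z)) Z = wd_det (\<lambda>a b. congr_mat ?B (Esym a b)) F (?\<phi> Z)"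
    unfolding wd_det_def
    by (intro sum.cong refl, subst wd_fold_affine[OF F maps entries \<phi>' _ _ Z]) auto
  also have "\<dots> = det ?B ^ 2 * wd_det Esym F (?\<phi> Z)"
    by (rule wd_det_congr_mat[OF F maps[OF Z]])
  finally have "wd_det Esym (\<lambda>Z. F (?\<phi> Z)) Z = of_real (det g) ^ 2 * wd_det Esym F (?\<phi> Z)"
    by (simp add: det_cmat_of_real)
  moreover have "wd_det Esym (\<lambda>Z. maass_factor k (\<lambda>_. inverse (complex_of_real (det g))) Z * F (?\<phi> Z)) Z
      = maass_factor k (\<lambda>_. inverse (complex_of_real (det g))) Z * wd_det Esym (\<lambda>Z. F (?\<phi> Z)) Z"
    unfolding maass_factor_def
    by (rule wd_det_cmult[OF siegel_smooth_compose[OF maps entries F] _ Z]) auto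
  ultimately show "wd_det Esym (\<lambda>Z. maass_factor k (\<lambda>_. inverse (complex_of_real (det g))) Z * F (?\<phi> Z)) Z =
      maass_factor k (\<lambda>_. inverse (complex_of_real (det g))) Z * inverse (complex_of_real (det g)) powi (-2) *
      wd_det Esym F (?\<phi> Z)"
    by (simp add: power_int_minus power_inverse)
qed

subsection \<open>Rank one inversions\<close>

lemma has_derivative_matrixI:
  fixes f :: "'a::real_normed_vector \<Rightarrow> 'b::euclidean_space^'n^'m"
  assumes "\<And>i j. ((\<lambda>x. f x $ i $ j) has_derivative (\<lambda>h. f' h $ i $ j)) (at x within S)"
  shows "(f has_derivative f') (at x within S)"
  unfolding has_derivative_componentwise_within[of f]
proof
  fix u :: "'b^'n^'m" assume "u \<in> Basis"
  then obtain i j w where u: "u = axis i (axis j w)" by (auto simp: Basis_vec_def)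
  show "((\<lambda>x. f x \<bullet> u) has_derivative (\<lambda>x. f' x \<bullet> u)) (at x within S)"
    unfolding u inner_axis by (intro has_derivative_inner_left assms)
qed

lemma siegel_Im_diag_pos:
  assumes "Z \<in> siegel"
  shows "Im (Z $ e $ e) > 0"
proof -
  have "0 < axis e 1 \<bullet> (Im_mat Z *v axis e 1)"
    using assms unfolding siegel_def positive_definite_def by (simp add: axis_eq_0_iff)
  then show ?thesis by (simp add: inner_axis' matrix_vector_mult_basis column_def)
qed

text \<open>The substitution Z \<mapsto> Z N^-1 with N = 1 + t e e^t Z is written out in entries by
  the Sherman-Morrison formula: \<open>inv_denom\<close> is det N, \<open>inv_jac\<close> is N^-1
  and \<open>inv_map\<close> is the substitution itself. Entries are read from column e, which for
  symmetric Z is also row e.\<close>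

definition inv_denom :: "'n \<Rightarrow> real \<Rightarrow> complex^'n::finite^'n \<Rightarrow> complex" where
  "inv_denom e t Z = 1 + of_real t * Z $ e $ e"

abbreviation (input) inv_ratio :: "'n \<Rightarrow> real \<Rightarrow> complex^'n::finite^'n \<Rightarrow> complex" where
  "inv_ratio e t Z \<equiv> of_real t * inverse (inv_denom e t Z)"

definition inv_jac :: "'n \<Rightarrow> real \<Rightarrow> complex^'n::finite^'n \<Rightarrow> complex^'n^'n" where
  "inv_jac e t Z = (\<chi> a b. (if a = b then 1 else 0) -
     (if a = e then inv_ratio e t Z * Z $ b $ e else 0))"

definition inv_deriv :: "'n \<Rightarrow> real \<Rightarrow> complex^'n::finite^'n \<Rightarrow> complex^'n^'n \<Rightarrow> complex^'n^'n" where
  "inv_deriv e t Z V = (\<chi> a b. V $ a $ b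
     - inv_ratio e t Z * (V $ a $ e * Z $ b $ e + Z $ a $ e * V $ b $ e)
     + (inv_ratio e t Z) ^ 2 * V $ e $ e * Z $ a $ e * Z $ b $ e)"

definition inv_map :: "'n \<Rightarrow> real \<Rightarrow> complex^'n::finite^'n \<Rightarrow> complex^'n^'n" where
  "inv_map e t Z = (\<chi> a b. Z $ a $ b - inv_ratio e t Z * (Z $ a $ e * Z $ b $ e))"

lemma inv_denom_nz:
  assumes "Z \<in> siegel"
  shows "inv_denom e t Z \<noteq> 0"
proof
  assume "inv_denom e t Z = 0"
  then have "Re (inv_denom e t Z) = 0" "Im (inv_denom e t Z) = 0" by simp_all
  then show False using siegel_Im_diag_pos[OF assms, of e] by (simp add: inv_denom_def)
qed

lemma smooth_inv_denom: "H.smooth (inv_denom e t)"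
  unfolding inv_denom_def
  by (intro H.smooth_intros smooth_entry)

lemma smooth_inverse_inv_denom: "H.smooth (\<lambda>Z. inverse (inv_denom e t Z))"
  by (rule H.smooth_inverse[OF smooth_inv_denom inv_denom_nz])

lemma smooth_inv_map: "H.smooth (\<lambda>Z. inv_map e t Z $ a $ b)"
  unfolding inv_map_def vec_lambda_beta
  by (intro H.smooth_intros smooth_entry smooth_inverse_inv_denom)

lemma smooth_inv_jac: "H.smooth (\<lambda>Z. inv_jac e t Z $ a $ b)"
proof (cases "a = e")
  case True
  then show ?thesis
    unfolding inv_jac_def vec_lambda_beta True simp_thms if_True
    by (intro H.smooth_intros smooth_entry smooth_inverse_inv_denom)
qed (simp add: inv_jac_def)

lemma inv_denom_has_derivative:
  "(inv_denom e t has_derivative (\<lambda>V. of_real t * V $ e $ e)) (at Z within S)"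
  unfolding inv_denom_def
  by (auto intro!: derivative_eq_intros bounded_linear.has_derivative[OF bounded_linear_mat_entry])

lemma inverse_inv_denom_has_derivative:
  assumes "Z \<in> siegel"
  shows "((\<lambda>Z. inverse (inv_denom e t Z)) has_derivative
    (\<lambda>V. - (of_real t * V $ e $ e * inverse (inv_denom e t Z) ^ 2))) (at Z within S)"
  using Deriv.has_derivative_inverse[OF inv_denom_nz[OF assms] inv_denom_has_derivative]
  by (simp add: power2_eq_square mult_ac)

lemma inv_map_has_derivative:
  assumes "Z \<in> siegel"
  shows "(inv_map e t has_derivative inv_deriv e t Z) (at Z within siegel)"
proof (rule has_derivative_matrixI)
  fix a b
  have entry: "((\<lambda>Z. Z $ i $ j) has_derivative (\<lambda>V. V $ i $ j)) (at Z within siegel)" for i j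
    by (rule bounded_linear_imp_has_derivative[OF bounded_linear_mat_entry])
  show "((\<lambda>Z. inv_map e t Z $ a $ b) has_derivative (\<lambda>V. inv_deriv e t Z V $ a $ b)) (at Z within siegel)"
    unfolding inv_map_def inv_deriv_def vec_lambda_beta
    by (rule has_derivative_eq_rhs, rule has_derivative_diff[OF entry has_derivative_mult[OF
          has_derivative_mult_right[OF inverse_inv_denom_has_derivative[OF assms]] has_derivative_mult[OF entry entry]]])
       (simp add: fun_eq_iff algebra_simps power2_eq_square)
qed

lemma matrix_mult_nth: "(A ** B) $ i $ j = (\<Sum>k\<in>UNIV. A $ i $ k * B $ k $ j)"
  by (simp add: matrix_matrix_mult_def)

lemma mult_inv_jac:
  "(U ** inv_jac e t Z) $ c $ b = U $ c $ b - inv_ratio e t Z * U $ c $ e * Z $ b $ e"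
proof -
  let ?r = "inv_ratio e t Z"
  have "(U ** inv_jac e t Z) $ c $ b = (\<Sum>d\<in>UNIV. (if d = b then U $ c $ d else 0)) -
     (\<Sum>d\<in>UNIV. (if d = e then U $ c $ d * (?r * Z $ b $ e) else 0))"
    unfolding sum_subtractf[symmetric] by (auto simp: matrix_matrix_mult_def inv_jac_def algebra_simps intro!: sum.cong)
  then show ?thesis by (simp add: mult_ac)
qed

text \<open>The differential of Z N^-1 is V \<mapsto> N^-t V N^-1 on symmetric matrices; the
  symmetry of \<open>U\<close> enters as \<open>U $ e $ b = U $ b $ e\<close>.\<close>

lemma congr_inv_jac:
  assumes U: "U \<in> sym_mats"
  shows "congr_mat (inv_jac e t Z) U = inv_deriv e t Z U"
proof -
  let ?r = "inv_ratio e t Z"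
  note l = mult_inv_jac[of U e t Z]
  have "congr_mat (inv_jac e t Z) U $ a $ b = (\<Sum>c\<in>UNIV. inv_jac e t Z $ c $ a * (U ** inv_jac e t Z) $ c $ b)" for a b
    unfolding congr_mat_def matrix_mul_assoc[symmetric] matrix_mult_nth[of "transpose (inv_jac e t Z)"]
    by (simp add: transpose_def)
  also have "\<dots> a b = (\<Sum>c\<in>UNIV. (if c = a then (U ** inv_jac e t Z) $ c $ b else 0)) -
       (\<Sum>c\<in>UNIV. (if c = e then ?r * Z $ a $ e * (U ** inv_jac e t Z) $ c $ b else 0))" for a b
    unfolding sum_subtractf[symmetric] by (auto simp: inv_jac_def algebra_simps intro!: sum.cong)
  finally have c: "congr_mat (inv_jac e t Z) U $ a $ b = (U ** inv_jac e t Z) $ a $ b -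
      ?r * Z $ a $ e * (U ** inv_jac e t Z) $ e $ b" for a b by simp
  have comm: "U $ e $ b = U $ b $ e" for b using U by (simp add: sym_mats_iff)
  show ?thesis
    unfolding vec_eq_iff inv_deriv_def vec_lambda_beta
  proof (intro allI)
    fix a b
    show "congr_mat (inv_jac e t Z) U $ a $ b = U $ a $ b
      - ?r * (U $ a $ e * Z $ b $ e + Z $ a $ e * U $ b $ e) + ?r ^ 2 * U $ e $ e * Z $ a $ e * Z $ b $ e"
      unfolding c l comm[of b] by (simp add: algebra_simps power2_eq_square)
  qed
qed

lemma inv_jac_other: "a \<noteq> e \<Longrightarrow> inv_jac e t Z $ a $ b = (if a = b then 1 else 0)"
  by (simp add: inv_jac_def)

text \<open>\<open>inv_jac\<close> is the identity matrix with row e replaced by the vector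
  \<open>x\<close>, so its determinant is \<open>x $ e\<close>.\<close>

lemma det_inv_jac:
  assumes Z: "Z \<in> siegel"
  shows "det (inv_jac e t Z) = inverse (inv_denom e t Z)"
proof -
  let ?r = "inv_ratio e t Z"
  define x :: "complex^'a" where "x = (\<chi> b. (if b = e then 1 else 0) - ?r * Z $ b $ e)"
  have "(\<Sum>i\<in>UNIV. x $ i *s row i (mat 1)) = x"
    by (simp add: vec_eq_iff row_def mat_def if_distrib cong: if_cong)
  then have "inv_jac e t Z = (\<chi> i. if i = e then (\<Sum>i\<in>UNIV. x $ i *s row i (mat 1)) else row i (mat 1))"
    by (simp add: vec_eq_iff inv_jac_def x_def row_def mat_def)
  then have "det (inv_jac e t Z) = x $ e" using cramer_lemma_transpose[of e x "mat 1"] by simp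
  also have "\<dots> = inverse (inv_denom e t Z)"
    using inv_denom_nz[OF Z, of e t] by (simp add: x_def field_simps inv_denom_def)
  finally show ?thesis .
qed

text \<open>\<open>m\<close> stands for the automorphy factor, of which only the logarithmic
  derivative matters: that of \<open>inv_denom\<close> is t U_ee / (1 + t Z_ee), so for
  \<open>wd\<close> the function \<open>m\<close> behaves like the c-th power of
  \<open>inv_denom\<close>. The exponent c stays free until the lower order terms are
  summed.\<close>

context
  fixes e :: "'n::finite" and t :: real and m :: "complex^'n^'n \<Rightarrow> complex" and c :: complex
  assumes maps: "\<And>Z. Z \<in> siegel \<Longrightarrow> inv_map e t Z \<in> siegel"
    and m: "H.smooth m"
    and wd_m: "\<And>Z U. Z \<in> siegel \<Longrightarrow> U \<in> sym_mats \<Longrightarrow>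
      wd U m Z = c * (inv_ratio e t Z) * U $ e $ e * m Z"
begin

lemma smooth_mult_inv_map:
  assumes "H.smooth q" "H.smooth G"
  shows "H.smooth (\<lambda>Z. q Z * G (inv_map e t Z))"
  by (rule H.smooth_mult[OF assms(1) siegel_smooth_compose[OF maps smooth_inv_map assms(2)]])

lemma wd_mult_inv_map:
  assumes q: "H.smooth q" and G: "H.smooth G" and Z: "Z \<in> siegel" and U: "U \<in> sym_mats"
  shows "wd U (\<lambda>Z. q Z * G (inv_map e t Z)) Z =
    wd U q Z * G (inv_map e t Z) + q Z * wd (congr_mat (inv_jac e t Z) U) G (inv_map e t Z)"
proof -
  let ?D = "inv_deriv e t Z"
  have D: "?D V = congr_mat (inv_jac e t Z) V" if "V \<in> sym_mats" for V
    using congr_inv_jac[OF that] by simp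
  have "wd U (\<lambda>Z. G (inv_map e t Z)) Z = wd (?D U) G (inv_map e t Z)"
    by (rule wd_compose[OF G maps Z inv_map_has_derivative[OF Z] U])
       (use U in \<open>simp_all only: D cscale_sym_mats congr_mat_sym congr_mat_cscale\<close>)
  then show ?thesis
    using wd_mult[OF q siegel_smooth_compose[OF maps smooth_inv_map G] Z U] D[OF U] by simp
qed

lemma congr_inv_jac_other:
  assumes "a \<noteq> e" "b \<noteq> e"
  shows "congr_mat (inv_jac e t Z) (Esym a b) = Esym a b"
  unfolding congr_inv_jac[OF Esym_sym] using assms by (simp add: vec_eq_iff inv_deriv_def Esym_def)

text \<open>A direction \<open>Esym a b\<close> with a, b \<noteq> e has zero column e, so the
  derivative of \<open>m\<close> vanishes along it and the Jacobian of the substitution fixes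
  it.\<close>

lemma wd_fold_inv_map_other:
  assumes F: "H.smooth F" and A: "finite A" "\<And>a. a \<in> A \<Longrightarrow> x a \<noteq> e \<and> y a \<noteq> e"
    and Z: "Z \<in> siegel"
  shows "wd_fold A (\<lambda>a. Esym (x a) (y a)) (\<lambda>Z. m Z * F (inv_map e t Z)) Z =
    m Z * wd_fold A (\<lambda>a. Esym (x a) (y a)) F (inv_map e t Z)"
proof (rule wd_fold_transfer[where \<phi> = "inv_map e t" and q = m, OF maps smooth_mult_inv_map[OF m] _ _ A(1) F Z])
  fix a and G :: "complex^'n^'n \<Rightarrow> complex" and Z :: "complex^'n^'n"
  assume a: "a \<in> A" and G: "H.smooth G" and Z: "Z \<in> siegel"
  have nz: "x a \<noteq> e" "y a \<noteq> e" using A(2)[OF a] by auto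
  have "Esym (x a) (y a) $ e $ e = 0" using nz by (simp add: Esym_def)
  then show "wd (Esym (x a) (y a)) (\<lambda>Z. m Z * G (inv_map e t Z)) Z =
      m Z * wd (Esym (x a) (y a)) G (inv_map e t Z)"
    by (simp add: wd_mult_inv_map[OF m G Z] wd_m[OF Z] congr_inv_jac_other[OF nz])
qed auto

text \<open>The source of the lower order terms. For b \<noteq> e the direction has vanishing (e, e)
  entry, so \<open>m\<close> and the denominator are stationary; only the numerator
  \<open>Z $ d $ e\<close> moves, with speed 1/2 and only for d = b.\<close>

lemma wd_inv_jac_row:
  assumes b: "b \<noteq> e" and Z: "Z \<in> siegel"
  shows "wd (Esym e b) (\<lambda>Z. m Z * inv_jac e t Z $ e $ d) Z =
    - (if d = b then inv_ratio e t Z / 2 * m Z else 0)"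
proof -
  have 0: "Esym e b $ e $ e = 0" using b by (simp add: Esym_def)
  have entry: "((\<lambda>Z. Z $ d $ e) has_derivative (\<lambda>V. V $ d $ e)) (at Z within siegel)"
    by (rule bounded_linear_imp_has_derivative[OF bounded_linear_mat_entry])
  have D: "((\<lambda>Z. inv_jac e t Z $ e $ d) has_derivative
      (\<lambda>V. 0 - (inv_ratio e t Z * V $ d $ e +
        of_real t * - (of_real t * V $ e $ e * inverse (inv_denom e t Z) ^ 2) * Z $ d $ e))) (at Z within siegel)"
    unfolding inv_jac_def vec_lambda_beta simp_thms if_True
    by (intro has_derivative_diff has_derivative_const has_derivative_mult has_derivative_mult_right
        entry inverse_inv_denom_has_derivative[OF Z])
  have de: "Esym e b $ d $ e = (if d = b then 1 / 2 else 0)" using b by (auto simp: Esym_def)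
  have "wd (Esym e b) (\<lambda>Z. inv_jac e t Z $ e $ d) Z = - (if d = b then inv_ratio e t Z / 2 else 0)"
    unfolding wd_eq[OF D Z Esym_sym] using 0 de by (simp add: field_simps)
  then show ?thesis
    unfolding wd_mult[OF m smooth_inv_jac Z Esym_sym] wd_m[OF Z Esym_sym] 0 by simp
qed

lemma wd_congr_inv_jac_row:
  assumes a: "a \<noteq> e" and G: "H.smooth G" and Z: "Z \<in> siegel"
  shows "wd (congr_mat (inv_jac e t Z') (Esym a e)) G Z =
    (\<Sum>d\<in>UNIV. inv_jac e t Z' $ e $ d * wd (Esym a d) G Z)"
proof -
  have "wd (congr_mat (inv_jac e t Z') (Esym a e)) G Z =
     (\<Sum>c\<in>UNIV. if c = a then (\<Sum>d\<in>UNIV. inv_jac e t Z' $ e $ d * wd (Esym c d) G Z) else 0)"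
    unfolding wd_congr_mat_Esym[OF G Z] inv_jac_other[OF a] by (intro sum.cong) auto
  then show ?thesis by simp
qed

text \<open>The derivatives in the directions of row and column \<open>e\<close> of the operator matrix produce,
  besides the transformed monomial, one term of lower order each.\<close>

lemma wd_fold_inv_map:
  fixes F :: "complex^'n^'n \<Rightarrow> complex"
  defines "K \<equiv> \<lambda>r Z. wd_fold (UNIV - {e}) (\<lambda>a. Esym a (r a)) F (inv_map e t Z)"
  assumes F: "H.smooth F" and Z: "Z \<in> siegel" and s: "s permutes UNIV"
  shows "wd_fold UNIV (\<lambda>a. Esym a (s a)) (\<lambda>Z. m Z * F (inv_map e t Z)) Z =
    m Z * wd_fold UNIV (\<lambda>a. congr_mat (inv_jac e t Z) (Esym a (s a))) F (inv_map e t Z) +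
    m Z * inv_ratio e t Z * (if s e = e then c * K s Z else - K (s \<circ> Transposition.transpose e (inv s e)) Z / 2)"
proof -
  let ?u = "\<lambda>a. Esym a (s a)" and ?f = "\<lambda>Z. m Z * F (inv_map e t Z)"
  note sm = smooth_mult_inv_map[OF m F]
  have inj: "s a = s b \<longleftrightarrow> a = b" for a b using permutes_inj[OF s] by (auto simp: inj_def)
  show ?thesis
  proof (cases "s e = e")
    case True
    \<comment> \<open>Only the (e, e) entry of the monomial feels the substitution; applied last, it
      produces the transformed monomial and, from the derivative of \<open>m\<close>, the term with
      c.\<close>
    let ?R = "UNIV - {e}"
    have ne: "a \<noteq> e \<and> s a \<noteq> e" if "a \<in> ?R" for a using that inj[of a e] True by auto
    have U: "UNIV = insert e ?R" by auto
    have ee: "Esym e e $ e $ e = 1" by (simp add: Esym_def)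
    have "wd_fold UNIV ?u ?f Z = wd (Esym e e) (wd_fold ?R ?u ?f) Z"
      by (subst U, subst wd_fold_insert) (auto simp: True wd_fold_smooth sm Z)
    also have "\<dots> = wd (Esym e e) (\<lambda>Z. m Z * wd_fold ?R ?u F (inv_map e t Z)) Z"
      by (intro wd_cong[OF wd_fold_smooth[OF _ sm]] Z wd_fold_inv_map_other[where x = "\<lambda>a. a" and y = s, OF F] ne)
        simp_all
    also have "\<dots> = c * inv_ratio e t Z * m Z * K s Z +
        m Z * wd (congr_mat (inv_jac e t Z) (Esym e e)) (wd_fold ?R ?u F) (inv_map e t Z)"
      unfolding K_def
      by (subst wd_mult_inv_map[OF m wd_fold_smooth[OF _ F] Z Esym_sym])
         (simp_all add: wd_m[OF Z Esym_sym] ee)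
    also have "wd (congr_mat (inv_jac e t Z) (Esym e e)) (wd_fold ?R ?u F) (inv_map e t Z) =
        wd_fold UNIV (\<lambda>a. congr_mat (inv_jac e t Z) (?u a)) F (inv_map e t Z)"
    proof -
      have "wd_fold ?R (\<lambda>a. congr_mat (inv_jac e t Z) (?u a)) F = wd_fold ?R ?u F"
        using ne by (intro wd_fold_cong congr_inv_jac_other) auto
      then show ?thesis
        by (subst U, subst wd_fold_insert) (auto simp: True wd_fold_smooth F congr_mat_sym maps Z)
    qed
    finally show ?thesis using True by (simp add: algebra_simps)
  next
    case False
    \<comment> \<open>The entries (a, e) and (e, b) are the only ones of the monomial in row or
      column e. The entry (a, e), applied first of the two, meets no derivative of \<open>m\<close>
      and yields the coefficients \<open>?q d\<close>; the entry (e, b) then differentiates these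
      coefficients.\<close>
    define a where "a = inv s e"
    define b where "b = s e"
    have sa: "s a = e" unfolding a_def using s by (simp add: permutes_inverses)
    have ae: "a \<noteq> e" using sa False by auto
    have ae0: "Esym a e $ e $ e = 0" using ae by (simp add: Esym_def)
    have be: "b \<noteq> e" using False by (simp add: b_def)
    let ?R = "UNIV - {e, a}"
    have U: "UNIV = insert e (insert a ?R)" and notin: "e \<notin> insert a ?R" "a \<notin> ?R" using ae by auto
    have ne: "x \<noteq> e \<and> s x \<noteq> e" if "x \<in> ?R" for x using that inj[of x a] sa by auto
    let ?G = "wd_fold ?R ?u F"
    have G: "H.smooth ?G" by (rule wd_fold_smooth[OF _ F]) simp
    let ?q = "\<lambda>d Z. m Z * inv_jac e t Z $ e $ d"
    let ?Gd = "\<lambda>d. wd (Esym a d) ?G"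
    have q: "H.smooth (?q d)" for d by (rule H.smooth_mult[OF m smooth_inv_jac])
    have Gd: "H.smooth (?Gd d)" for d by (rule wd_smooth[OF G Esym_sym])
    have first: "wd_fold (insert a ?R) ?u ?f Z = (\<Sum>d\<in>UNIV. ?q d Z * ?Gd d (inv_map e t Z))" if Z: "Z \<in> siegel" for Z
    proof -
      have "wd_fold (insert a ?R) ?u ?f Z = wd (Esym a e) (wd_fold ?R ?u ?f) Z"
        by (subst wd_fold_insert) (auto simp: sa wd_fold_smooth sm Z)
      also have "\<dots> = wd (Esym a e) (\<lambda>Z. m Z * ?G (inv_map e t Z)) Z"
        by (intro wd_cong[OF wd_fold_smooth[OF _ sm]] Z wd_fold_inv_map_other[where x = "\<lambda>a. a" and y = s, OF F] ne)
          simp_all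
      also have "\<dots> = m Z * wd (congr_mat (inv_jac e t Z) (Esym a e)) ?G (inv_map e t Z)"
        by (subst wd_mult_inv_map[OF m G Z Esym_sym])
          (simp_all add: wd_m[OF Z Esym_sym] ae0)
      finally show ?thesis
        unfolding wd_congr_inv_jac_row[OF ae G maps[OF Z]] by (simp add: sum_distrib_left mult.assoc)
    qed
    have "wd_fold UNIV ?u ?f Z = wd (Esym e b) (wd_fold (insert a ?R) ?u ?f) Z"
      by (subst U, subst wd_fold_insert) (use notin in \<open>auto simp: b_def wd_fold_smooth sm Z\<close>)
    also have "\<dots> = wd (Esym e b) (\<lambda>Z. \<Sum>d\<in>UNIV. ?q d Z * ?Gd d (inv_map e t Z)) Z"
      by (intro wd_cong[OF wd_fold_smooth[OF _ sm] first] Z) auto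
    also have "\<dots> = (\<Sum>d\<in>UNIV. wd (Esym e b) (\<lambda>Z. ?q d Z * ?Gd d (inv_map e t Z)) Z)"
      by (rule wd_sum[OF smooth_mult_inv_map[OF q Gd] Z Esym_sym])
    also have "\<dots> = (\<Sum>d\<in>UNIV. - (if d = b then inv_ratio e t Z / 2 * m Z else 0) * ?Gd d (inv_map e t Z) +
        ?q d Z * wd (congr_mat (inv_jac e t Z) (Esym e b)) (?Gd d) (inv_map e t Z))"
      by (simp only: wd_mult_inv_map[OF q Gd Z Esym_sym] wd_inv_jac_row[OF be Z])
    also have "\<dots> = - (inv_ratio e t Z / 2 * m Z) * ?Gd b (inv_map e t Z) +
        (\<Sum>d\<in>UNIV. ?q d Z * wd (congr_mat (inv_jac e t Z) (Esym e b)) (?Gd d) (inv_map e t Z))"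
      unfolding sum.distrib by (simp add: if_distrib if_distribR cong: if_cong)
    \<comment> \<open>The rest is the full monomial in the transformed directions, in which the
      Jacobian at the fixed point Z acts as a constant matrix.\<close>
    also have "(\<Sum>d\<in>UNIV. ?q d Z * wd (congr_mat (inv_jac e t Z) (Esym e b)) (?Gd d) (inv_map e t Z)) =
        m Z * wd_fold UNIV (\<lambda>a. congr_mat (inv_jac e t Z) (?u a)) F (inv_map e t Z)"
    proof -
      let ?C = "congr_mat (inv_jac e t Z)"
      have C: "?C (Esym x y) \<in> sym_mats" for x y by (rule congr_mat_sym[OF Esym_sym])
      have R: "wd_fold ?R (\<lambda>a. ?C (?u a)) F = ?G"
        using ne by (intro wd_fold_cong congr_inv_jac_other) auto
      have "wd_fold UNIV (\<lambda>a. ?C (?u a)) F (inv_map e t Z) =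
         wd (?C (Esym e b)) (wd_total (?C (Esym a e)) ?G) (inv_map e t Z)"
        by (subst U, subst wd_fold_insert, simp, use ae in simp, subst wd_fold_insert)
           (auto simp: b_def[symmetric] sa R wd_total_smooth C maps Z)
      also have "\<dots> = wd (?C (Esym e b)) (\<lambda>Z'. \<Sum>d\<in>UNIV. inv_jac e t Z $ e $ d * ?Gd d Z') (inv_map e t Z)"
        by (intro wd_cong wd_total_smooth C maps Z) (simp add: C G wd_congr_inv_jac_row[OF ae])
      also have "\<dots> = (\<Sum>d\<in>UNIV. inv_jac e t Z $ e $ d * wd (?C (Esym e b)) (?Gd d) (inv_map e t Z))"
        by (subst wd_sum) (auto intro!: H.smooth_mult Gd simp: maps Z C wd_cmult Gd)
      finally show ?thesis by (simp add: sum_distrib_left mult.assoc)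
    qed
    \<comment> \<open>In the lower order term the entries (e, b) and (a, e) have merged into (a, b).
      This is the minor monomial of s composed with the transposition of e and a, which fixes e and
      sends a to b.\<close>
    also have "?Gd b (inv_map e t Z) = K (s \<circ> Transposition.transpose e a) Z"
    proof -
      let ?r = "s \<circ> Transposition.transpose e a"
      have "UNIV - {e} = insert a ?R" using ae by auto
      moreover have "wd_fold ?R (\<lambda>x. Esym x (?r x)) F = ?G"
        by (intro wd_fold_cong) (auto simp: Transposition.transpose_def)
      moreover have "?r a = b" by (simp add: b_def)
      ultimately show ?thesis unfolding K_def using notin
        by (simp add: wd_fold_insert G maps Z)
    qed
    finally show ?thesis using False by (simp add: a_def algebra_simps)
  qed
qed

text \<open>A permutation s moving e is uniquely r \<circ> (e a) with r fixing e and a = s^-1(e)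
  \<noteq> e. The transposition reverses the sign, and for every r there are n - 1 choices of
  a.\<close>

lemma sum_lower_order_terms:
  fixes K :: "('n \<Rightarrow> 'n) \<Rightarrow> complex"
  shows "(\<Sum>s | s permutes UNIV \<and> s e \<noteq> e. of_int (sign s) * K (s \<circ> Transposition.transpose e (inv s e))) =
    - (of_nat (CARD('n) - 1) * (\<Sum>r | r permutes UNIV \<and> r e = e. of_int (sign r) * K r))"
proof -
  let ?A = "{s. s permutes (UNIV :: 'n set) \<and> s e \<noteq> e}" and ?B = "{r. r permutes (UNIV :: 'n set) \<and> r e = e}"
  let ?t = "Transposition.transpose e"
  have tp: "?t a permutes UNIV" for a by (rule permutes_swap_id) auto
  have "(\<Sum>s\<in>?A. of_int (sign s) * K (s \<circ> ?t (inv s e))) =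
     (\<Sum>(r, a)\<in>?B \<times> (UNIV - {e}). - (of_int (sign r) * K r))"
  proof (rule sum.reindex_bij_witness[where i = "\<lambda>(r, a). r \<circ> ?t a" and j = "\<lambda>s. (s \<circ> ?t (inv s e), inv s e)"])
    fix s assume "s \<in> ?A"
    then have s: "s permutes UNIV" "s e \<noteq> e" by auto
    have si: "s (inv s e) = e" using s by (simp add: permutes_inverses)
    show "(case (s \<circ> ?t (inv s e), inv s e) of (r, a) \<Rightarrow> r \<circ> ?t a) = s" by (simp add: comp_assoc)
    show "(s \<circ> ?t (inv s e), inv s e) \<in> ?B \<times> (UNIV - {e})"
      using s si permutes_compose[OF tp s(1)] by auto
    have "inv s e \<noteq> e" using si s(2) by metis
    then have "sign (s \<circ> ?t (inv s e)) = - sign s"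
      by (simp add: sign_compose permutation_of_permutes[OF s(1)] permutation_swap_id sign_swap_id)
    then show "(case (s \<circ> ?t (inv s e), inv s e) of (r, a) \<Rightarrow> - (of_int (sign r) * K r)) =
        of_int (sign s) * K (s \<circ> ?t (inv s e))" by simp
  next
    fix x assume "x \<in> ?B \<times> (UNIV - {e})"
    then obtain r a where x: "x = (r, a)" and r: "r permutes UNIV" "r e = e" and a: "a \<noteq> e" by auto
    have perm: "(r \<circ> ?t a) permutes UNIV" by (rule permutes_compose[OF tp r(1)])
    have "(r \<circ> ?t a) a = e" using r by simp
    then have i: "inv (r \<circ> ?t a) e = a" using permutes_inv_eq[OF perm] by blast
    have "(let s = case x of (r, a) \<Rightarrow> r \<circ> ?t a in (s \<circ> ?t (inv s e), inv s e)) = x"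
      unfolding x Let_def prod.case i by (simp add: comp_assoc)
    then show "((case x of (r, a) \<Rightarrow> r \<circ> ?t a) \<circ> ?t (inv (case x of (r, a) \<Rightarrow> r \<circ> ?t a) e),
        inv (case x of (r, a) \<Rightarrow> r \<circ> ?t a) e) = x" by (simp only: Let_def)
    have "r a \<noteq> e" using r a permutes_inj[OF r(1)] by (metis injD)
    then show "(case x of (r, a) \<Rightarrow> r \<circ> ?t a) \<in> ?A" using perm x by simp
  qed
  also have "\<dots> = (\<Sum>r\<in>?B. \<Sum>a\<in>UNIV - {e}. - (of_int (sign r) * K r))"
    by (rule sum.cartesian_product[symmetric])
  also have "\<dots> = - (of_nat (CARD('n) - 1) * (\<Sum>r\<in>?B. of_int (sign r) * K r))"
    by (simp add: sum_negf sum_distrib_left card_Diff_singleton)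
  finally show ?thesis .
qed

lemma wd_det_inv_map:
  assumes F: "H.smooth F" and Z: "Z \<in> siegel" and c: "c = - (of_nat (CARD('n) - 1) / 2)"
  shows "wd_det Esym (\<lambda>Z. m Z * F (inv_map e t Z)) Z =
    m Z * inverse (inv_denom e t Z) ^ 2 * wd_det Esym F (inv_map e t Z)"
proof -
  let ?P = "{s. s permutes (UNIV :: 'n set)}"
  define K where "K r = wd_fold (UNIV - {e}) (\<lambda>a. Esym a (r a)) F (inv_map e t Z)" for r
  define L where "L s = (if s e = e then c * K s else - K (s \<circ> Transposition.transpose e (inv s e)) / 2)" for s
  have "(\<Sum>s\<in>?P. of_int (sign s) * L s) =
      (\<Sum>s\<in>{s\<in>?P. s e = e}. of_int (sign s) * L s) + (\<Sum>s\<in>{s\<in>?P. \<not> s e = e}. of_int (sign s) * L s)"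
    by (subst sum.union_disjoint[symmetric]) (auto intro: sum.cong)
  also have "(\<Sum>s\<in>{s\<in>?P. s e = e}. of_int (sign s) * L s) =
      c * (\<Sum>r | r permutes UNIV \<and> r e = e. of_int (sign r) * K r)"
    by (simp add: L_def sum_distrib_left mult.left_commute)
  also have "(\<Sum>s\<in>{s\<in>?P. \<not> s e = e}. of_int (sign s) * L s) = - (1 / 2) *
      (\<Sum>s | s permutes UNIV \<and> s e \<noteq> e. of_int (sign s) * K (s \<circ> Transposition.transpose e (inv s e)))"
    by (simp add: L_def sum_distrib_left)
  \<comment> \<open>The coefficient of each signed minor monomial is c + (n - 1)/2, which is zero
    for the present c.\<close>
  finally have L0: "(\<Sum>s\<in>?P. of_int (sign s) * L s) = 0"
    unfolding sum_lower_order_terms c by (simp add: field_simps)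
  have "wd_det Esym (\<lambda>Z. m Z * F (inv_map e t Z)) Z =
      (\<Sum>s\<in>?P. m Z * (of_int (sign s) * wd_fold UNIV (\<lambda>a. congr_mat (inv_jac e t Z) (Esym a (s a))) F (inv_map e t Z)) +
        m Z * inv_ratio e t Z * (of_int (sign s) * L s))"
    unfolding wd_det_def
    by (intro sum.cong refl) (simp add: wd_fold_inv_map[OF F Z] L_def K_def algebra_simps)
  also have "\<dots> = m Z * wd_det (\<lambda>a b. congr_mat (inv_jac e t Z) (Esym a b)) F (inv_map e t Z) +
      m Z * inv_ratio e t Z * (\<Sum>s\<in>?P. of_int (sign s) * L s)"
    by (simp only: sum.distrib sum_distrib_left[symmetric] wd_det_def)
  finally show ?thesis
    unfolding L0 wd_det_congr_mat[OF F maps[OF Z]] det_inv_jac[OF Z] by simp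
qed

end

subsection \<open>Decomposition of symplectic maps\<close>

text \<open>The factor j^-k contributes -k and |j|^(2s) contributes s = k + 1 - \<kappa>, because
  the conjugate of j is antiholomorphic. The sum 1 - \<kappa> = - (n - 1)/2 is the exponent required
  by \<open>wd_det_inv_map\<close>.\<close>

lemma wd_maass_factor:
  fixes e :: "'n::finite"
  assumes Z: "Z \<in> siegel" and U: "U \<in> sym_mats"
  shows "wd U (maass_factor k (inv_denom e t)) Z =
    - (of_nat (CARD('n) - 1) / 2) * (inv_ratio e t Z) * U $ e $ e * maass_factor k (inv_denom e t) Z"
proof -
  let ?j = "inv_denom e t" and ?s = "of_int k + 1 - kappa TYPE('n)"
  let ?p = "\<lambda>Z. ?j Z powi (- k)" and ?q = "\<lambda>Z. complex_of_real ((cmod (?j Z) ^ 2) powr ?s)"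
  note nz = inv_denom_nz[OF Z, of e t]
  have iU: "cscale \<i> U $ e $ e = \<i> * U $ e $ e" by simp
  have p: "(?p has_derivative (\<lambda>V. of_real t * V $ e $ e * (of_int (- k) * ?j Z powi (- k - 1)))) (at Z within siegel)"
    by (rule has_derivative_power_int[OF nz inv_denom_has_derivative])
  have wp: "wd U ?p Z = - of_int k * (of_real t * inverse (?j Z)) * U $ e $ e * ?p Z"
    unfolding wd_eq[OF p Z U] iU using nz by (simp add: power_int_diff field_simps)
  have sq: "cmod z ^ 2 = Re z ^ 2 + Im z ^ 2" for z by (rule cmod_power2)
  have "((\<lambda>Z. cmod (?j Z) ^ 2) has_derivative (\<lambda>V. 2 * Re (cnj (?j Z) * (of_real t * V $ e $ e)))) (at Z within siegel)"
    unfolding sq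
    by (rule has_derivative_eq_rhs, (rule derivative_intros has_derivative_Re has_derivative_Im inv_denom_has_derivative)+)
       (simp add: fun_eq_iff algebra_simps)
  then have "((\<lambda>Z. (cmod (?j Z) ^ 2) powr ?s) has_derivative
      (\<lambda>V. (2 * Re (cnj (?j Z) * (of_real t * V $ e $ e))) * (?s * (cmod (?j Z) ^ 2) powr (?s - 1)))) (at Z within siegel)"
    using nz by (rule_tac has_derivative_eq_rhs, rule_tac has_derivative_compose[OF _
          has_real_derivative_powr[unfolded has_field_derivative_def]]) (auto simp: mult_ac)
  from has_derivative_of_real[OF this]
  have q: "(?q has_derivative (\<lambda>V. of_real ((2 * Re (cnj (?j Z) * (of_real t * V $ e $ e))) *
      (?s * (cmod (?j Z) ^ 2) powr (?s - 1))))) (at Z within siegel)" .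
  \<comment> \<open>The holomorphic derivative of 2 Re w, for w complex linear in the direction, is
    w.\<close>
  have wirt: "(of_real (2 * Re w * x) - \<i> * of_real (2 * Re (\<i> * w) * x)) / 2 = w * of_real x" for w x
    by (simp add: complex_eq_iff)
  have rot: "cnj (?j Z) * (of_real t * (\<i> * U $ e $ e)) = \<i> * (cnj (?j Z) * (of_real t * U $ e $ e))"
    by (simp add: mult_ac)
  have "wd U ?q Z = (cnj (?j Z) * (of_real t * U $ e $ e)) * of_real (?s * (cmod (?j Z) ^ 2) powr (?s - 1))"
    unfolding wd_eq[OF q Z U] iU rot by (rule wirt)
  also have "of_real (?s * (cmod (?j Z) ^ 2) powr (?s - 1)) = of_real ?s * ?q Z * inverse (?j Z * cnj (?j Z))"
  proof -
    have pow: "x powr (a - 1) = x powr a * inverse x" if "x > 0" for x a :: real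
      using that by (simp add: powr_diff divide_inverse)
    show ?thesis
      unfolding complex_norm_square[symmetric]
      by (subst pow) (use nz in simp, simp only: of_real_mult of_real_inverse mult_ac)
  qed
  also have "(cnj (?j Z) * (of_real t * U $ e $ e)) * (of_real ?s * ?q Z * inverse (?j Z * cnj (?j Z))) =
      of_real ?s * (of_real t * inverse (?j Z)) * U $ e $ e * ?q Z"
    using nz by (simp add: field_simps)
  finally have wq: "wd U ?q Z = of_real ?s * (of_real t * inverse (?j Z)) * U $ e $ e * ?q Z" .
  have sp: "H.smooth ?p" by (rule H.smooth_powi[OF smooth_inv_denom inv_denom_nz])
  have sq': "H.smooth ?q"
  proof (rule H.smooth_powr)
    show "H.smooth (\<lambda>Z. of_real (cmod (?j Z) ^ 2))"
      unfolding complex_norm_square by (intro H.smooth_intros smooth_inv_denom)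
  qed (use inv_denom_nz in auto)
  have m: "maass_factor k ?j = (\<lambda>Z. ?p Z * ?q Z)"
    by (simp add: maass_factor_def fun_eq_iff)
  have c: "- of_int k + of_real ?s = - (of_nat (CARD('n) - 1) / 2 :: complex)"
    by (simp add: kappa_def of_nat_diff Suc_leI field_simps)
  have "wd U (maass_factor k ?j) Z = (- of_int k + of_real ?s) * (of_real t * inverse (?j Z)) * U $ e $ e * maass_factor k ?j Z"
    unfolding m wd_mult[OF sp sq' Z U] wp wq by (simp add: algebra_simps)
  then show ?thesis unfolding c .
qed

section \<open>Hermitian forms and the maps Z \<mapsto> Z (1 + S Z)^-1\<close>

abbreviation cnj_mat :: "complex^'n^'m \<Rightarrow> complex^'n^'m" where
  "cnj_mat \<equiv> map_matrix cnj"

lemma det_cnj_mat: "det (cnj_mat A) = cnj (det A)"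
  by (simp add: det_def)

lemma cnj_mat_mult: "cnj_mat (A ** B) = cnj_mat A ** cnj_mat B"
  by (simp add: vec_eq_iff matrix_mult_nth)

definition herm_form :: "complex^'n^'n \<Rightarrow> complex^'n \<Rightarrow> complex" where
  "herm_form A u = (\<Sum>i\<in>UNIV. cnj (u $ i) * (A *v u) $ i)"

lemma sum_cnj_transpose:
  "(\<Sum>i\<in>UNIV. cnj (u $ i) * (transpose (cnj_mat N) *v w) $ i) = (\<Sum>k\<in>UNIV. cnj ((N *v u) $ k) * w $ k)"
proof -
  have "(\<Sum>i\<in>UNIV. cnj (u $ i) * (transpose (cnj_mat N) *v w) $ i) =
      (\<Sum>i\<in>UNIV. \<Sum>k\<in>UNIV. cnj (u $ i) * (cnj (N $ k $ i) * w $ k))"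
    unfolding matrix_vector_mult_def transpose_def by (simp add: sum_distrib_left)
  also have "\<dots> = (\<Sum>k\<in>UNIV. \<Sum>i\<in>UNIV. cnj (u $ i) * (cnj (N $ k $ i) * w $ k))"
    by (rule sum.swap)
  also have "\<dots> = (\<Sum>k\<in>UNIV. cnj ((N *v u) $ k) * w $ k)"
    by (simp add: matrix_vector_mult_def sum_distrib_left mult_ac)
  finally show ?thesis .
qed

lemma herm_form_congr: "herm_form (transpose (cnj_mat N) ** A ** N) u = herm_form A (N *v u)"
  unfolding herm_form_def matrix_mul_assoc[symmetric] matrix_vector_mul_assoc[symmetric]
  by (rule sum_cnj_transpose)

lemma Re_herm_form:
  "Re (herm_form (cmat_of_real Y) u) =
    (\<chi> i. Re (u $ i)) \<bullet> (Y *v (\<chi> i. Re (u $ i))) + (\<chi> i. Im (u $ i)) \<bullet> (Y *v (\<chi> i. Im (u $ i)))"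
  by (simp add: herm_form_def inner_vec_def matrix_vector_mult_def sum.distrib[symmetric])

lemma herm_form_pos:
  assumes Y: "positive_definite Y" and u: "u \<noteq> 0"
  shows "Re (herm_form (cmat_of_real Y) u) > 0"
proof -
  let ?a = "(\<chi> i. Re (u $ i))" and ?b = "(\<chi> i. Im (u $ i))"
  have nn: "x \<bullet> (Y *v x) \<ge> 0" for x using Y unfolding positive_definite_def by (cases "x = 0") force+
  have "?a \<noteq> 0 \<or> ?b \<noteq> 0" using u by (auto simp: vec_eq_iff complex_eq_iff)
  then have "?a \<bullet> (Y *v ?a) > 0 \<or> ?b \<bullet> (Y *v ?b) > 0" using Y unfolding positive_definite_def by blast
  then show ?thesis unfolding Re_herm_form using nn[of ?a] nn[of ?b] by linarith
qed

abbreviation low_denom :: "real^'n^'n \<Rightarrow> complex^'n::finite^'n \<Rightarrow> complex^'n^'n" where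
  "low_denom S Z \<equiv> mat 1 + cmat_of_real S ** Z"

abbreviation low_act :: "real^'n^'n \<Rightarrow> complex^'n::finite^'n \<Rightarrow> complex^'n^'n" where
  "low_act S Z \<equiv> Z ** matrix_inv (low_denom S Z)"

context
  fixes S :: "real^'n::finite^'n" and Z :: "complex^'n^'n"
  assumes S: "symmetric_mat S" and Z: "Z \<in> siegel"
begin

lemma Im_mat_conv: "cmat_of_real (Im_mat A) = map_matrix (\<lambda>z. z / (2 * \<i>)) (A - cnj_mat A)"
  by (simp add: vec_eq_iff complex_eq_iff)

text \<open>The terms with S cancel since the conjugate transpose of N = 1 + S Z is 1 + conj(Z) S.
  Up to the factor 2 i the right side is Im Z, which gives both the invertibility of N and the
  transformation law of the imaginary part.\<close>

lemma low_denom_identity: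
  "transpose (cnj_mat (low_denom S Z)) ** Z - cnj_mat Z ** low_denom S Z = Z - cnj_mat Z"
proof -
  have "transpose (cmat_of_real S) = cmat_of_real S" "transpose (cnj_mat Z) = cnj_mat Z"
    using S siegel_sym[OF Z] by (simp_all add: symmetric_mat_def sym_mats_transpose transpose_map_matrix)
  moreover have "cnj_mat (low_denom S Z) = mat 1 + cmat_of_real S ** cnj_mat Z"
    by (simp add: vec_eq_iff matrix_mult_nth mat_def)
  ultimately have "transpose (cnj_mat (low_denom S Z)) = mat 1 + cnj_mat Z ** cmat_of_real S"
    by (simp add: transpose_simps)
  then show ?thesis by (simp add: matrix_distribs matrix_mul_assoc)
qed

lemma herm_form_Im:
  "herm_form (cmat_of_real (Im_mat A)) u = herm_form (A - cnj_mat A) u / (2 * \<i>)"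
  unfolding Im_mat_conv
  by (simp add: herm_form_def matrix_vector_mult_def sum_divide_distrib sum_distrib_left sum_negf mult_ac)

text \<open>At a kernel vector u of N the Hermitian form of the left side of
  \<open>low_denom_identity\<close> vanishes, hence so does that of Im Z, contrary to positive
  definiteness.\<close>

lemma det_low_denom: "det (low_denom S Z) \<noteq> 0"
proof (rule det_nz_of_ker, rule ccontr)
  fix u assume u: "low_denom S Z *v u = 0" "u \<noteq> 0"
  have 1: "(cnj_mat Z ** low_denom S Z) *v u = 0"
    using u(1) by (simp only: matrix_vector_mul_assoc[symmetric] matrix_vector_mult_0_right)
  have 2: "(\<Sum>i\<in>UNIV. cnj (u $ i) * ((transpose (cnj_mat N) ** A) *v u) $ i) =
     (\<Sum>k\<in>UNIV. cnj ((N *v u) $ k) * (A *v u) $ k)" for N A :: "complex^'n^'n"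
    unfolding matrix_vector_mul_assoc[symmetric] by (rule sum_cnj_transpose)
  have "herm_form (Z - cnj_mat Z) u = 0"
    unfolding low_denom_identity[symmetric] herm_form_def
    by (simp add: matrix_vector_mult_diff_rdistrib 1 right_diff_distrib sum_subtractf 2 u(1))
  then show False
    using herm_form_pos[of "Im_mat Z" u] Z u(2) by (simp add: siegel_def herm_form_Im)
qed

text \<open>The identity N^t Z = Z N is multiplied by the inverse of N^t on the left and that of N
  on the right.\<close>

lemma low_act_sym: "transpose (low_act S Z) = low_act S Z"
proof -
  let ?N = "low_denom S Z"
  have "transpose ?N ** Z = Z ** ?N"
    using S siegel_sym[OF Z]
    by (simp add: transpose_simps matrix_distribs matrix_mul_assoc symmetric_mat_def sym_mats_transpose
        transpose_map_matrix)
  then have "matrix_inv (transpose ?N) ** (transpose ?N ** Z) ** matrix_inv ?N =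
      matrix_inv (transpose ?N) ** (Z ** ?N) ** matrix_inv ?N" by simp
  also have "matrix_inv (transpose ?N) ** (transpose ?N ** Z) = Z"
    by (simp add: matrix_mul_assoc matrix_inv_left det_low_denom)
  also have "matrix_inv (transpose ?N) ** (Z ** ?N) ** matrix_inv ?N = matrix_inv (transpose ?N) ** Z"
    by (simp add: matrix_mul_assoc[symmetric] matrix_inv_right det_low_denom)
  finally show ?thesis
    using siegel_sym[OF Z]
    by (simp add: matrix_inv_transpose[OF det_low_denom] matrix_transpose_mul sym_mats_transpose)
qed

lemma Im_low_act:
  "transpose (cnj_mat (low_denom S Z)) ** cmat_of_real (Im_mat (low_act S Z)) ** low_denom S Z = cmat_of_real (Im_mat Z)"
proof -
  let ?N = "low_denom S Z" and ?Z' = "low_act S Z"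
  have 1: "?Z' ** ?N = Z"
    by (simp add: matrix_mul_assoc[symmetric] matrix_inv_left det_low_denom)
  have "transpose (cnj_mat ?N) ** cnj_mat ?Z' = transpose (cnj_mat ?Z' ** cnj_mat ?N)"
    using low_act_sym by (simp add: transpose_simps transpose_map_matrix)
  also have "\<dots> = cnj_mat Z"
    unfolding cnj_mat_mult[symmetric] 1 using siegel_sym[OF Z] by (simp add: transpose_map_matrix sym_mats_transpose)
  finally have 2: "transpose (cnj_mat ?N) ** cnj_mat ?Z' = cnj_mat Z" .
  have "transpose (cnj_mat ?N) ** (?Z' - cnj_mat ?Z') ** ?N = transpose (cnj_mat ?N) ** (?Z' ** ?N) - (transpose (cnj_mat ?N) ** cnj_mat ?Z') ** ?N"
    by (simp only: matrix_diff_ldistrib matrix_diff_rdistrib matrix_mul_assoc)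
  also have "\<dots> = Z - cnj_mat Z" unfolding 1 2 by (rule low_denom_identity)
  finally have 3: "transpose (cnj_mat ?N) ** (?Z' - cnj_mat ?Z') ** ?N = Z - cnj_mat Z" .
  have scale: "A ** map_matrix (\<lambda>z. z / (2 * \<i>)) X ** B = map_matrix (\<lambda>z. z / (2 * \<i>)) (A ** X ** B)"
    for A X B :: "complex^'n^'n"
    by (simp add: vec_eq_iff matrix_mult_nth sum_divide_distrib sum_distrib_left sum_distrib_right sum_negf mult_ac)
  show ?thesis unfolding Im_mat_conv scale 3 ..
qed

lemma det_Im_low_act: "det (Im_mat Z) = cmod (det (low_denom S Z)) ^ 2 * det (Im_mat (low_act S Z))"
proof -
  have "complex_of_real (det (Im_mat Z)) = of_real (cmod (det (low_denom S Z)) ^ 2 * det (Im_mat (low_act S Z)))"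
    unfolding of_real_mult complex_norm_square det_cmat_of_real[symmetric] Im_low_act[symmetric]
    by (simp add: det_mul det_cnj_mat mult_ac)
  then show ?thesis using of_real_eq_iff by blast
qed

lemma low_act_siegel: "low_act S Z \<in> siegel"
  unfolding siegel_def
proof (intro CollectI conjI)
  let ?N = "low_denom S Z"
  show "symmetric_mat (low_act S Z)" using low_act_sym by (simp add: symmetric_mat_def)
  then have sym: "symmetric_mat (Im_mat (low_act S Z))" by (simp add: symmetric_mat_iff)
  show "positive_definite (Im_mat (low_act S Z))"
    unfolding positive_definite_def
  proof (intro conjI allI impI sym)
    fix x :: "real^'n" assume x: "x \<noteq> 0"
    \<comment> \<open>Since N u = x, the form of the new imaginary part at x is the form of Im Z at
      u.\<close>
    define u where "u = matrix_inv ?N *v (\<chi> i. complex_of_real (x $ i))"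
    have Nu: "?N *v u = (\<chi> i. of_real (x $ i))"
      unfolding u_def by (simp add: matrix_vector_mul_assoc matrix_inv_right det_low_denom)
    have "u \<noteq> 0"
    proof
      assume "u = 0"
      then have "(\<chi> i. complex_of_real (x $ i)) = 0" using Nu by simp
      then show False using x by (simp add: vec_eq_iff)
    qed
    then have "0 < Re (herm_form (cmat_of_real (Im_mat Z)) u)"
      using Z by (intro herm_form_pos) (simp_all add: siegel_def)
    also have "\<dots> = Re (herm_form (cmat_of_real (Im_mat (low_act S Z))) (?N *v u))"
      unfolding Im_low_act[symmetric] herm_form_congr ..
    also have "\<dots> = x \<bullet> (Im_mat (low_act S Z) *v x)"
      unfolding Nu Re_herm_form by (simp add: zero_vec_def[symmetric])
    finally show "0 < x \<bullet> (Im_mat (low_act S Z) *v x)" .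
  qed
qed

end

section \<open>Reduction of a symmetric S to rank one matrices\<close>

definition outer :: "real^'n \<Rightarrow> real^'n^'n" where
  "outer v = (\<chi> i j. v $ i * v $ j)"

lemma symmetric_mat_outer: "symmetric_mat (s *\<^sub>R outer v)"
  by (simp add: symmetric_mat_iff outer_def mult_ac)

text \<open>\<open>inv_jac\<close> is checked to be the inverse of 1 + S Z, which ties the matrix
  form of the substitution to the entrywise form in which it was differentiated.\<close>

lemma low_act_axis:
  assumes Z: "Z \<in> siegel"
  shows "low_act (t *\<^sub>R outer (axis e 1)) Z = inv_map e t Z"
    and "det (low_denom (t *\<^sub>R outer (axis e 1)) Z) = inv_denom e t Z"
proof -
  let ?N = "low_denom (t *\<^sub>R outer (axis e 1)) Z"
  have sym: "Z $ i $ j = Z $ j $ i" for i j using siegel_sym[OF Z] by (simp add: sym_mats_iff)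
  have mult: "(U ** inv_jac e t Z) $ c $ b = U $ c $ b - inv_ratio e t Z * U $ c $ e * Z $ b $ e"
    for U :: "complex^'a^'a" and c b by (rule mult_inv_jac)
  have N: "?N $ a $ b = (if a = b then 1 else 0) + (if a = e then of_real t * Z $ b $ e else 0)" for a b
  proof -
    have "(cmat_of_real (t *\<^sub>R outer (axis e 1)) ** Z) $ a $ b =
        (\<Sum>k\<in>UNIV. if k = e then (if a = e then of_real t * Z $ b $ e else 0) else 0)"
      unfolding matrix_mult_nth by (intro sum.cong refl) (auto simp: outer_def axis_def sym[of b e])
    then show ?thesis by (simp add: mat_def)
  qed
  have inv: "?N ** inv_jac e t Z = mat 1"
    unfolding vec_eq_iff mult N using inv_denom_nz[OF Z, of e t]
    by (auto simp: mat_def inv_denom_def field_simps)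
  show "low_act (t *\<^sub>R outer (axis e 1)) Z = inv_map e t Z"
    unfolding matrix_inv_eqI[OF inv] vec_eq_iff mult by (simp add: inv_map_def mult_ac)
  show "det ?N = inv_denom e t Z"
    using arg_cong[OF inv, of det] det_inv_jac[OF Z, of e t] inv_denom_nz[OF Z, of e t]
    by (simp add: det_mul field_simps)
qed

abbreviation low_equivariant :: "real^'n::finite^'n \<Rightarrow> bool" where
  "low_equivariant S \<equiv> equivariant (low_act S) (\<lambda>Z. det (low_denom S Z))"

lemma low_equivariant_axis: "low_equivariant (t *\<^sub>R outer (axis e 1))"
proof -
  have maps: "inv_map e t Z \<in> siegel" if "Z \<in> siegel" for Z
    using low_act_siegel[OF symmetric_mat_outer that] low_act_axis(1)[OF that] by metis
  have "equivariant (inv_map e t) (inv_denom e t)"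
  proof (rule equivariantI[OF maps inv_denom_nz smooth_inv_map smooth_inv_denom])
    show "det (Im_mat Z) = cmod (inv_denom e t Z) ^ 2 * det (Im_mat (inv_map e t Z))" if "Z \<in> siegel" for Z
      using det_Im_low_act[OF symmetric_mat_outer that, of t "axis e 1"] low_act_axis[OF that, of t e] by simp
    fix k :: int and F :: "complex^'a^'a \<Rightarrow> complex" and Z :: "complex^'a^'a" assume F: "H.smooth F" and Z: "Z \<in> siegel"
    show "wd_det Esym (\<lambda>Z. maass_factor k (inv_denom e t) Z * F (inv_map e t Z)) Z =
      maass_factor k (inv_denom e t) Z * inv_denom e t Z powi (-2) * wd_det Esym F (inv_map e t Z)"
      using wd_det_inv_map[OF maps smooth_maass_factor[OF smooth_inv_denom inv_denom_nz] wd_maass_factor F Z refl]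
      by (simp add: power_int_minus power_inverse)
  qed
  then show ?thesis by (rule equivariant_cong) (simp_all add: low_act_axis)
qed

lemma low_equivariant_zero: "low_equivariant 0"
proof -
  have zero: "cmat_of_real 0 = 0" by (simp add: vec_eq_iff)
  have "equivariant (\<lambda>Z. Z) (\<lambda>_. 1)"
    using equivariant_affine[of "mat 1" 0] by (simp add: map_matrix_mat1 symmetric_mat_iff zero)
  then show ?thesis
    by (rule equivariant_cong) (simp_all add: zero matrix_inv_eqI[of "mat 1" "mat 1"])
qed

text \<open>With Z' = Z (1 + S' Z)^-1 the cocycle identity 1 + (S + S') Z = (1 + S Z') (1 + S' Z)
  expresses that S \<mapsto> (1 0; S 1) is a homomorphism.\<close>

lemma low_equivariant_add:
  assumes 1: "low_equivariant S" and 2: "low_equivariant S'"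
  shows "low_equivariant (S + S')"
proof (rule equivariant_cong[OF equivariant_compose[OF 1 2]])
  fix Z :: "complex^'a^'a" assume Z: "Z \<in> siegel"
  let ?N' = "low_denom S' Z" and ?Z' = "low_act S' Z"
  have nz': "det ?N' \<noteq> 0" and Z': "?Z' \<in> siegel" using 2 Z unfolding equivariant_def by auto
  have nz: "det (low_denom S ?Z') \<noteq> 0" using 1 Z' unfolding equivariant_def by auto
  have "?Z' ** ?N' = Z" by (simp add: matrix_mul_assoc[symmetric] matrix_inv_left nz')
  then have "cmat_of_real S ** ?Z' ** ?N' = cmat_of_real S ** Z"
    by (simp only: matrix_mul_assoc[symmetric])
  then have prod: "low_denom (S + S') Z = low_denom S ?Z' ** ?N'"
    unfolding matrix_add_rdistrib[of "mat 1"] by (simp add: map_matrix_add matrix_add_rdistrib add_ac)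
  show "det (low_denom (S + S') Z) = det (low_denom S ?Z') * det ?N'"
    unfolding prod by (rule det_mul)
  show "low_act (S + S') Z = low_act S ?Z'"
    unfolding prod matrix_inv_matrix_mult[OF nz nz'] by (simp only: matrix_mul_assoc)
qed

lemma low_equivariant_sum:
  "finite I \<Longrightarrow> (\<And>i. i \<in> I \<Longrightarrow> low_equivariant (f i)) \<Longrightarrow> low_equivariant (\<Sum>i\<in>I. f i)"
  by (induction I rule: finite_induct) (simp_all add: low_equivariant_zero low_equivariant_add)

text \<open>Conjugating the map of S by Z \<mapsto> g Z g^t gives the map of g^t S g, and the affine
  maps on both sides are already known to be equivariant.\<close>

lemma low_equivariant_congr:
  assumes S: "low_equivariant S" and g: "det g \<noteq> 0"
  shows "low_equivariant (transpose g ** S ** g)"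
proof -
  let ?g = "cmat_of_real g" and ?h = "matrix_inv g"
  have zero: "cmat_of_real 0 = 0" "symmetric_mat (0 :: real^'a^'a)" by (simp_all add: vec_eq_iff symmetric_mat_iff)
  have h: "det ?h \<noteq> 0" using g by (simp add: det_matrix_inv)
  have inv: "cmat_of_real ?h = matrix_inv ?g" using matrix_inv_cmat_of_real[OF g] by simp
  have gc: "det ?g \<noteq> 0" using g by (simp add: det_cmat_of_real)
  note A = equivariant_affine[OF g zero(2), unfolded zero add_0_right]
  note B = equivariant_affine[OF h zero(2), unfolded zero add_0_right]
  show ?thesis
  proof (rule equivariant_cong[OF equivariant_compose[OF B equivariant_compose[OF S A]]])
    fix Z :: "complex^'a^'a" assume Z: "Z \<in> siegel"
    let ?Z' = "?g ** Z ** transpose ?g"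
    let ?N = "low_denom (transpose g ** S ** g) Z"
    have nz: "det (low_denom S ?Z') \<noteq> 0"
      using A S Z unfolding equivariant_def by auto
    have "transpose ?g ** low_denom S ?Z' = ?N ** transpose ?g"
      by (simp add: matrix_distribs map_matrix_of_real_mult transpose_map_matrix matrix_mul_assoc)
    then have "matrix_inv (transpose ?g) ** (transpose ?g ** low_denom S ?Z') =
        matrix_inv (transpose ?g) ** (?N ** transpose ?g)" by simp
    then have N': "low_denom S ?Z' = matrix_inv (transpose ?g) ** ?N ** transpose ?g"
      using gc by (simp add: matrix_mul_assoc matrix_inv_left)
    then have det: "det (low_denom S ?Z') = det ?N"
      using gc by (simp add: det_mul det_matrix_inv)
    show "det ?N = inverse (of_real (det ?h)) * (det (low_denom S ?Z') * inverse (of_real (det g)))"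
      unfolding det using g by (simp add: det_matrix_inv)
    have "matrix_inv (low_denom S ?Z') = matrix_inv (transpose ?g) ** matrix_inv ?N ** transpose ?g"
    proof (rule matrix_inv_eqI)
      have "low_denom S ?Z' ** (matrix_inv (transpose ?g) ** matrix_inv ?N ** transpose ?g) =
        matrix_inv (transpose ?g) ** (?N ** (transpose ?g ** matrix_inv (transpose ?g)) ** matrix_inv ?N) ** transpose ?g"
        unfolding N' by (simp only: matrix_mul_assoc)
      then show "low_denom S ?Z' ** (matrix_inv (transpose ?g) ** matrix_inv ?N ** transpose ?g) = mat 1"
        using gc nz det by (simp add: matrix_inv_right matrix_inv_left)
    qed
    then have "low_act S ?Z' = ?g ** Z ** (transpose ?g ** matrix_inv (transpose ?g)) ** matrix_inv ?N ** transpose ?g"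
      by (simp only: matrix_mul_assoc)
    then have "low_act S ?Z' = ?g ** low_act (transpose g ** S ** g) Z ** transpose ?g"
      using gc by (simp add: matrix_inv_right matrix_mul_assoc)
    then have "cmat_of_real ?h ** low_act S ?Z' ** transpose (cmat_of_real ?h) =
       (matrix_inv ?g ** ?g) ** low_act (transpose g ** S ** g) Z ** (transpose ?g ** matrix_inv (transpose ?g))"
      unfolding inv matrix_inv_transpose[OF gc] by (simp only: matrix_mul_assoc)
    then show "low_act (transpose g ** S ** g) Z = cmat_of_real ?h ** low_act S ?Z' ** transpose (cmat_of_real ?h)"
      using gc by (simp add: matrix_inv_right matrix_inv_left)
  qed
qed

lemma outer_congr: "transpose g ** (t *\<^sub>R outer v) ** g = t *\<^sub>R outer (transpose g *v v)"
proof -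
  have "(transpose g ** (t *\<^sub>R outer v) ** g) $ i $ j = t * ((\<Sum>k\<in>UNIV. g $ k $ i * v $ k) * (\<Sum>k\<in>UNIV. g $ k $ j * v $ k))" for i j
    unfolding sum_product sum_distrib_left matrix_mult_nth transpose_def outer_def sum_distrib_right
    by (simp add: mult_ac)
  then show ?thesis by (simp add: vec_eq_iff outer_def matrix_vector_mult_def transpose_def vector_matrix_mult_def)
qed

text \<open>An orthogonal Q carries a coordinate vector to v / |v|, and congruence by Q^t turns the
  axis case into this one.\<close>

lemma low_equivariant_outer: "low_equivariant (t *\<^sub>R outer v)"
proof (cases "v = 0")
  case True
  then have zero: "t *\<^sub>R outer v = 0" by (simp add: outer_def vec_eq_iff)
  show ?thesis unfolding zero by (rule low_equivariant_zero)
next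
  case False
  fix e :: 'a
  have "norm (axis e 1 :: real^'a) = norm (v /\<^sub>R norm v)" using False by simp
  then obtain f where f: "orthogonal_transformation f" "f (axis e 1 :: real^'a) = v /\<^sub>R norm v"
    using orthogonal_transformation_exists by blast
  define Q where "Q = matrix f"
  have Q: "orthogonal_matrix Q" using f(1) orthogonal_transformation_matrix unfolding Q_def by blast
  have lin: "Vector_Spaces.linear (*s) (*s) f"
    using orthogonal_transformation_linear[OF f(1)] by (simp add: linear_matrix_vector_mul_eq)
  have Qe: "Q *v axis e 1 = v /\<^sub>R norm v"
    using f(2) matrix_works[OF lin] unfolding Q_def by simp
  have "det (transpose Q) \<noteq> 0" using det_orthogonal_matrix[OF Q] by auto
  \<comment> \<open>The scalar t |v|^2 undoes the normalisation of v.\<close>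
  from low_equivariant_congr[OF low_equivariant_axis this, of "t * norm v ^ 2" e]
  have "low_equivariant ((t * norm v ^ 2) *\<^sub>R outer (v /\<^sub>R norm v))"
    unfolding outer_congr by (simp only: transpose_transpose Qe)
  moreover have "(t * norm v ^ 2) *\<^sub>R outer (v /\<^sub>R norm v) = t *\<^sub>R outer v"
  proof -
    have "norm v * (norm v * (inverse (norm v) * inverse (norm v))) = 1"
      using False by (simp add: field_simps)
    then show ?thesis by (simp add: outer_def vec_eq_iff power2_eq_square)
  qed
  ultimately show ?thesis by simp
qed

text \<open>The difference (e_i + e_j)(e_i + e_j)^t - e_i e_i^t - e_j e_j^t equals e_i e_j^t + e_j
  e_i^t; the sum over all ordered pairs counts every entry of S twice, whence the factor
  1/2.\<close>

lemma symmetric_mat_polarization: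
  fixes S :: "real^'n::finite^'n"
  assumes S: "symmetric_mat S"
  shows "S = (\<Sum>i\<in>UNIV. \<Sum>j\<in>UNIV. (S $ i $ j / 2) *\<^sub>R outer (axis i 1 + axis j 1) +
     ((- (S $ i $ j / 2)) *\<^sub>R outer (axis i 1) + (- (S $ i $ j / 2)) *\<^sub>R outer (axis j 1)))" (is "S = ?R")
proof -
  have "?R $ a $ b = S $ a $ b" for a b
  proof -
    have "?R $ a $ b = (\<Sum>i\<in>UNIV. \<Sum>j\<in>UNIV. (if j = b then (if i = a then S $ a $ b / 2 else 0) else 0)) +
       (\<Sum>i\<in>UNIV. \<Sum>j\<in>UNIV. (if j = a then (if i = b then S $ b $ a / 2 else 0) else 0))"
      unfolding sum.distrib[symmetric] sum_component
      by (intro sum.cong refl) (auto simp: outer_def axis_def algebra_simps)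
    also have "\<dots> = S $ a $ b" using S by (simp add: symmetric_mat_iff)
    finally show ?thesis .
  qed
  then show ?thesis by (simp add: vec_eq_iff)
qed

lemma low_equivariant:
  assumes "symmetric_mat S"
  shows "low_equivariant S"
proof -
  have "low_equivariant (\<Sum>i\<in>UNIV. \<Sum>j\<in>UNIV. (S $ i $ j / 2) *\<^sub>R outer (axis i 1 + axis j 1) +
     ((- (S $ i $ j / 2)) *\<^sub>R outer (axis i 1) + (- (S $ i $ j / 2)) *\<^sub>R outer (axis j 1)))"
    by (intro low_equivariant_sum low_equivariant_add low_equivariant_outer finite)
  then show ?thesis unfolding symmetric_mat_polarization[OF assms, symmetric] .
qed

text \<open>det(x C + D) is a polynomial in x that does not vanish at x = i: by the symmetry of C
  D^t, (D + i C)(D - i C)^t = D D^t + C C^t, and this matrix has trivial kernel because of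
  \<open>h6\<close>. A nonzero polynomial has finitely many roots, so some real x is none of
  them.\<close>

lemma exists_shift_invertible:
  fixes A B C D :: "real^'n::finite^'n"
  assumes h5: "C ** transpose D = D ** transpose C" and h6: "A ** transpose D - B ** transpose C = mat 1"
  shows "\<exists>x. det (x *\<^sub>R C + D) \<noteq> 0"
proof -
  let ?C = "cmat_of_real C" and ?D = "cmat_of_real D"
  define P :: "complex poly^'n^'n" where "P = (\<chi> i j. [:?D $ i $ j, ?C $ i $ j:])"
  have P: "poly (det P) z = det (\<chi> i j. ?D $ i $ j + z * ?C $ i $ j)" for z
    by (simp add: det_def P_def poly_sum poly_prod)
  let ?E = "D ** transpose D + C ** transpose C"
  have "det ?E \<noteq> 0"
  proof (rule det_nz_of_ker)
    fix x assume x: "?E *v x = 0"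
    have "x \<bullet> (?E *v x) = (transpose D *v x) \<bullet> (transpose D *v x) + (transpose C *v x) \<bullet> (transpose C *v x)"
      by (simp add: matrix_vector_mult_add_rdistrib inner_add_right matrix_vector_mul_assoc[symmetric] dot_lmul_matrix[symmetric])
    then have "transpose D *v x = 0" "transpose C *v x = 0"
      using x by (simp_all add: add_nonneg_eq_0_iff)
    then have "(A ** transpose D - B ** transpose C) *v x = 0"
      by (simp only: matrix_vector_mult_diff_rdistrib matrix_vector_mul_assoc[symmetric] matrix_vector_mult_0_right diff_0_right)
    then show "x = 0" unfolding h6 by simp
  qed
  then have "det (cmat_of_real ?E) \<noteq> 0" by (simp add: det_cmat_of_real)
  moreover have "cmat_of_real ?E = (\<chi> i j. ?D $ i $ j + \<i> * ?C $ i $ j) ** transpose (\<chi> i j. ?D $ i $ j - \<i> * ?C $ i $ j)"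
  proof -
    have "(\<Sum>k\<in>UNIV. C $ i $ k * D $ j $ k) = (\<Sum>k\<in>UNIV. D $ i $ k * C $ j $ k)" for i j
      using arg_cong[OF h5, of "\<lambda>M. M $ i $ j"] by (simp add: matrix_mult_nth transpose_def)
    then show ?thesis
      by (simp add: vec_eq_iff matrix_mult_nth transpose_def complex_eq_iff algebra_simps sum.distrib sum_subtractf)
  qed
  ultimately have "poly (det P) \<i> \<noteq> 0" unfolding P by (simp add: det_mul)
  then have "det P \<noteq> 0" by auto
  then have "finite {z. poly (det P) z = 0}" by (rule poly_roots_finite)
  then have "finite (complex_of_real -` {z. poly (det P) z = 0})"
    by (rule finite_vimageI) (simp add: inj_on_def)
  then obtain x where "poly (det P) (complex_of_real x) \<noteq> 0"
    using infinite_UNIV_char_0[where 'a = real] by (metis (mono_tags, lifting) UNIV_eq_I mem_Collect_eq vimageI)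
  moreover have "(\<chi> i j. ?D $ i $ j + complex_of_real x * ?C $ i $ j) = cmat_of_real (x *\<^sub>R C + D)"
    by (simp add: vec_eq_iff)
  ultimately show ?thesis unfolding P by (auto simp: det_cmat_of_real)
qed

text \<open>After right multiplication by the translation (1 x; 0 1) the lower right block D' is
  invertible, and the matrix factors as (1 T; 0 1) (D'^-t 0; 0 D') (1 0; S 1) with S = D'^-1 C and T
  = B' D'^-1. The maps of these factors and the translation back by -x are known to be
  equivariant.\<close>

lemma equivariant_symplectic:
  fixes A B C D :: "real^'n::finite^'n"
  assumes h1: "transpose A ** C = transpose C ** A" and h2: "transpose B ** D = transpose D ** B"
    and h3: "transpose A ** D - transpose C ** B = mat 1"
    and h5: "C ** transpose D = D ** transpose C"
    and h6: "A ** transpose D - B ** transpose C = mat 1"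
  shows "equivariant
    (\<lambda>Z. (cmat_of_real A ** Z + cmat_of_real B) ** matrix_inv (cmat_of_real C ** Z + cmat_of_real D))
    (\<lambda>Z. det (cmat_of_real C ** Z + cmat_of_real D))"
proof -
  obtain x where x: "det (x *\<^sub>R C + D) \<noteq> 0" using exists_shift_invertible[OF h5 h6] by blast
  define D' where "D' = x *\<^sub>R C + D"
  define B' where "B' = x *\<^sub>R A + B"
  have nz: "det D' \<noteq> 0" using x by (simp add: D'_def)
  note scale = scalar_matrix_assoc[symmetric] matrix_scalar_ac transpose_scalar
  have h5': "C ** transpose D' = D' ** transpose C"
    by (simp add: D'_def transpose_add matrix_distribs scale h5)
  have h2': "transpose B' ** D' = transpose D' ** B'"
  proof -
    have "x *\<^sub>R (transpose A ** D) - x *\<^sub>R (transpose C ** B) = x *\<^sub>R mat 1"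
      by (simp add: h3 scaleR_diff_right[symmetric])
    moreover have "x *\<^sub>R transpose (transpose A ** D) - x *\<^sub>R transpose (transpose C ** B) = x *\<^sub>R mat 1"
      by (simp add: h3 scaleR_diff_right[symmetric] transpose_diff[symmetric])
    ultimately show ?thesis
      by (simp add: D'_def B'_def transpose_add transpose_simps matrix_distribs scale h1 h2 algebra_simps)
  qed
  have h6': "A ** transpose D' - B' ** transpose C = mat 1"
  proof -
    have "A ** transpose D' - B' ** transpose C = A ** transpose D - B ** transpose C"
      by (simp add: D'_def B'_def transpose_add matrix_distribs scale)
    then show ?thesis using h6 by simp
  qed
  let ?I = "matrix_inv D'"
  have I: "D' ** ?I = mat 1" "?I ** D' = mat 1" using nz by (simp_all add: matrix_inv_right matrix_inv_left)
  have It: "transpose D' ** transpose ?I = mat 1" "transpose ?I ** transpose D' = mat 1"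
    using I by (simp_all add: matrix_transpose_mul[symmetric])
  define S where "S = ?I ** C"
  define T where "T = B' ** ?I"
  have symS: "symmetric_mat S"
  proof -
    have "?I ** (C ** transpose D') ** transpose ?I = ?I ** (D' ** transpose C) ** transpose ?I"
      unfolding h5' ..
    then have "?I ** C ** (transpose D' ** transpose ?I) = (?I ** D') ** transpose C ** transpose ?I"
      by (simp only: matrix_mul_assoc)
    then have "?I ** C = transpose C ** transpose ?I" unfolding It I by simp
    then show ?thesis by (simp add: symmetric_mat_def S_def matrix_transpose_mul)
  qed
  have symT: "symmetric_mat T"
  proof -
    have "transpose ?I ** (transpose B' ** D') ** ?I = transpose ?I ** (transpose D' ** B') ** ?I"
      unfolding h2' ..
    then have "transpose ?I ** transpose B' ** (D' ** ?I) = (transpose ?I ** transpose D') ** B' ** ?I"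
      by (simp only: matrix_mul_assoc)
    then have "transpose ?I ** transpose B' = B' ** ?I" unfolding It I by simp
    then show ?thesis by (simp add: symmetric_mat_def T_def matrix_transpose_mul)
  qed
  \<comment> \<open>The upper left block of the factorisation, obtained from A D'^t - B' C^t = 1 on
    multiplying by D'^-t.\<close>
  have A_eq: "A = transpose ?I + T ** C"
  proof -
    have "A ** (transpose D' ** transpose ?I) = B' ** (transpose C ** transpose ?I) + (A ** transpose D' - B' ** transpose C) ** transpose ?I"
      by (simp add: matrix_distribs matrix_mul_assoc)
    also have "transpose C ** transpose ?I = ?I ** C"
      using symS by (simp add: symmetric_mat_def S_def matrix_transpose_mul)
    finally show ?thesis unfolding It h6' by (simp add: T_def matrix_mul_assoc add.commute)
  qed
  have nzI: "det (transpose ?I) \<noteq> 0" using nz by (simp add: det_matrix_inv)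
  have symx: "symmetric_mat (- x *\<^sub>R mat 1 :: real^'n^'n)" by (simp add: symmetric_mat_iff mat_def)
  have one: "det (mat 1 :: real^'n^'n) \<noteq> 0" by simp
  note aff1 = equivariant_affine[OF nzI symT] and aff2 = equivariant_affine[OF one symx]
  let ?s = "\<lambda>Z. cmat_of_real (mat 1) ** Z ** transpose (cmat_of_real (mat 1)) + cmat_of_real (- x *\<^sub>R mat 1)"
  show ?thesis
  proof (rule equivariant_cong[OF equivariant_compose[OF aff1
          equivariant_compose[OF low_equivariant[OF symS] aff2]]])
    fix Z :: "complex^'n^'n" assume Z: "Z \<in> siegel"
    let ?D = "cmat_of_real D'" and ?Ic = "cmat_of_real ?I" and ?A = "cmat_of_real A" and ?B = "cmat_of_real B" and ?C = "cmat_of_real C" and ?B' = "cmat_of_real B'" and ?T = "cmat_of_real T"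
    have Ic: "?D ** ?Ic = mat 1" "?Ic ** ?D = mat 1"
      unfolding map_matrix_of_real_mult[symmetric] I by (simp_all add: map_matrix_mat1)
    let ?Z' = "?s Z"
    have "cmat_of_real (- x *\<^sub>R mat 1) = - (x *\<^sub>R mat 1 :: complex^'n^'n)"
      by (simp add: vec_eq_iff mat_def scaleR_conv_of_real[where 'a = complex])
    then have Z': "?Z' = Z - x *\<^sub>R mat 1" by (simp add: map_matrix_mat1)
    let ?N = "low_denom S ?Z'" and ?J = "?C ** Z + cmat_of_real D"
    have nzN: "det ?N \<noteq> 0"
      using low_equivariant[OF symS] aff2 Z unfolding equivariant_def by blast
    have CD: "?C ** Z + cmat_of_real D = ?C ** ?Z' + ?D"
      unfolding Z' by (simp add: D'_def map_matrix_add matrix_distribs vec_eq_iff matrix_mult_nth mat_def if_distrib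
          scaleR_conv_of_real[where 'a = complex] cong: if_cong)
    \<comment> \<open>The denominator of the whole map at Z is D' times that of the lower unipotent
      factor at Z - x.\<close>
    have DN: "?D ** ?N = ?J"
      unfolding CD by (simp add: S_def map_matrix_of_real_mult matrix_distribs matrix_mul_assoc Ic add.commute)
    have nzD: "det ?D \<noteq> 0" using nz by (simp add: det_cmat_of_real)
    have invJ: "matrix_inv ?J = matrix_inv ?N ** ?Ic"
      unfolding DN[symmetric] matrix_inv_matrix_mult[OF nzD nzN] matrix_inv_cmat_of_real[OF nz] ..
    have nzJ: "det ?J \<noteq> 0" unfolding DN[symmetric] using nzD nzN by (simp add: det_mul)
    have AB: "?A ** Z + ?B = transpose ?Ic ** ?Z' + ?T ** ?J"
    proof -
      have "?A ** Z + ?B = ?A ** ?Z' + ?B'"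
        unfolding Z' by (simp add: B'_def map_matrix_add matrix_distribs vec_eq_iff matrix_mult_nth mat_def if_distrib
          scaleR_conv_of_real[where 'a = complex] cong: if_cong)
      also have "\<dots> = transpose ?Ic ** ?Z' + (?T ** ?C ** ?Z' + ?T ** ?D)"
      proof -
        have "B' = T ** D'" by (simp add: T_def matrix_mul_assoc[symmetric] I)
        then have "?B' = ?T ** ?D" by (simp add: map_matrix_of_real_mult)
        moreover have "?A = transpose ?Ic + ?T ** ?C"
          by (subst A_eq) (simp add: map_matrix_add map_matrix_of_real_mult transpose_map_matrix)
        ultimately show ?thesis by (simp add: matrix_add_rdistrib add.assoc)
      qed
      finally show ?thesis unfolding CD by (simp add: matrix_add_ldistrib matrix_mul_assoc)
    qed
    have dist: "(P + Q ** J) ** K = P ** K + Q ** (J ** K)" for P Q J K :: "complex^'n^'n"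
      by (simp only: matrix_add_rdistrib matrix_mul_assoc)
    have "(?A ** Z + ?B) ** matrix_inv ?J =
        transpose ?Ic ** ?Z' ** matrix_inv ?J + ?T ** (?J ** matrix_inv ?J)"
      unfolding AB dist ..
    also have "\<dots> = transpose ?Ic ** (?Z' ** matrix_inv ?N) ** ?Ic + ?T"
      unfolding matrix_inv_right[OF nzJ] unfolding invJ by (simp add: matrix_mul_assoc)
    finally show "(?A ** Z + ?B) ** matrix_inv ?J =
       cmat_of_real (transpose ?I) ** low_act S ?Z' ** transpose (cmat_of_real (transpose ?I)) + ?T"
      by (simp add: transpose_map_matrix)
    have "det ?J = of_real (det D') * det ?N" unfolding DN[symmetric] by (simp add: det_mul det_cmat_of_real)
    then show "det ?J = inverse (of_real (det (transpose ?I))) * (det ?N * inverse (of_real (det (mat 1 :: real^'n^'n))))"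
      using nz by (simp add: det_matrix_inv)
  qed
qed

subsection \<open>The operators \<open>X\<^sub>+\<close> along slices\<close>

lemma sum_UNIV_Plus: "(\<Sum>k\<in>(UNIV :: ('a::finite + 'b::finite) set). f k) = (\<Sum>k\<in>UNIV. f (Inl k)) + (\<Sum>k\<in>UNIV. f (Inr k))"
  by (simp add: UNIV_Plus_UNIV[symmetric] sum.Plus del: UNIV_Plus_UNIV)

lemma block_mat_mult:
  fixes A :: "'a::semiring_1^'n::finite^'n"
  shows "block_mat A B C D ** block_mat A' B' C' D' =
    block_mat (A ** A' + B ** C') (A ** B' + B ** D') (C ** A' + D ** C') (C ** B' + D ** D')"
  by (auto simp: vec_eq_iff matrix_mult_nth block_mat_def sum_UNIV_Plus split: sum.split)

lemma block_mat_transpose: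
  "transpose (block_mat A B C D) = block_mat (transpose A) (transpose C) (transpose B) (transpose D)"
  by (auto simp: vec_eq_iff transpose_def block_mat_def split: sum.split)

lemma block_mat_eq_iff:
  "block_mat A B C D = block_mat A' B' C' D' \<longleftrightarrow> A = A' \<and> B = B' \<and> C = C' \<and> D = D'"
  by (auto simp: vec_eq_iff block_mat_def split: sum.split)

lemma block_mat_one: "block_mat (mat 1) 0 0 (mat 1) = mat 1"
  by (auto simp: vec_eq_iff block_mat_def mat_def split: sum.split)

lemma block_mat_uminus: "- block_mat A B C D = block_mat (- A) (- B) (- C) (- D)"
  by (auto simp: vec_eq_iff block_mat_def split: sum.split)

lemma map_block_mat: "map_matrix f (block_mat A B C D) =
    block_mat (map_matrix f A) (map_matrix f B) (map_matrix f C) (map_matrix f D)"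
  by (auto simp: vec_eq_iff block_mat_def split: sum.split)

text \<open>The first three relations are blocks of G^t J G = J. This equation makes - J G^t J a
  left inverse of G, hence also a right inverse, so G J G^t = J, which gives the last two.\<close>

lemma Sp_int_relations:
  fixes A B C D :: "int^'n::finite^'n"
  assumes "block_mat A B C D \<in> Sp_int"
  defines "A' \<equiv> map_matrix real_of_int A" and "B' \<equiv> map_matrix real_of_int B"
    and "C' \<equiv> map_matrix real_of_int C" and "D' \<equiv> map_matrix real_of_int D"
  shows "transpose A' ** C' = transpose C' ** A'" "transpose B' ** D' = transpose D' ** B'"
    "transpose A' ** D' - transpose C' ** B' = mat 1"
    "C' ** transpose D' = D' ** transpose C'"
    "A' ** transpose D' - B' ** transpose C' = mat 1"
proof -
  let ?J = "block_mat 0 (mat 1) (- mat 1) 0 :: real^('n + 'n)^('n + 'n)"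
  let ?G = "block_mat A' B' C' D'"
  have J: "map_matrix real_of_int (block_mat 0 (mat 1) (- mat 1) 0) = ?J"
  proof -
    have "map_matrix real_of_int 0 = (0 :: real^'n^'n)" "map_matrix real_of_int (mat 1) = (mat 1 :: real^'n^'n)"
      "map_matrix real_of_int (- mat 1) = (- mat 1 :: real^'n^'n)"
      by (simp_all add: vec_eq_iff mat_def)
    then show ?thesis by (simp only: map_block_mat)
  qed
  have "transpose (block_mat A B C D) ** block_mat 0 (mat 1) (- mat 1) 0 ** block_mat A B C D = block_mat 0 (mat 1) (- mat 1) 0"
    using assms(1) by (simp add: Sp_int_def Let_def)
  from arg_cong[OF this, of "map_matrix real_of_int"]
  have 1: "transpose ?G ** ?J ** ?G = ?J"
    unfolding map_matrix_of_int_mult J transpose_map_matrix[symmetric]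
    unfolding map_block_mat A'_def B'_def C'_def D'_def .
  have z: "(0 :: real^'n^'n) ** X = 0" "X ** 0 = 0" for X :: "real^'n^'n"
    by (simp_all add: vec_eq_iff matrix_mult_nth)
  have JJ: "?J ** ?J = - mat 1"
    unfolding block_mat_mult block_mat_one[symmetric] block_mat_uminus by (simp add: z matrix_minus_mult matrix_mult_minus)
  have "(- (?J ** transpose ?G ** ?J)) ** ?G = - (?J ** (transpose ?G ** ?J ** ?G))"
    by (simp add: matrix_minus_mult matrix_mul_assoc)
  then have "(- (?J ** transpose ?G ** ?J)) ** ?G = mat 1" unfolding 1 JJ by simp
  then have "?G ** (- (?J ** transpose ?G ** ?J)) = mat 1" using matrix_left_right_inverse by blast
  then have "?G ** ?J ** transpose ?G ** ?J = - mat 1"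
    by (simp add: matrix_mult_minus matrix_mul_assoc) (metis minus_minus)
  then have "?G ** ?J ** transpose ?G ** ?J ** ?J = (- mat 1) ** ?J" by simp
  then have "?G ** ?J ** transpose ?G ** (?J ** ?J) = - ?J" by (simp add: matrix_mul_assoc matrix_minus_mult)
  then have 2: "?G ** ?J ** transpose ?G = ?J" unfolding JJ by (simp add: matrix_mult_minus)
  from 1 show "transpose A' ** C' = transpose C' ** A'" "transpose B' ** D' = transpose D' ** B'"
    "transpose A' ** D' - transpose C' ** B' = mat 1"
    unfolding block_mat_transpose block_mat_mult block_mat_eq_iff
    by (simp_all add: z matrix_minus_mult matrix_mult_minus)
  from 2 show "C' ** transpose D' = D' ** transpose C'"
    "A' ** transpose D' - B' ** transpose C' = mat 1"
    unfolding block_mat_transpose block_mat_mult block_mat_eq_iff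
    by (simp_all add: z matrix_minus_mult matrix_mult_minus)
qed

text \<open>A holomorphic section over the half space on which V = P Y, so that Y^-1 V^t is the
  constant P^t.\<close>

definition slice :: "real^'n^'m \<Rightarrow> real^'n^'m \<Rightarrow> complex^'n^'n \<Rightarrow> ('n::finite, 'm::finite) sj_point" where
  "slice P Q Z = (Z, cmat_of_real P ** Z + cmat_of_real Q)"

lemma slice_in_space: "Z \<in> siegel \<Longrightarrow> slice P Q Z \<in> siegel_jacobi_space"
  by (simp add: slice_def sj_space_iff)

lemma smooth_slice:
  assumes "sj.smooth h"
  shows "H.smooth (\<lambda>Z. h (slice P Q Z))"
proof (rule smooth_compose[OF H.rel_open_set_axioms sj.rel_open_set_axioms slice_in_space _ assms])
  fix w
  have "H.smooth (\<lambda>Z. (cmat_of_real P ** Z + cmat_of_real Q) $ i $ j)" for i j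
    by (simp, intro H.smooth_add H.smooth_matrix_mult) (auto intro: smooth_entry)
  then show "H.smooth (\<lambda>Z. complex_of_real (slice P Q Z \<bullet> w))"
    unfolding slice_def inner_prod_def fst_conv snd_conv of_real_add of_real_inner_matrix
    by (intro H.smooth_intros smooth_entry)
qed

text \<open>The W-component of the tangent vector to a slice over the direction
  \<open>cscale z (Esym a b)\<close>, decomposed into coordinate directions; the two summands are
  the directions occurring in \<open>YV_D_W a b\<close> and \<open>YV_D_W b a\<close>.\<close>

lemma w_dir_sum:
  fixes P :: "real^'n::finite^'m::finite"
  shows "(0, cmat_of_real P ** cscale z (Esym a b)) =
    (1 / 2) *\<^sub>R (\<Sum>c\<in>UNIV. P $ c $ a *\<^sub>R w_dir c b z + P $ c $ b *\<^sub>R w_dir c a z)"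
proof -
  have l: "(cmat_of_real P ** cscale z (Esym a b)) $ i $ j =
     (of_real (P $ i $ a) * (if j = b then z else 0) + of_real (P $ i $ b) * (if j = a then z else 0)) / 2" for i j
  proof -
    have "(cmat_of_real P ** cscale z (Esym a b)) $ i $ j =
       (\<Sum>k\<in>UNIV. if k = a then of_real (P $ i $ a) * (if j = b then z else 0) / 2 else 0) +
       (\<Sum>k\<in>UNIV. if k = b then of_real (P $ i $ b) * (if j = a then z else 0) / 2 else 0)"
      unfolding matrix_mult_nth sum.distrib[symmetric] by (intro sum.cong refl) (simp add: Esym_def field_simps)
    then show ?thesis by (simp add: add_divide_distrib)
  qed
  have r: "(\<Sum>c\<in>UNIV. P $ c $ x *\<^sub>R (if i = c \<and> j = y then z else 0)) = P $ i $ x *\<^sub>R (if j = y then z else 0)" for i j x y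
  proof -
    have "(\<Sum>c\<in>UNIV. P $ c $ x *\<^sub>R (if i = c \<and> j = y then z else 0)) = (\<Sum>c\<in>UNIV. if c = i then P $ i $ x *\<^sub>R (if j = y then z else 0) else 0)"
      by (intro sum.cong) auto
    then show ?thesis by simp
  qed
  show ?thesis
  proof (rule prod_eqI)
    show "snd (0, cmat_of_real P ** cscale z (Esym a b)) =
      snd ((1 / 2) *\<^sub>R (\<Sum>c\<in>UNIV. P $ c $ a *\<^sub>R w_dir c b z + P $ c $ b *\<^sub>R w_dir c a z))"
      unfolding vec_eq_iff snd_conv l w_dir_def snd_scaleR snd_sum snd_add vector_scaleR_component
        sum_component vector_add_component vec_lambda_beta sum.distrib r
      by (simp add: scaleR_conv_of_real[where 'a = complex] add_divide_distrib)
  qed (simp add: fst_sum w_dir_def)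
qed

text \<open>X_+ differentiates along the tangent directions (E, P E) of the slice: as Y^-1 V^t = P^t
  there, the two correction terms supply precisely the derivative along the W-component.\<close>

lemma wd_slice:
  assumes h: "sj.smooth h" and Z: "Z \<in> siegel"
  shows "X_plus a b h (slice P Q Z) = 2 * \<i> * wd (Esym a b) (\<lambda>Z. h (slice P Q Z)) Z"
proof -
  let ?p = "slice P Q Z" and ?E = "Esym a b"
  obtain L where L: "(h has_derivative L) (at ?p within siegel_jacobi_space)"
    using sj.smooth_has_derivative[OF h slice_in_space[OF Z]] by blast
  note lin = has_derivative_linear[OF L]
  have dd: "dir_deriv v h ?p = L v" if "v \<in> sj_tangent" for v
    by (rule sj.dir_deriv_eq[OF L slice_in_space[OF Z] that])
  have w: "w_dir c d z \<in> sj_tangent" for c d z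
    by (simp add: w_dir_def sj_tangent_def symmetric_mat_iff)
  \<comment> \<open>For a \<noteq> b the coordinate direction is twice \<open>Esym a b\<close>; the
    factor 1/2 in \<open>D_Z\<close> compensates.\<close>
  have z: "z_dir a b z = (if a = b then 1 else 2) *\<^sub>R (cscale z ?E, 0)" for z
    by (auto simp: z_dir_def vec_eq_iff Esym_def doubleton_eq_iff scaleR_conv_of_real[where 'a = complex])
  have zt: "z_dir a b z \<in> sj_tangent" for z
    by (simp add: z_dir_def sj_tangent_def symmetric_mat_iff insert_commute)
  have DZ: "D_Z a b h ?p = (L (cscale 1 ?E, 0) - \<i> * L (cscale \<i> ?E, 0)) / 2"
    unfolding D_Z_def partial_z_def dd[OF zt] unfolding z linear_cmul[OF lin]
    by (simp add: scaleR_conv_of_real[where 'a = complex] diff_divide_distrib)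
  have Wd: "D_W d c h ?p = (L (w_dir c d 1) - \<i> * L (w_dir c d \<i>)) / 2" for c d
    unfolding D_W_def partial_w_def dd[OF w] ..
  have nz: "det (Im_mat Z) \<noteq> 0" using siegel_det_pos[OF Z] by simp
  have Im_W: "Im_mat (cmat_of_real P ** Z + cmat_of_real Q) = P ** Im_mat Z"
    by (simp add: vec_eq_iff matrix_mult_nth)
  have "transpose (Im_mat Z) = Im_mat Z"
    using siegel_sym[OF Z] by (simp add: transpose_map_matrix sym_mats_transpose)
  then have coeff: "matrix_inv (Im_mat Z) ** transpose (Im_mat (cmat_of_real P ** Z + cmat_of_real Q)) = transpose P"
    unfolding Im_W by (simp add: matrix_transpose_mul matrix_mul_assoc matrix_inv_left[OF nz])
  define T where "T x y z = (\<Sum>c\<in>UNIV. of_real (P $ c $ x) * L (w_dir c y z))" for x y z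
  have YV: "YV_D_W x y h ?p = \<i> * ((T x y 1 - \<i> * T x y \<i>) / 2)" for x y
  proof -
    have "YV_D_W x y h ?p = \<i> * (\<Sum>c\<in>UNIV. of_real (P $ c $ x) * ((L (w_dir c y 1) - \<i> * L (w_dir c y \<i>)) / 2))"
      unfolding YV_D_W_def slice_def prod.case coeff Wd[unfolded slice_def]
      by (simp add: transpose_def)
    also have "(\<Sum>c\<in>UNIV. of_real (P $ c $ x) * ((L (w_dir c y 1) - \<i> * L (w_dir c y \<i>)) / 2)) = (T x y 1 - \<i> * T x y \<i>) / 2"
      unfolding T_def sum_distrib_left sum_subtractf[symmetric] sum_divide_distrib
      by (intro sum.cong refl) (simp add: field_simps)
    finally show ?thesis .
  qed
  have Lw: "L (0, cmat_of_real P ** cscale z ?E) = (T a b z + T b a z) / 2" for z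
    unfolding w_dir_sum T_def
    by (simp add: linear_cmul[OF lin] linear_sum[OF lin] linear_add[OF lin] scaleR_conv_of_real sum.distrib)
  have sec': "(slice P Q has_derivative (\<lambda>U. (U, cmat_of_real P ** U))) (at Z within siegel)"
    unfolding slice_def
  proof (rule has_derivative_Pair[OF has_derivative_ident])
    have "linear (\<lambda>U. cmat_of_real P ** U)"
      by (auto intro!: linearI simp: matrix_add_ldistrib matrix_scalar_ac scalar_matrix_assoc)
    then show "((\<lambda>Z. cmat_of_real P ** Z + cmat_of_real Q) has_derivative (\<lambda>U. cmat_of_real P ** U)) (at Z within siegel)"
      using linear_conv_bounded_linear bounded_linear_imp_has_derivative has_derivative_add_const by blast
  qed
  have "(h has_derivative L) (at ?p within slice P Q ` siegel)"
    by (rule has_derivative_subset[OF L]) (use slice_in_space in blast)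
  then have hs: "((\<lambda>Z. h (slice P Q Z)) has_derivative (\<lambda>U. L (U, cmat_of_real P ** U))) (at Z within siegel)"
    using has_derivative_in_compose[OF sec'] by blast
  have split: "L (U, V) = L (U, 0) + L (0, V)" for U V
    using linear_add[OF lin, of "(U, 0)" "(0, V)"] by simp
  have one: "cscale 1 ?E = ?E" by (simp add: vec_eq_iff)
  have wd_E: "wd ?E (\<lambda>Z. h (slice P Q Z)) Z = (L (cscale 1 ?E, 0) + L (0, cmat_of_real P ** cscale 1 ?E)
      - \<i> * (L (cscale \<i> ?E, 0) + L (0, cmat_of_real P ** cscale \<i> ?E))) / 2"
    unfolding wd_eq[OF hs Z Esym_sym] split[of ?E "cmat_of_real P ** ?E"]
      split[of "cscale \<i> ?E" "cmat_of_real P ** cscale \<i> ?E"] one ..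
  show ?thesis
    unfolding X_plus_def DZ YV wd_E Lw by (simp add: field_simps)
qed

lemma sj_smooth_X_plus:
  assumes h: "sj.smooth h"
  shows "sj.smooth (X_plus a b h)"
proof -
  have zt: "z_dir i j z \<in> sj_tangent" for i j z
    by (simp add: z_dir_def sj_tangent_def symmetric_mat_iff insert_commute)
  have wt: "w_dir i j z \<in> sj_tangent" for i j z
    by (simp add: w_dir_def sj_tangent_def symmetric_mat_iff)
  have DZ: "sj.smooth (D_Z i j h)" for i j
    unfolding D_Z_def partial_z_def
    by (cases "i = j") (simp_all, (intro sj.smooth_intros sj.smooth_dir_deriv h zt)+)
  have DW: "sj.smooth (D_W j i h)" for i j
    unfolding D_W_def partial_w_def
    by (intro sj.smooth_intros sj.smooth_dir_deriv h wt)
  have YV: "sj.smooth (YV_D_W i j h)" for i j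
  proof -
    have "YV_D_W i j h = (\<lambda>q. \<i> * (\<Sum>c\<in>UNIV. (\<Sum>k\<in>UNIV. of_real (matrix_inv (Im_mat (fst q)) $ i $ k) *
        of_real (Im (snd q $ c $ k))) * D_W j c h q))"
      by (auto simp: YV_D_W_def fun_eq_iff matrix_mult_nth transpose_def)
    then show ?thesis
      by (simp only:) (intro sj.smooth_intros DW sj_smooth_Im_inv sj_smooth_W)
  qed
  show ?thesis
    unfolding X_plus_def
    by (intro sj.smooth_intros DZ YV)
qed

lemma sj_smooth_X_plus_list: "sj.smooth h \<Longrightarrow> sj.smooth (foldr (\<circ>) (map (\<lambda>i. X_plus i (s i)) xs) id h)"
  by (induction xs) (simp_all add: sj_smooth_X_plus)

text \<open>Each factor is evaluated on the same slice, so \<open>wd_slice\<close> iterates. The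
  ordered composition becomes a \<open>wd_fold\<close>, for which the order of the factors is
  immaterial.\<close>

lemma X_plus_list_slice:
  assumes h: "sj.smooth h"
  shows "distinct xs \<Longrightarrow> Z \<in> siegel \<Longrightarrow> foldr (\<circ>) (map (\<lambda>i. X_plus i (s i)) xs) id h (slice P Q Z) =
    (2 * \<i>) ^ length xs * wd_fold (set xs) (\<lambda>i. Esym i (s i)) (\<lambda>Z. h (slice P Q Z)) Z"
proof (induction xs arbitrary: Z)
  case (Cons x xs)
  let ?h = "foldr (\<circ>) (map (\<lambda>i. X_plus i (s i)) xs) id h"
  let ?F = "wd_fold (set xs) (\<lambda>i. Esym i (s i)) (\<lambda>Z. h (slice P Q Z))"
  have sh: "sj.smooth ?h" by (rule sj_smooth_X_plus_list[OF h])
  have sF: "H.smooth ?F" by (rule wd_fold_smooth[OF _ smooth_slice[OF h]]) simp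
  have "foldr (\<circ>) (map (\<lambda>i. X_plus i (s i)) (x # xs)) id h (slice P Q Z) = X_plus x (s x) ?h (slice P Q Z)"
    by simp
  also have "\<dots> = 2 * \<i> * wd (Esym x (s x)) (\<lambda>Z. ?h (slice P Q Z)) Z"
    by (rule wd_slice[OF sh Cons.prems(2)])
  also have "wd (Esym x (s x)) (\<lambda>Z. ?h (slice P Q Z)) Z =
      wd (Esym x (s x)) (\<lambda>Z. (2 * \<i>) ^ length xs * ?F Z) Z"
    by (intro wd_cong smooth_slice[OF sh] Cons.IH Cons.prems(2) Esym_sym) (use Cons.prems(1) in simp)
  also have "\<dots> = (2 * \<i>) ^ length xs * wd (Esym x (s x)) ?F Z"
    using Cons by (intro wd_cmult sF) auto
  finally show ?case using Cons.prems by (simp add: wd_fold_insert sF)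
qed simp

lemma op_det_slice:
  fixes h :: "('n::{finite,linorder}, 'm::finite) sj_point \<Rightarrow> complex"
  assumes h: "sj.smooth h" and Z: "Z \<in> siegel"
  shows "op_det X_plus h (slice P Q Z) = (2 * \<i>) ^ CARD('n) * wd_det Esym (\<lambda>Z. h (slice P Q Z)) Z"
  unfolding op_det_def wd_det_def sum_distrib_left
  using X_plus_list_slice[OF h, of "sorted_list_of_set UNIV", OF _ Z]
  by (intro sum.cong refl) (simp add: mult.left_commute)

lemma sj_smooth_op_det: "sj.smooth h \<Longrightarrow> sj.smooth (op_det X_plus h)"
  unfolding op_det_def
  by (intro sj.smooth_intros sj_smooth_X_plus_list)

section \<open>Antiholomorphic factors\<close>

lemma wd_fold_antiholomorphic:
  assumes q: "H.smooth q" "\<And>Z U. Z \<in> siegel \<Longrightarrow> U \<in> sym_mats \<Longrightarrow> wd U q Z = 0"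
    and F: "H.smooth F" and A: "finite A" "\<And>a. a \<in> A \<Longrightarrow> u a \<in> sym_mats" and Z: "Z \<in> siegel"
  shows "wd_fold A u (\<lambda>Z. q Z * F Z) Z = q Z * wd_fold A u F Z"
  by (rule wd_fold_transfer[where \<phi> = "\<lambda>Z. Z"])
     (use assms in \<open>auto intro: H.smooth_mult simp: wd_mult\<close>)

lemma wd_det_antiholomorphic:
  assumes "H.smooth q" "\<And>Z U. Z \<in> siegel \<Longrightarrow> U \<in> sym_mats \<Longrightarrow> wd U q Z = 0"
    and "H.smooth F" "Z \<in> siegel"
  shows "wd_det Esym (\<lambda>Z. q Z * F Z) Z = q Z * wd_det Esym F Z"
  unfolding wd_det_def sum_distrib_left
  by (intro sum.cong refl)
     (simp add: wd_fold_antiholomorphic[OF assms(1-3) _ _ assms(4)] mult.left_commute)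

subsection \<open>Jacobi forms\<close>

definition qtrace :: "real^'m^'m \<Rightarrow> real^'n::finite^'m::finite \<Rightarrow> complex^'n^'n \<Rightarrow> complex" where
  "qtrace M P Z = trace (cmat_of_real M ** (cmat_of_real P ** Z ** transpose (cmat_of_real P)))"

definition theta :: "real^'m^'m \<Rightarrow> real^'n::finite^'m::finite \<Rightarrow> complex^'n^'n \<Rightarrow> complex" where
  "theta M P Z = exp (2 * of_real pi * \<i> * qtrace M P Z)"

lemma qtrace_expand: "qtrace M P Z =
    (\<Sum>i\<in>UNIV. \<Sum>k\<in>UNIV. \<Sum>b\<in>UNIV. \<Sum>a\<in>UNIV. of_real (M $ i $ k * P $ k $ a * P $ i $ b) * Z $ a $ b)"
  by (simp add: qtrace_def trace_def matrix_mult_nth transpose_def sum_distrib_left sum_distrib_right mult_ac)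

lemma qtrace_add: "qtrace M P (Z + Z') = qtrace M P Z + qtrace M P Z'"
  and qtrace_cscale: "qtrace M P (cscale c Z) = c * qtrace M P Z"
  by (simp_all add: qtrace_expand sum.distrib sum_distrib_left algebra_simps)

lemma bounded_linear_qtrace: "bounded_linear (qtrace M P)"
proof -
  have "linear (qtrace M P)"
  proof (rule linearI)
    show "qtrace M P (r *\<^sub>R Z) = r *\<^sub>R qtrace M P Z" for r Z
    proof -
      have "r *\<^sub>R Z = cscale (of_real r) Z" by (simp add: vec_eq_iff scaleR_conv_of_real[where 'a = complex])
      then show ?thesis by (simp add: qtrace_cscale scaleR_conv_of_real)
    qed
  qed (rule qtrace_add)
  then show ?thesis by (simp add: linear_conv_bounded_linear)
qed

lemma theta_nz: "theta M P Z \<noteq> 0"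
  by (simp add: theta_def)

lemma smooth_theta: "H.smooth (theta M P)"
  unfolding theta_def
  by (intro H.smooth_intros H.smooth_linear bounded_linear_qtrace)

text \<open>\<open>theta\<close> is holomorphic, its exponent being complex linear in Z; hence its
  conjugate has no holomorphic derivative.\<close>

lemma wd_cnj_theta:
  assumes Z: "Z \<in> siegel" and U: "U \<in> sym_mats"
  shows "wd U (\<lambda>Z. cnj (theta M P Z)) Z = 0"
proof -
  have q: "(qtrace M P has_derivative qtrace M P) (at Z within siegel)"
    by (rule bounded_linear_imp_has_derivative[OF bounded_linear_qtrace])
  have "((\<lambda>Z. exp (2 * of_real pi * \<i> * qtrace M P Z)) has_derivative
      (\<lambda>V. exp (2 * of_real pi * \<i> * qtrace M P Z) * (2 * of_real pi * \<i> * qtrace M P V))) (at Z within siegel)"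
    using has_derivative_compose[OF has_derivative_mult_right[OF q, of "2 * of_real pi * \<i>"]
        DERIV_exp[unfolded has_field_derivative_def]] .
  then have "(theta M P has_derivative (\<lambda>V. theta M P Z * (2 * of_real pi * \<i> * qtrace M P V))) (at Z within siegel)"
    unfolding theta_def[abs_def] .
  from wd_eq[OF has_derivative_cnj[OF this] Z U] show ?thesis
    by (simp add: qtrace_cscale algebra_simps)
qed

lemma theta_mult_cnj:
  "theta M P Z * cnj (theta M P Z) = of_real (exp (- 4 * pi * trace (M ** P ** Im_mat Z ** transpose P)))"
proof -
  have "Im (qtrace M P Z) = trace (M ** P ** Im_mat Z ** transpose P)"
  proof -
    have "Im (trace (cmat_of_real M ** X)) = trace (M ** Im_mat X)" for X
      by (simp add: trace_def matrix_mult_nth)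
    moreover have "trace (M ** P ** Im_mat Z ** transpose P) = trace (M ** (P ** Im_mat Z ** transpose P))"
      by (simp only: matrix_mul_assoc)
    ultimately show ?thesis
      by (simp only: qtrace_def transpose_map_matrix Im_mat_congr)
  qed
  then have "cmod (theta M P Z) ^ 2 = exp (- 4 * pi * trace (M ** P ** Im_mat Z ** transpose P))"
    by (simp add: theta_def flip: exp_of_nat_mult)
  then show ?thesis by (metis complex_norm_square)
qed

section \<open>The operator H on a slice\<close>

lemma trace_MVYV_slice:
  assumes Z: "Z \<in> siegel"
  shows "trace_MVYV M (slice P Q Z) = trace (M ** P ** Im_mat Z ** transpose P)"
proof -
  have Im: "Im_mat (cmat_of_real P ** Z + cmat_of_real Q) = P ** Im_mat Z"
    by (simp add: vec_eq_iff matrix_mult_nth)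
  have nz: "det (Im_mat Z) \<noteq> 0" using siegel_det_pos[OF Z] by simp
  have sym: "transpose (Im_mat Z) = Im_mat Z"
    using siegel_sym[OF Z] by (simp add: transpose_map_matrix sym_mats_transpose)
  have "M ** (P ** Im_mat Z) ** matrix_inv (Im_mat Z) ** transpose (P ** Im_mat Z) =
      M ** P ** (Im_mat Z ** matrix_inv (Im_mat Z)) ** Im_mat Z ** transpose P"
    unfolding matrix_transpose_mul sym by (simp only: matrix_mul_assoc)
  then show ?thesis unfolding trace_MVYV_def slice_def prod.case Im by (simp add: matrix_inv_right[OF nz])
qed

lemma sj_smooth_weight:
  "sj.smooth (\<lambda>q. of_real (det (Im_mat (fst q)) powr s * exp (r * trace_MVYV M q)))"
  unfolding of_real_mult exp_of_real[symmetric]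
  by (intro sj.smooth_intros sj.smooth_powr sj_smooth_det_Im sj_det_pos sj_smooth_trace_MVYV)

text \<open>The constant (2 i)^n comes from the factor 2 i in X_+; it is the same on all slices and
  therefore drops out of the transformation law.\<close>

lemma H_op_slice:
  fixes f :: "('n::{finite,linorder}, 'm::finite) sj_point \<Rightarrow> complex"
  assumes f: "sj.smooth f" and Z: "Z \<in> siegel"
  shows "H_op k M f (slice P Q Z) =
    (2 * \<i>) ^ CARD('n) * inverse (theta M P Z) * maass k (\<lambda>Z. theta M P Z * f (slice P Q Z)) Z"
proof -
  let ?s = "of_int k + 1 - kappa TYPE('n)"
  let ?tr = "\<lambda>Z. trace (M ** P ** Im_mat Z ** transpose P)"
  let ?h = "\<lambda>q. of_real (det (Im_mat (fst q)) powr ?s * exp (- 4 * pi * trace_MVYV M q)) * f q"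
  let ?F = "\<lambda>Z. det_Im_powr ?s Z * (theta M P Z * f (slice P Q Z))"
  have sh: "sj.smooth ?h"
    by (rule sj.smooth_mult[OF sj_smooth_weight f])
  have sF: "H.smooth ?F"
    by (intro H.smooth_mult smooth_det_Im_powr smooth_theta smooth_slice f)
  have h_slice: "?h (slice P Q Z) = cnj (theta M P Z) * ?F Z" if "Z \<in> siegel" for Z
  proof -
    have "?h (slice P Q Z) = of_real (exp (- 4 * pi * ?tr Z)) * (det_Im_powr ?s Z * f (slice P Q Z))"
      unfolding trace_MVYV_slice[OF that] by (simp add: slice_def det_Im_powr_def mult_ac)
    then show ?thesis unfolding theta_mult_cnj[symmetric] by (simp only: mult_ac)
  qed
  have det: "wd_det Esym (\<lambda>Z. ?h (slice P Q Z)) Z = cnj (theta M P Z) * wd_det Esym ?F Z"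
  proof -
    have "wd_det Esym (\<lambda>Z. ?h (slice P Q Z)) Z = wd_det Esym (\<lambda>Z. cnj (theta M P Z) * ?F Z) Z"
      by (rule wd_det_cong_fun[OF smooth_slice[OF sh] h_slice Z])
    also have "\<dots> = cnj (theta M P Z) * wd_det Esym ?F Z"
      by (rule wd_det_antiholomorphic[OF H.smooth_cnj[OF smooth_theta] wd_cnj_theta sF Z])
    finally show ?thesis .
  qed
  \<comment> \<open>The conjugate of theta, once pulled out of the determinant, cancels one of the
    two factors of |theta|^-2 in front of the operator.\<close>
  have inv: "of_real (exp (4 * pi * ?tr Z)) * cnj (theta M P Z) = inverse (theta M P Z)"
  proof -
    have "of_real (exp (4 * pi * ?tr Z)) * (theta M P Z * cnj (theta M P Z)) = 1"
      unfolding theta_mult_cnj of_real_mult[symmetric] exp_add[symmetric] by simp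
    then show ?thesis using theta_nz[of M P Z] by (simp add: field_simps)
  qed
  have "H_op k M f (slice P Q Z) = of_real (det (Im_mat (fst (slice P Q Z))) powr (kappa TYPE('n) - of_int k - 1) *
      exp (4 * pi * trace_MVYV M (slice P Q Z))) * op_det X_plus ?h (slice P Q Z)"
    by (simp add: H_op_def kappa_def Let_def)
  also have "\<dots> = det_Im_powr (kappa TYPE('n) - of_int k - 1) Z * of_real (exp (4 * pi * ?tr Z)) *
      ((2 * \<i>) ^ CARD('n) * (cnj (theta M P Z) * wd_det Esym ?F Z))"
    unfolding op_det_slice[OF sh Z] det trace_MVYV_slice[OF Z] by (simp add: slice_def det_Im_powr_def)
  also have "\<dots> = (2 * \<i>) ^ CARD('n) * (of_real (exp (4 * pi * ?tr Z)) * cnj (theta M P Z)) *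
      (det_Im_powr (kappa TYPE('n) - of_int k - 1) Z * wd_det Esym ?F Z)"
    by (simp only: mult_ac)
  finally show ?thesis unfolding inv maass_def .
qed

lemma sj_smooth_H_op:
  assumes f: "sj.smooth f"
  shows "sj.smooth (H_op k M f)"
  unfolding H_op_def Let_def
  by (intro sj.smooth_mult[OF sj_smooth_weight] sj_smooth_op_det sj.smooth_mult[OF sj_smooth_weight f])

lemma slice_exists:
  assumes "(Z, W) \<in> siegel_jacobi_space"
  shows "\<exists>P Q. (Z, W) = slice P Q Z"
proof -
  have Z: "Z \<in> siegel" using assms by (simp add: sj_space_iff)
  \<comment> \<open>Imaginary parts in W = P Z + Q give V = P Y, which determines P; the real parts
    then determine Q.\<close>
  let ?P = "Im_mat W ** matrix_inv (Im_mat Z)"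
  let ?Q = "map_matrix Re W - ?P ** map_matrix Re Z"
  have "?P ** Im_mat Z = Im_mat W"
    using siegel_det_pos[OF Z] by (simp add: matrix_mul_assoc[symmetric] matrix_inv_left)
  then have "(\<Sum>k\<in>UNIV. ?P $ i $ k * Im (Z $ k $ j)) = Im (W $ i $ j)" for i j
    using matrix_mult_nth[of ?P "Im_mat Z" i j] by simp
  then have "W = cmat_of_real ?P ** Z + cmat_of_real ?Q"
    by (simp add: vec_eq_iff complex_eq_iff matrix_mult_nth[of "cmat_of_real ?P"] matrix_mult_nth[of ?P])
  then show ?thesis unfolding slice_def by blast
qed

text \<open>The group permutes slices, moving the row (P, Q) to (P + \<lambda>, Q + \<mu>) G^-1. The
  order of quantifiers carries the content: \<open>\<phi>\<close> and \<open>j\<close> are the same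
  for all slices, and the constant \<open>c\<close> depends neither on Z, so that it passes through
  \<open>maass\<close>, nor on k, so that it serves the weights k and k + 2 alike.\<close>

lemma jacobi_slice:
  fixes g :: "('n::finite, 'm::finite) jacobi_elt"
  assumes g: "g \<in> jacobi_group" and M: "symmetric_mat M"
  shows "\<exists>\<phi> j. equivariant \<phi> j \<and> (\<forall>P Q. \<exists>P' Q' c. c \<noteq> 0 \<and>
    (\<forall>Z\<in>siegel. jacobi_act g (slice P Q Z) = slice P' Q' (\<phi> Z) \<and>
      (\<forall>k. jacobi_factor k M g (slice P Q Z) = j Z powi k * (c * theta M P Z / theta M P' (\<phi> Z)))))"
proof -
  obtain A B C D l mu kap where g_eq: "g = ((A, B, C, D), (l, mu, kap))" by (metis surj_pair)
  define \<phi> where "\<phi> = (\<lambda>Z. (cmat_of_int A ** Z + cmat_of_int B) ** matrix_inv (cmat_of_int C ** Z + cmat_of_int D))"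
  define j where "j = (\<lambda>Z. det (cmat_of_int C ** Z + cmat_of_int D))"
  let ?r = "map_matrix real_of_int"
  have "block_mat A B C D \<in> Sp_int" using g by (simp add: g_eq jacobi_group_def)
  note rel = Sp_int_relations[OF this]
  have int: "cmat_of_int X = cmat_of_real (map_matrix real_of_int X)" for X :: "int^'a^'b"
    by (simp add: vec_eq_iff)
  have equi: "equivariant \<phi> j"
    unfolding \<phi>_def j_def int by (rule equivariant_symplectic[OF rel])
  define a b c d where abcd: "a = cmat_of_int A" "b = cmat_of_int B" "c = cmat_of_int C" "d = cmat_of_int D"
  have cast: "cmat_of_real (transpose X) = transpose (cmat_of_real X)" for X :: "real^'a^'b"
    by (simp add: transpose_map_matrix)
  have r1: "transpose a ** c = transpose c ** a" and r2: "transpose b ** d = transpose d ** b"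
    and r3: "transpose a ** d - transpose c ** b = mat 1"
    using arg_cong[OF rel(1), of cmat_of_real] arg_cong[OF rel(2), of cmat_of_real] arg_cong[OF rel(3), of cmat_of_real]
    unfolding abcd int map_matrix_of_real_mult map_matrix_diff cast map_matrix_mat1 .
  have r3': "transpose d ** a - transpose b ** c = mat 1"
    using arg_cong[OF r3, of transpose] by (simp add: transpose_simps)
  have "\<exists>P' Q' c. c \<noteq> 0 \<and>
    (\<forall>Z\<in>siegel. jacobi_act g (slice P Q Z) = slice P' Q' (\<phi> Z) \<and>
      (\<forall>k. jacobi_factor k M g (slice P Q Z) = j Z powi k * (c * theta M P Z / theta M P' (\<phi> Z))))" for P Q
  proof -
    let ?Pr = "P + ?r l" and ?Qr = "Q + ?r mu"
    \<comment> \<open>The row (P + \<lambda>, Q + \<mu>) times the inverse symplectic matrix, whose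
      blocks are D^t, -B^t, -C^t, A^t; \<open>pa\<close> and \<open>qb\<close> below express that
      multiplication by the matrix itself recovers the row.\<close>
    define P' where "P' = ?Pr ** transpose (?r D) - ?Qr ** transpose (?r C)"
    define Q' where "Q' = ?Qr ** transpose (?r A) - ?Pr ** transpose (?r B)"
    define p0 q0 p q p' q' l' mu' kap' M' where
      defs: "p0 = cmat_of_real P" "q0 = cmat_of_real Q" "p = cmat_of_real ?Pr" "q = cmat_of_real ?Qr"
        "p' = cmat_of_real P'" "q' = cmat_of_real Q'" "l' = cmat_of_int l" "mu' = cmat_of_int mu"
        "kap' = cmat_of_int kap" "M' = cmat_of_real M"
    have p: "p = p0 + l'" and q: "q = q0 + mu'" unfolding defs int by (simp_all add: map_matrix_add)
    have p': "p' = p ** transpose d - q ** transpose c" and q': "q' = q ** transpose a - p ** transpose b"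
      unfolding defs abcd int P'_def Q'_def by (simp_all add: map_matrix_diff map_matrix_of_real_mult transpose_map_matrix)
    have pa: "p' ** a + q' ** c = p"
    proof -
      have "p' ** a + q' ** c = p ** (transpose d ** a - transpose b ** c) + q ** (transpose a ** c - transpose c ** a)"
        unfolding p' q' by (simp add: matrix_distribs matrix_mul_assoc)
      then show ?thesis unfolding r3' r1 by (simp add: matrix_diff_ldistrib)
    qed
    have qb: "p' ** b + q' ** d = q"
    proof -
      have "p' ** b + q' ** d = p ** (transpose d ** b - transpose b ** d) + q ** (transpose a ** d - transpose c ** b)"
        unfolding p' q' by (simp add: matrix_distribs matrix_mul_assoc)
      then show ?thesis unfolding r3 r2 by (simp add: matrix_diff_ldistrib)
    qed
    let ?tr = "\<lambda>X. trace (M' ** X)"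
    have tr_add: "?tr (X + Y) = ?tr X + ?tr Y" and tr_diff: "?tr (X - Y) = ?tr X - ?tr Y" for X Y
      by (simp_all add: matrix_add_ldistrib matrix_diff_ldistrib trace_add trace_sub)
    have symM: "transpose M' = M'" using M by (simp add: defs symmetric_mat_def transpose_map_matrix)
    have tr_transpose: "?tr (transpose X) = ?tr X" for X
    proof -
      have "?tr (transpose X) = trace (transpose (X ** M'))" by (simp add: matrix_transpose_mul symM)
      also have "\<dots> = trace (X ** M')" by (simp add: trace_def transpose_def)
      also have "\<dots> = ?tr X" by (rule trace_mul_sym)
      finally show ?thesis .
    qed
    \<comment> \<open>The terms of the exponent that are free of Z.\<close>
    let ?c0 = "?tr (q ** transpose p) - ?tr (q' ** transpose p') - 2 * ?tr (l' ** transpose q0) - ?tr (kap' + mu' ** transpose l')"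
    let ?e = "\<lambda>z. exp (2 * of_real pi * \<i> * z) :: complex"
    have th: "theta M P Z = ?e (?tr (p0 ** Z ** transpose p0))" "theta M P' Z = ?e (?tr (p' ** Z ** transpose p'))" for Z
      by (simp_all add: theta_def qtrace_def defs)
    have main: "jacobi_act g (slice P Q Z) = slice P' Q' (\<phi> Z) \<and>
        (\<forall>k. jacobi_factor k M g (slice P Q Z) = j Z powi k * (?e ?c0 * theta M P Z / theta M P' (\<phi> Z)))"
      if Z: "Z \<in> siegel" for Z
    proof -
      let ?K = "l' ** Z ** transpose l' + 2 *\<^sub>R (l' ** transpose (p0 ** Z + q0)) + kap' + mu' ** transpose l'"
      let ?J = "c ** Z + d" and ?W = "p ** Z + q"
      have nz: "det ?J \<noteq> 0" using equi Z unfolding equivariant_def j_def abcd by blast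
      have symZ: "transpose Z = Z" using siegel_sym[OF Z] by (simp add: sym_mats_transpose)
      have \<phi>: "\<phi> Z = (a ** Z + b) ** matrix_inv ?J" by (simp add: \<phi>_def abcd)
      have denom: "aut_denom g Z = ?J" by (simp add: g_eq aut_denom_def abcd)
      have shift: "heis_shift g (slice P Q Z) = ?W"
        unfolding p q by (simp add: g_eq heis_shift_def slice_def defs(1,2,7,8) matrix_add_rdistrib add_ac)
      have W: "?W = p' ** (a ** Z + b) + q' ** ?J"
      proof -
        have "p' ** (a ** Z + b) + q' ** ?J = (p' ** a + q' ** c) ** Z + (p' ** b + q' ** d)"
          by (simp add: matrix_add_ldistrib matrix_add_rdistrib matrix_mul_assoc add_ac)
        then show ?thesis unfolding pa qb by simp
      qed
      have dist: "(X ** Y + Q ** J) ** K = X ** (Y ** K) + Q ** (J ** K)"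
        for X Q :: "complex^'n^'m" and Y J K :: "complex^'n^'n"
        by (simp only: matrix_add_rdistrib matrix_mul_assoc)
      have W': "?W ** matrix_inv ?J = p' ** \<phi> Z + q'"
        unfolding W dist \<phi> by (simp add: matrix_inv_right[OF nz])
      have act: "jacobi_act g (slice P Q Z) = slice P' Q' (\<phi> Z)"
      proof -
        have "jacobi_act g (slice P Q Z) = ((a ** Z + b) ** matrix_inv (aut_denom g Z),
            heis_shift g (slice P Q Z) ** matrix_inv (aut_denom g Z))"
          by (simp add: g_eq jacobi_act_def slice_def abcd)
        then show ?thesis unfolding denom shift W' by (simp add: slice_def \<phi> defs)
      qed
      have quad: "?W ** matrix_inv ?J ** c ** transpose ?W =
          p ** Z ** transpose p + q ** transpose p - q' ** transpose p' - p' ** \<phi> Z ** transpose p'"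
      proof -
        let ?V = "?W ** matrix_inv ?J"
        \<comment> \<open>The formula for p' gives c W^t + p'^t = (c Z + d) p^t, so the inverse
          cancels without being expanded.\<close>
        have "?V ** (c ** transpose ?W) + ?V ** transpose p' = ?V ** ?J ** transpose p"
          unfolding p' by (simp add: transpose_simps symZ matrix_distribs matrix_mul_assoc)
        also have "?V ** ?J = ?W" by (simp add: matrix_mul_assoc[symmetric] matrix_inv_left[OF nz])
        finally have "?V ** (c ** transpose ?W) + (p' ** \<phi> Z + q') ** transpose p' = ?W ** transpose p"
          unfolding W' .
        then show ?thesis by (simp add: matrix_add_rdistrib matrix_mul_assoc algebra_simps)
      qed
      \<comment> \<open>Symmetry of M and Z merges the two mixed terms into one with coefficient 2,
        which then cancels against the term 2 \<lambda> W^t of the exponent.\<close>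
      have cross: "?tr (p0 ** Z ** transpose l') = ?tr (l' ** Z ** transpose p0)"
        using tr_transpose[of "l' ** Z ** transpose p0"] by (simp add: matrix_transpose_mul symZ matrix_mul_assoc)
      have pZp: "?tr (p ** Z ** transpose p) = ?tr (p0 ** Z ** transpose p0) + 2 * ?tr (l' ** Z ** transpose p0) + ?tr (l' ** Z ** transpose l')"
        unfolding p by (simp add: transpose_add matrix_add_ldistrib matrix_add_rdistrib tr_add trace_add cross[symmetric] add_ac)
      have two: "?tr (2 *\<^sub>R X) = 2 * ?tr X" for X
        by (simp add: trace_def matrix_mult_nth scaleR_conv_of_real[where 'a = complex] sum_distrib_left mult_ac)
      have lin: "?tr (?K) =
          ?tr (l' ** Z ** transpose l') + 2 * ?tr (l' ** Z ** transpose p0) + 2 * ?tr (l' ** transpose q0) + ?tr (kap' + mu' ** transpose l')"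
        unfolding add.assoc[of _ kap'] tr_add two transpose_add matrix_transpose_mul symZ
        by (simp add: matrix_add_ldistrib tr_add trace_add matrix_mul_assoc algebra_simps)
      have expo: "trace (M' ** ?W ** matrix_inv ?J ** c ** transpose ?W
          - M' ** (?K)) =
          ?c0 + ?tr (p0 ** Z ** transpose p0) - ?tr (p' ** \<phi> Z ** transpose p')"
      proof -
        have assoc: "M' ** ?W ** matrix_inv ?J ** c ** transpose ?W = M' ** (?W ** matrix_inv ?J ** c ** transpose ?W)"
          by (simp only: matrix_mul_assoc)
        show ?thesis
          unfolding trace_sub lin assoc unfolding quad tr_diff tr_add pZp by simp
      qed
      have "jacobi_factor k M g (slice P Q Z) = j Z powi k * (?e ?c0 * theta M P Z / theta M P' (\<phi> Z))" for k
      proof -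
        have "jacobi_factor k M g (slice P Q Z) = det (aut_denom g Z) powi k *
            ?e (trace (M' ** heis_shift g (slice P Q Z) ** matrix_inv (aut_denom g Z) ** c ** transpose (heis_shift g (slice P Q Z))
          - M' ** (?K)))"
          by (simp add: g_eq jacobi_factor_def slice_def Let_def abcd defs)
        also have "\<dots> = j Z powi k * ?e (?c0 + ?tr (p0 ** Z ** transpose p0) - ?tr (p' ** \<phi> Z ** transpose p'))"
          unfolding denom shift expo by (simp only: j_def abcd)
        finally show ?thesis
          unfolding th by (simp only: exp_add exp_diff right_diff_distrib distrib_left)
      qed
      then show ?thesis using act by blast
    qed
    show ?thesis
      by (rule exI[of _ P'], rule exI[of _ Q'], rule exI[of _ "?e ?c0"]) (use main in simp)
  qed
  then show ?thesis using equi by blast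
qed

theorem theorem3p8:
  fixes k :: int and M :: "real^'m^'m"
  assumes "positive_definite M" and "half_integral M"
  shows "\<forall>f \<in> (jacobi_forms k M :: (('n::{finite,linorder}, 'm) sj_point \<Rightarrow> complex) set).
           H_op k M f \<in> jacobi_forms (k + 2) M"
proof
  fix f :: "('n, 'm) sj_point \<Rightarrow> complex"
  assume "f \<in> jacobi_forms k M"
  then have f: "sj.smooth f"
    and f_eq: "\<And>g p. g \<in> jacobi_group \<Longrightarrow> p \<in> siegel_jacobi_space \<Longrightarrow> f (jacobi_act g p) = jacobi_factor k M g p * f p"
    by (auto simp: jacobi_forms_def smooth_sj_iff)
  have "H_op k M f (jacobi_act g p) = jacobi_factor (k + 2) M g p * H_op k M f p"
    if g: "g \<in> jacobi_group" and p: "p \<in> siegel_jacobi_space" for g p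
  proof -
    obtain Z0 W0 where p_eq: "p = (Z0, W0)" by (cases p)
    then have Z0: "Z0 \<in> siegel" using p by (simp add: sj_space_iff)
    obtain P Q where PQ: "p = slice P Q Z0" using slice_exists p p_eq by blast
    have "symmetric_mat M" using assms(1) by (simp add: positive_definite_def)
    from jacobi_slice[OF g this]
    obtain \<phi> j where equi: "equivariant \<phi> j"
      and "\<exists>P' Q' c. c \<noteq> 0 \<and> (\<forall>Z\<in>siegel. jacobi_act g (slice P Q Z) = slice P' Q' (\<phi> Z) \<and>
        (\<forall>k. jacobi_factor k M g (slice P Q Z) = j Z powi k * (c * theta M P Z / theta M P' (\<phi> Z))))"
      by blast
    then obtain P' Q' c where ex: "c \<noteq> 0 \<and> (\<forall>Z\<in>siegel. jacobi_act g (slice P Q Z) = slice P' Q' (\<phi> Z) \<and>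
        (\<forall>k. jacobi_factor k M g (slice P Q Z) = j Z powi k * (c * theta M P Z / theta M P' (\<phi> Z))))"
      by (elim exE)
    have act: "jacobi_act g (slice P Q Z) = slice P' Q' (\<phi> Z)"
      and factor: "jacobi_factor k M g (slice P Q Z) = j Z powi k * (c * theta M P Z / theta M P' (\<phi> Z))"
      if "Z \<in> siegel" for Z k
      using ex that by simp_all
    have \<phi>: "\<phi> Z \<in> siegel" and j: "j Z \<noteq> 0" if "Z \<in> siegel" for Z
      using equi that unfolding equivariant_def by blast+
    let ?G = "\<lambda>Z. theta M P Z * f (slice P Q Z)" and ?G' = "\<lambda>Z. theta M P' Z * f (slice P' Q' Z)"
    have sG: "H.smooth ?G" and sG': "H.smooth ?G'"
      by (intro H.smooth_mult smooth_theta smooth_slice f)+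
    \<comment> \<open>Up to the constant c, theta f on the slice (P, Q) is the weight k slash of
      theta f on the slice (P', Q'). These are in general different functions of Z, which is why
      \<open>equivariant\<close> is stated for arbitrary F.\<close>
    have rel: "c * ?G Z = j Z powi (- k) * ?G' (\<phi> Z)" if Z: "Z \<in> siegel" for Z
      using f_eq[OF g slice_in_space[OF Z, of P Q]] j[OF Z] theta_nz[of M P' "\<phi> Z"]
      unfolding act[OF Z] factor[OF Z] by (simp add: power_int_minus field_simps)
    have "c * maass k ?G Z0 = maass k (\<lambda>Z. j Z powi (- k) * ?G' (\<phi> Z)) Z0"
      unfolding maass_cmult[OF sG Z0, symmetric]
      by (rule maass_cong[OF H.smooth_mult[OF H.smooth_const sG] rel Z0])
    also have "\<dots> = j Z0 powi (- k - 2) * maass k ?G' (\<phi> Z0)"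
      using equi sG' Z0 unfolding equivariant_def by blast
    finally have "maass k ?G' (\<phi> Z0) = j Z0 powi (k + 2) * (c * maass k ?G Z0)"
    proof -
      assume eq: "c * maass k ?G Z0 = j Z0 powi (- k - 2) * maass k ?G' (\<phi> Z0)"
      have "j Z0 powi (k + 2) * j Z0 powi (- k - 2) = 1"
        using j[OF Z0] by (simp flip: power_int_add)
      then show ?thesis unfolding eq mult.assoc[symmetric] by simp
    qed
    \<comment> \<open>Division by the two thetas restores the Jacobi factor, now of weight k + 2 and
      with the same c.\<close>
    then have "H_op k M f (slice P' Q' (\<phi> Z0)) =
        j Z0 powi (k + 2) * (c * theta M P Z0 / theta M P' (\<phi> Z0)) * H_op k M f (slice P Q Z0)"
      unfolding H_op_slice[OF f \<phi>[OF Z0]] H_op_slice[OF f Z0] using theta_nz[of M P Z0]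
      by (simp add: field_simps)
    then show ?thesis unfolding PQ act[OF Z0] factor[OF Z0] .
  qed
  then show "H_op k M f \<in> jacobi_forms (k + 2) M"
    by (simp add: jacobi_forms_def smooth_sj_iff sj_smooth_H_op[OF f])
qed

end
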